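(* Let $p$ be a prime, fix an algebraic closure $\overline{\mathbb{Q}}$ of $\mathbb{Q}$ and a prime $\mathfrak{p}$ of the ring of integers $\mathcal{O}_{\overline{\mathbb{Q}}}$ lying over $p$; identify $\overline{\mathbb{F}}_p=\mathcal{O}_{\overline{\mathbb{Q}}}/\mathfrak{p}$ and let $\mathbb{F}_q\subset\overline{\mathbb{F}}_p$ be the subfield with $q$ elements. Let Gauss sums $G_q(a)$ and Jacobi sums $J_q(\mathbf{a})$ and the sets $A'_{d,w}$ be as in the context. \begin{enumerate} \item Fix a real number $\epsilon>0$ and a positive integer $n$. There exists a constant $C_{\epsilon,n}$ depending only on $\epsilon$ and $n$ such that if $d>C_{\epsilon,n}$, $q=p^f\equiv 1\pmod d$, $a\in(\mathbb{Z}/d\mathbb{Z})^\times$, and the degree of $G_q(a)$ over $\mathbb{Q}(\mu_p)$ is $\le n$, then $$\left|\frac{\operatorname{ord}_\wp G_q(a)}{(p-1)f}-\frac12\right|<\epsilon,$$ where $\wp$ is the prime of $\mathbb{Q}(\mu_{pd})$ under $\mathfrak{p}$. \item Fix a positive integer $n$. There exist constants $C_n$ and $\epsilon_n>0$ depending only on $n$ such that if $d>C_n$, $q=p^f\equiv 1\pmod d$, $w\ge 1$, $\mathbf{a}\in A'_{d,w}$, and the degree of $J_q(\mathbf{a})$ over $\mathbb{Q}$ is $\le n$, then $$\frac{\operatorname{ord}_\wp J_q(\mathbf{a})}{f}>\epsilon_n,$$ where $\wp$ is the prime of $\mathbb{Q}(\mu_d)$ under $\mathfrak{p}$. \end{e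numerate}
   Context: $\mu_d$ denotes the group of $d$-th roots of unity in $\overline{\mathbb{Q}}$. Reduction modulo $\mathfrak{p}$ gives an isomorphism from the group of roots of unity of order prime to $p$ in $\mathcal{O}_{\overline{\mathbb{Q}}}$ onto $\overline{\mathbb{F}}_p^\times$; let $t:\overline{\mathbb{F}}_p^\times\to\overline{\mathbb{Q}}^\times$ be its inverse (and its restriction to $\mathbb{F}_q^\times$). Fix a nontrivial additive character $\psi_p:\mathbb{F}_p\to\overline{\mathbb{Q}}^\times$ and put $\psi_q=\psi_p\circ\operatorname{tr}_{\mathbb{F}_q/\mathbb{F}_p}$. For a character $\chi$ of $\mathbb{F}_q^\times$, $G_q(\chi)=-\sum_{x\in\mathbb{F}_q^\times}\chi(x)\psi_q(x)$. For $d\mid q-1$ and $a\in\mathbb{Z}/d\mathbb{Z}$, $G_q(a):=G_q(t^{-a(q-1)/d})\in\mathbb{Q}(\mu_{pd})$. For $w\ge1$ and nontrivial characters $\chi_0,\dots,\chi_{w+1}$ of $\mathbb{F}_q^\times$ with trivial product, $J_q(\chi_0,\dots,\chi_{w+1})=\frac{1}{q-1}\sum_{x_0,\dots,x_{w+1}\in\mathbb{F}_q^\times,\ x_0+\cdots+x_{w+1}=0}\chi_0(x_0)\cdots\chi_{w+1}(x_{w+1})$. $A_{d,w}\subset(\mathbb{Z}/d\mathbb{Z})^{w+2}$ is the set of tuples $\mathbf{a}=(a_0,\dots,a_{w+1})$ with all $a_i\ne0$ and $\sum a_i=0$; $A'_{d,w}$ is the subset with $\gcd(d,a_0,\dots,a_{w+1})=1$.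 For $\mathbf{a}\in A_{d,w}$ and $q\equiv1\pmod d$, $J_q(\mathbf{a}):=J_q(t^{-a_0(q-1)/d},\dots,t^{-a_{w+1}(q-1)/d})\in\mathbb{Q}(\mu_d)$. $\operatorname{ord}_\wp$ is the normalized valuation at $\wp$ (so $\operatorname{ord}_\wp(q)=(p-1)f$ in $\mathbb{Q}(\mu_{pd})$ and $\operatorname{ord}_\wp(q)=f$ in $\mathbb{Q}(\mu_d)$). *)

theory Defs
  imports Complex_Main "HOL-Computational_Algebra.Polynomial" "HOL-Algebra.Ideal"
    "HOL-Library.FuncSet"
begin

text \<open>We take the algebraic closure of Q to be the algebraic numbers inside the complex numbers.\<close>

definition alg_int :: "complex \<Rightarrow> bool" where
  "alg_int x \<longleftrightarrow> (\<exists>P :: int poly. lead_coeff P = 1 \<and> poly (map_poly of_int P) x = 0)"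

definition AI_ring :: "complex ring" where
  "AI_ring = \<lparr>carrier = {x. alg_int x}, monoid.mult = (*), one = 1, zero = 0, add = (+)\<rparr>"

definition prime_over :: "complex set \<Rightarrow> nat \<Rightarrow> bool" where
  "prime_over P p \<longleftrightarrow> primeideal P AI_ring \<and> (of_nat p :: complex) \<in> P"

text \<open>The (Q-valued) valuation on the algebraic numbers attached to the prime P over p,
  normalised so that v(p) = 1: v(x) is the supremum of m/n (n > 0) such that
  x^n / p^m lies in the localisation of the algebraic integers at P.\<close>
definition val :: "complex set \<Rightarrow> nat \<Rightarrow> complex \<Rightarrow> real" where
  "val P p x = Sup {real_of_int m / real n | m n. n > 0 \<and>
      (\<exists>a b. alg_int a \<and> alg_int b \<and> b \<notin> P \<and> b * x ^ n = (of_nat p) powi m * a)}"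

definition mu :: "nat \<Rightarrow> complex set" where
  "mu m = {z. z ^ m = 1}"

definition cyc_field :: "nat \<Rightarrow> complex set" where
  "cyc_field m = {x. \<exists>r :: nat \<Rightarrow> rat.
      x = (\<Sum>k<m. of_rat (r k) * exp (2 * pi * \<i> * of_nat k / of_nat m))}"

definition alg_degree :: "complex set \<Rightarrow> complex \<Rightarrow> nat" where
  "alg_degree K x = (LEAST n. \<exists>Q :: complex poly. Q \<noteq> 0 \<and> degree Q = n \<and>
      (\<forall>i. coeff Q i \<in> K) \<and> poly Q x = 0)"

text \<open>Finite field model.  Reduction modulo P identifies mu (q-1) with F_q^*, the inverse
  being the Teichmueller map t.  Hence an element of F_q^* is represented by its lift
  z in mu (q-1), and t(x) = z.  For x in F_q with lift z, tr_{F_q/F_p}(x) is the reduction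
  of the algebraic integer sum_{i<f} z^(p^i); it lies in F_p = Z/p, i.e. it is the class
  of an integer k with sum - k in P.  A nontrivial additive character of F_p = Z/p is
  k \<mapsto> exp(2 pi i c k / p) with c not divisible by p.\<close>

definition trace_int :: "complex set \<Rightarrow> nat \<Rightarrow> nat \<Rightarrow> complex \<Rightarrow> int" where
  "trace_int P p f z = (SOME k. (\<Sum>i<f. z ^ (p ^ i)) - of_int k \<in> P)"

definition psi_q :: "complex set \<Rightarrow> nat \<Rightarrow> int \<Rightarrow> nat \<Rightarrow> complex \<Rightarrow> complex" where
  "psi_q P p c f z = exp (2 * pi * \<i> * of_int (c * trace_int P p f z) / of_nat p)"

definition chr :: "nat \<Rightarrow> nat \<Rightarrow> int \<Rightarrow> complex \<Rightarrow> complex" where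
  "chr q d a z = z powi (- (a * int ((q - 1) div d)))"

definition gauss :: "complex set \<Rightarrow> nat \<Rightarrow> int \<Rightarrow> nat \<Rightarrow> nat \<Rightarrow> int \<Rightarrow> complex" where
  "gauss P p c f d a = - (\<Sum>z\<in>mu (p ^ f - 1). chr (p ^ f) d a z * psi_q P p c f z)"

text \<open>Jacobi sum J_q(a_0,...,a_{w+1}); tuples (x_0,...,x_{w+1}) in (F_q^*)^{w+2} with
  x_0 + ... + x_{w+1} = 0 correspond to tuples of lifts whose sum reduces to 0 mod P.\<close>
definition jacobi :: "complex set \<Rightarrow> nat \<Rightarrow> nat \<Rightarrow> nat \<Rightarrow> (nat \<Rightarrow> int) \<Rightarrow> complex" where
  "jacobi P q d w a = (1 / of_nat (q - 1)) *
     (\<Sum>x \<in> {x \<in> PiE {..w+1} (\<lambda>_. mu (q - 1)). (\<Sum>i\<le>w+1. x i) \<in> P}.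
        \<Prod>i\<le>w+1. chr q d (a i) (x i))"

definition A'_set :: "nat \<Rightarrow> nat \<Rightarrow> (nat \<Rightarrow> int) set" where
  "A'_set d w = {a. (\<forall>i\<le>w+1. \<not> int d dvd a i) \<and> int d dvd (\<Sum>i\<le>w+1. a i) \<and>
                    Gcd (insert (int d) (a ` {..w+1})) = 1}"

end

theory Submission
  imports Defs "HOL-Analysis.Analysis" "HOL-Number_Theory.Number_Theory" "HOL-Real_Asymp.Real_Asymp"
    "HOL-Library.Real_Mod"
begin

text \<open>Stickelberger's theorem gives the valuation of \<open>G\<^sub>q(a)\<close>, divided by \<open>f\<close>, as the mean of the
  fractional parts \<open>\<langle>p\<^sup>i a / d\<rangle>\<close>. If the degree of the sum is at most \<open>n\<close>, its stabiliser
  \<open>H\<close> in \<open>(\<int>/d)\<^sup>*\<close> has index at most \<open>n\<close> and contains \<open>p\<close>, so the mean may be taken over the multiples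
  \<open>t a / d\<close> with \<open>t \<in> H\<close> instead. These are nearly equidistributed for large \<open>d\<close>: in the finite Fourier
  expansion of the fractional part, the exponential sum over \<open>H\<close> at frequency \<open>k\<close> is at most \<open>\<surd>(d k)\<close> by
  Parseval, while \<open>\<phi>(d)\<close> is at least of the order \<open>d / log d\<close>. Hence the mean is close to \<open>1/2\<close> for \<open>a\<close>
  prime to \<open>d\<close>, which is the claim for Gauss sums.

  For Jacobi sums the valuation is the sum of the means for \<open>a\<^sub>0, \<dots>, a\<^sub>w\<^sub>+\<^sub>1\<close> minus \<open>1\<close>. Terms whose exact
  denominator is large contribute nearly \<open>1/2\<close>, terms with a small denominator contribute an amount
  bounded below. Three large denominators suffice; otherwise, since the \<open>a\<^sub>i\<close> sum to zero and
  generate \<open>\<int>/d\<close>, there are exactly two, both of them comparable to \<open>d\<close>, and at least one small one.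

  The upper bound in Stickelberger's theorem comes from \<open>G(k) G(1) = J \<sqdot> G(k + 1)\<close> with \<open>J\<close> integral
  and \<open>G(p k) = G(k)\<close>; since \<open>G(k) G(-k)\<close> is \<open>q\<close> up to a unit, the upper bounds for \<open>k\<close> and \<open>-k\<close>
  are both attained.\<close>

section \<open>Additive characters and fractional parts modulo n\<close>

definition unity_root :: "nat \<Rightarrow> int \<Rightarrow> complex" where
  "unity_root n k = cis (2 * pi * (real_of_int k / real n))"

lemma exp_eq_unity_root:
  "exp (2 * pi * \<i> * of_int k / of_nat n) = unity_root n k"
  by (simp add: unity_root_def cis_conv_exp mult_ac)

lemma unity_root_0 [simp]: "unity_root n 0 = 1"
  by (simp add: unity_root_def)

lemma unity_root_add: "unity_root n (k + l) = unity_root n k * unity_root n l"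
  by (simp add: unity_root_def cis_mult add_divide_distrib algebra_simps)

lemma cnj_unity_root: "cnj (unity_root n k) = unity_root n (- k)"
  by (simp add: unity_root_def cis_cnj)

lemma unity_root_diff: "unity_root n (k - l) = unity_root n k * cnj (unity_root n l)"
  using unity_root_add[of n k "- l"] by (simp add: cnj_unity_root)

lemma unity_root_power: "unity_root n k ^ m = unity_root n (int m * k)"
  by (simp add: unity_root_def Complex.DeMoivre mult_ac)

lemma unity_root_mult_cancel: "m > 0 \<Longrightarrow> unity_root (m * n) (int m * k) = unity_root n k"
  by (simp add: unity_root_def)

lemma unity_root_eq_1_iff:
  assumes "n > 0"
  shows "unity_root n k = 1 \<longleftrightarrow> int n dvd k"
proof -
  have "cis (2 * pi * x) = 1 \<longleftrightarrow> x \<in> \<int>" for x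
    by (auto simp: cis_eq_1_iff Ints_def)
  then have "unity_root n k = 1 \<longleftrightarrow> real_of_int k / of_int (int n) \<in> \<int>"
    by (simp only: unity_root_def of_int_of_nat_eq)
  also have "\<dots> \<longleftrightarrow> int n dvd k"
    using assms by (simp only: of_int_div_of_int_in_Ints_iff) simp
  finally show ?thesis .
qed

lemma unity_root_cong:
  assumes "[k = l] (mod int n)"
  shows "unity_root n k = unity_root n l"
proof (cases "n = 0")
  case False
  then have "unity_root n (k - l) = 1"
    using assms by (simp add: unity_root_eq_1_iff cong_iff_dvd_diff)
  then show ?thesis
    using unity_root_add[of n "k - l" l] by simp
qed (simp add: unity_root_def)

lemma unity_root_mult_power: "m > 0 \<Longrightarrow> unity_root (m * n) k ^ (m * l) = unity_root n (k * int l)"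
  using unity_root_mult_cancel[of m n "k * int l"] by (simp add: unity_root_power mult_ac)

lemma unity_root_mult_power_cong_1:
  assumes "m > 0" "[s = 1] (mod n)"
  shows "unity_root (m * n) (int s) ^ (m * l) = unity_root n (int l)"
proof -
  have "[int s * int l = 1 * int l] (mod int n)"
    using assms(2) cong_int_iff[of s 1 n] by (intro cong_mult cong_refl) simp
  from unity_root_cong[OF this] show ?thesis using assms(1) by (simp add: unity_root_mult_power)
qed

lemma sum_unity_root:
  assumes "n > 0"
  shows "(\<Sum>b<n. unity_root n (int b * k)) = (if int n dvd k then of_nat n else 0)"
proof -
  have powers: "unity_root n (int b * k) = unity_root n k ^ b" for b
    by (simp add: unity_root_power)
  show ?thesis
  proof (cases "int n dvd k")
    case True
    then show ?thesis
      using assms by (simp add: powers unity_root_eq_1_iff[THEN iffD2])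
  next
    case False
    then have "unity_root n k \<noteq> 1" "unity_root n k ^ n = 1"
      using assms by (simp_all add: unity_root_power unity_root_eq_1_iff)
    then show ?thesis
      using False by (simp add: powers geometric_sum)
  qed
qed

lemma sin_pi_times_ge:
  assumes "0 \<le> x" "x \<le> 1 / 2"
  shows "sin (pi * x) \<ge> 2 * x"
proof -
  have "concave_on {0..pi / 2} sin"
    by (rule f''_le0_imp_concave[where f' = cos and f'' = "\<lambda>x. - sin x"])
      (auto intro!: derivative_eq_intros sin_ge_zero)
  from concave_onD[OF this, of "2 * x" 0 "pi / 2"] show ?thesis
    using assms by (simp add: mult_ac)
qed

lemma norm_unity_root_minus_1_ge:
  assumes "2 * b \<le> n"
  shows "norm (unity_root n (int b) - 1) \<ge> 4 * real b / real n"
proof (cases "n = 0")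
  case False
  define x where "x = pi * (real b / real n)"
  have "unity_root n (int b) = cis (2 * x)"
    by (simp add: unity_root_def x_def mult.assoc)
  then have "unity_root n (int b) - 1 = 2 * \<i> * of_real (sin x) * cis x"
    by (simp add: complex_eq_iff sin_double cos_double_sin power2_eq_square)
  then have "norm (unity_root n (int b) - 1) = 2 * \<bar>sin x\<bar>"
    by (simp add: norm_mult)
  moreover have "real b / real n \<le> 1 / 2"
    using False assms by (simp add: field_simps)
  then have "sin x \<ge> 2 * (real b / real n)"
    unfolding x_def by (intro sin_pi_times_ge) auto
  ultimately show ?thesis by linarith
qed simp

definition mod_frac :: "nat \<Rightarrow> int \<Rightarrow> real" where
  "mod_frac n k = real_of_int (k mod int n) / real n"

lemma mod_frac_0 [simp]: "mod_frac n 0 = 0"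
  by (simp add: mod_frac_def)

lemma mod_frac_nonneg: "mod_frac n k \<ge> 0"
  by (cases "n = 0") (simp_all add: mod_frac_def)

lemma mod_frac_ge: "n > 0 \<Longrightarrow> \<not> int n dvd k \<Longrightarrow> mod_frac n k \<ge> 1 / real n"
  by (simp add: mod_frac_def divide_right_mono dvd_eq_mod_eq_0 order_le_neq_trans int_one_le_iff_zero_less)

lemma mod_frac_cong: "[k = l] (mod int n) \<Longrightarrow> mod_frac n k = mod_frac n l"
  by (simp add: mod_frac_def cong_def)

lemma mod_frac_mult_cancel: "m > 0 \<Longrightarrow> mod_frac (m * n) (int m * k) = mod_frac n k"
  by (simp add: mod_frac_def)

lemma mod_frac_uminus:
  assumes "n > 0" "\<not> int n dvd k"
  shows "mod_frac n (- k) = 1 - mod_frac n k"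
  using assms by (simp add: mod_frac_def zmod_zminus1_eq_if dvd_eq_mod_eq_0 field_simps)

lemma sum_of_nat_times_root_of_unity_power:
  fixes w :: "'a :: field"
  assumes "w ^ n = 1" "w \<noteq> 1"
  shows "(\<Sum>i<n. of_nat i * w ^ i) = of_nat n / (w - 1)"
proof -
  have "(w - 1) * (\<Sum>i<m. of_nat i * w ^ i) = of_nat m * w ^ m - w * (\<Sum>i<m. w ^ i)" for m
    by (induction m) (simp_all add: algebra_simps)
  moreover have "(\<Sum>i<n. w ^ i) = 0"
    using assms by (simp add: geometric_sum)
  ultimately have "(w - 1) * (\<Sum>i<n. of_nat i * w ^ i) = of_nat n"
    using assms(1) by simp
  then show ?thesis
    using assms(2) by (simp add: eq_divide_eq mult.commute)
qed

definition fourier_coefficient :: "nat \<Rightarrow> nat \<Rightarrow> complex" where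
  "fourier_coefficient n b = (\<Sum>i<n. of_nat i * unity_root n (- int b) ^ i)"

lemma fourier_coefficient_0: "fourier_coefficient n 0 = of_nat n * ((of_nat n - 1) / 2)"
proof -
  have "2 * (\<Sum>i<m. of_nat i) = (of_nat m * (of_nat m - 1) :: complex)" for m
    by (induction m) (simp_all add: algebra_simps)
  from this[of n] show ?thesis by (simp add: fourier_coefficient_def mult.commute)
qed

lemma fourier_coefficient_pos:
  assumes "b \<in> {1..<n}"
  shows "fourier_coefficient n b = of_nat n / (unity_root n (- int b) - 1)"
  unfolding fourier_coefficient_def
  using assms zdvd_not_zless[of "int b" "int n"]
  by (intro sum_of_nat_times_root_of_unity_power) (auto simp: unity_root_power unity_root_eq_1_iff)

lemma residue_fourier_inversion:
  assumes "r < n"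
  shows "of_nat r = (\<Sum>b<n. unity_root n (int b * int r) * fourier_coefficient n b) / of_nat n"
proof -
  have n: "n > 0" using assms by simp
  have "(of_nat r :: complex) = (\<Sum>i<n. if i = r then of_nat i else 0)"
    using assms by simp
  also have "\<dots> = (\<Sum>i<n. of_nat i * ((\<Sum>b<n. unity_root n (int b * (int r - int i))) / of_nat n))"
  proof (intro sum.cong refl)
    fix i assume "i \<in> {..<n}"
    then have "int n dvd int r - int i \<longleftrightarrow> i = r"
      using assms by (auto simp: mod_eq_dvd_iff[symmetric])
    then show "(if i = r then of_nat i else 0)
        = of_nat i * ((\<Sum>b<n. unity_root n (int b * (int r - int i))) / of_nat n)"
      using n by (simp add: sum_unity_root)
  qed
  also have "\<dots> = (\<Sum>b<n. \<Sum>i<n. of_nat i * unity_root n (int b * (int r - int i))) / of_nat n"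
    by (simp add: sum_distrib_left sum_divide_distrib) (rule sum.swap)
  also have "\<dots> = (\<Sum>b<n. unity_root n (int b * int r) * fourier_coefficient n b) / of_nat n"
  proof -
    have "unity_root n (int b * (int r - int i)) = unity_root n (int b * int r) * unity_root n (- int b) ^ i"
      for b i
      unfolding unity_root_power unity_root_add[symmetric] by (simp add: algebra_simps)
    then show ?thesis by (simp add: fourier_coefficient_def sum_distrib_left mult_ac)
  qed
  finally show ?thesis .
qed

lemma mod_frac_fourier_expansion:
  assumes n: "n > 0"
  shows "complex_of_real (mod_frac n k) = (of_nat n - 1) / (2 * of_nat n)
    + (\<Sum>b\<in>{1..<n}. unity_root n (int b * k) / (unity_root n (- int b) - 1)) / of_nat n"
proof -
  define r where "r = nat (k mod int n)"
  have r: "r < n" "int r = k mod int n"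
    using n by (auto simp: r_def nat_less_iff)
  have "unity_root n (int b * int r) = unity_root n (int b * k)" for b
    by (intro unity_root_cong cong_mult cong_refl) (simp add: r(2) cong_def)
  note expansion = residue_fourier_inversion[OF r(1), unfolded this]
  have "of_nat n * complex_of_real (mod_frac n k) = of_nat r"
    using n r(2) by (simp add: mod_frac_def flip: r(2))
  also note expansion
  also have "{..<n} = insert 0 {1..<n}" using n by auto
  also have "(\<Sum>b\<in>\<dots>. unity_root n (int b * k) * fourier_coefficient n b) / of_nat n
      = (of_nat n - 1) / 2 + (\<Sum>b\<in>{1..<n}. unity_root n (int b * k) / (unity_root n (- int b) - 1))"
    using n by (simp add: fourier_coefficient_0 fourier_coefficient_pos add_divide_distrib sum_divide_distrib)
  finally have "complex_of_real (mod_frac n k) = \<dots> / of_nat n"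
    using n by (simp only: eq_divide_eq mult.commute) simp
  then show ?thesis by (simp add: add_divide_distrib)
qed

section \<open>Subgroups of the units modulo d\<close>

definition units_mod :: "nat \<Rightarrow> nat set" where
  "units_mod d = {t. t < d \<and> coprime t d}"

lemma finite_units_mod [simp]: "finite (units_mod d)"
  by (simp add: units_mod_def)

lemma mod_in_units_mod_iff: "d > 0 \<Longrightarrow> t mod d \<in> units_mod d \<longleftrightarrow> coprime t d"
  by (simp add: units_mod_def)

text \<open>\<^const>\<open>totatives\<close> represents the class of \<open>0\<close> by \<open>d\<close> instead of \<open>0\<close>, which matters for \<open>d = 1\<close>.\<close>

lemma card_units_mod:
  assumes "d > 0"
  shows "card (units_mod d) = totient d"
proof (cases "d = 1")
  case True
  then have "units_mod d = {0}" by (auto simp: units_mod_def)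
  then show ?thesis using True by simp
next
  case False
  then have "units_mod d = totatives d" using assms
    by (auto simp: units_mod_def totatives_def intro: Nat.gr0I le_neq_implies_less)
  then show ?thesis by (simp add: totient_def)
qed

lemma int_dvd_coprime_mult_iff: "coprime t d \<Longrightarrow> int d dvd int t * a \<longleftrightarrow> int d dvd a"
  by (metis coprime_commute coprime_dvd_mult_right_iff coprime_int_iff)

lemma cong_int_mod_mult: "[int (s * t mod d) * a = int s * (int t * a)] (mod int d)"
  by (simp only: cong_def zmod_int mod_mult_left_eq of_nat_mult mult.assoc)

lemma card_le_mult_card_image:
  assumes "finite A" "\<And>y. y \<in> f ` A \<Longrightarrow> card {x \<in> A. f x = y} \<le> k"
  shows "card A \<le> k * card (f ` A)"
proof -
  have "card A = (\<Sum>y\<in>f ` A. card {x \<in> A. f x = y})"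
    using sum.image_gen[OF assms(1), of "\<lambda>_. 1 :: nat" f] by simp
  also have "\<dots> \<le> card (f ` A) * k"
    using assms(2) sum_bounded_above[of "f ` A" "\<lambda>y. card {x \<in> A. f x = y}" k] by simp
  finally show ?thesis by (simp add: mult.commute)
qed

lemma exists_coprime_in_residue_class:
  fixes t m d :: nat
  assumes "coprime t m" "d > 0"
  obtains s where "[s = t] (mod m)" "coprime s d"
proof
  define r where "r = \<Prod>{p \<in> prime_factors d. \<not> p dvd t}"
  show "[t + m * r = t] (mod m)" by (simp add: cong_def)
  have dvd_r_iff: "p dvd r \<longleftrightarrow> \<not> p dvd t" if "prime p" "p dvd d" for p
  proof -
    have "p dvd r \<longleftrightarrow> (\<exists>q\<in>{q \<in> prime_factors d. \<not> q dvd t}. p dvd q)"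
      unfolding r_def using that(1) by (intro prime_dvd_prod_iff) simp_all
    also have "\<dots> \<longleftrightarrow> \<not> p dvd t"
      using that assms(2) primes_dvd_imp_eq by (auto simp: in_prime_factors_iff)
    finally show ?thesis .
  qed
  show "coprime (t + m * r) d"
  proof (rule ccontr)
    assume "\<not> coprime (t + m * r) d"
    then have "gcd (t + m * r) d \<noteq> 1" by (simp only: coprime_iff_gcd_eq_1 not_False_eq_True)
    then obtain p where "prime p" "p dvd gcd (t + m * r) d" using prime_factor_nat by blast
    then have p: "prime p" "p dvd t + m * r" "p dvd d" by auto
    show False
    proof (cases "p dvd t")
      case True
      then have "p dvd m * r" using p(2) by (simp add: dvd_add_right_iff)
      moreover have "\<not> p dvd r" using dvd_r_iff[OF p(1,3)] True by blast
      ultimately have "p dvd m" using prime_dvd_multD[OF p(1)] by blast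
      then show False
        using True assms(1) p(1) by (meson coprime_common_divisor not_prime_unit)
    next
      case False
      then have "p dvd m * r" using dvd_r_iff[OF p(1,3)] by simp
      then show False using p(2) False by (simp add: dvd_add_left_iff)
    qed
  qed
qed

locale unit_subgroup =
  fixes d :: nat and H :: "nat set"
  assumes nonempty: "H \<noteq> {}"
    and subset_units: "H \<subseteq> units_mod d"
    and mult_closed: "s \<in> H \<Longrightarrow> t \<in> H \<Longrightarrow> s * t mod d \<in> H"
begin

lemma finite_H [simp]: "finite H"
  using subset_units by (rule finite_subset) simp

lemma card_pos: "card H > 0"
  using nonempty by (simp add: card_gt_0_iff)

lemma less: "t \<in> H \<Longrightarrow> t < d" and coprime: "t \<in> H \<Longrightarrow> coprime t d"
  using subset_units by (auto simp: units_mod_def)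

lemma modulus_pos: "d > 0"
  using nonempty less by fastforce

lemma mult_inj:
  assumes "coprime k d"
  shows "inj_on (\<lambda>t. t * k mod d) H"
proof (rule inj_onI)
  fix s t assume st: "s \<in> H" "t \<in> H" "s * k mod d = t * k mod d"
  then have "[s = t] (mod d)" using assms by (simp flip: cong_def add: cong_mult_rcancel_nat)
  then show "s = t" using less st by (simp add: cong_def)
qed

lemma mult_bij:
  assumes "h \<in> H"
  shows "bij_betw (\<lambda>t. t * h mod d) H H"
  using mult_inj[OF coprime[OF assms]] mult_closed assms
  by (simp add: bij_betw_def endo_inj_surj image_subset_iff)

lemma sum_dilate:
  fixes \<phi> :: "int \<Rightarrow> 'a :: comm_monoid_add"
  assumes "h \<in> H" and cong: "\<And>k l. [k = l] (mod int d) \<Longrightarrow> \<phi> k = \<phi> l"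
  shows "(\<Sum>t\<in>H. \<phi> (int t * (int h * a))) = (\<Sum>t\<in>H. \<phi> (int t * a))"
proof -
  have "(\<Sum>t\<in>H. \<phi> (int t * a)) = (\<Sum>t\<in>H. \<phi> (int (t * h mod d) * a))"
    by (rule sum.reindex_bij_betw[OF mult_bij[OF assms(1)], symmetric])
  also have "\<dots> = (\<Sum>t\<in>H. \<phi> (int t * (int h * a)))"
    by (intro sum.cong refl cong cong_int_mod_mult)
  finally show ?thesis ..
qed

lemma one_mem: "1 mod d \<in> H"
proof -
  obtain h where h: "h \<in> H" using nonempty by blast
  then have "h \<in> (\<lambda>t. t * h mod d) ` H"
    using bij_betw_imp_surj_on[OF mult_bij[OF h]] by simp
  then obtain t where t: "t \<in> H" "t * h mod d = h" by auto
  then have "[t * h = 1 * h] (mod d)" using less[OF h] by (simp add: cong_def)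
  then have "[t = 1] (mod d)" using coprime[OF h] by (simp only: cong_mult_rcancel_nat)
  then show ?thesis using t(1) less by (simp add: cong_def)
qed

lemma power_mod_mem:
  assumes "t mod d \<in> H"
  shows "t ^ i mod d \<in> H"
proof (induction i)
  case (Suc i)
  have "t ^ Suc i mod d = (t mod d) * (t ^ i mod d) mod d" by (simp add: mod_mult_eq)
  then show ?case using mult_closed[OF assms Suc] by (simp only:)
qed (use one_mem in simp)

end

lemma unit_subgroup_units_mod:
  assumes "d > 0"
  shows "unit_subgroup d (units_mod d)"
proof
  show "units_mod d \<noteq> {}"
    using mod_in_units_mod_iff[OF assms, of 1] by auto
  show "s * t mod d \<in> units_mod d" if "s \<in> units_mod d" "t \<in> units_mod d" for s t
    using that mod_in_units_mod_iff[OF assms] by (simp add: units_mod_def)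
qed simp

locale unit_subgroup_reduction = unit_subgroup +
  fixes m :: nat
  assumes dvd: "m dvd d"
begin

abbreviation reduced :: "nat set" where "reduced \<equiv> (\<lambda>t. t mod m) ` H"
abbreviation kernel :: "nat set" where "kernel \<equiv> {t \<in> H. [t = 1] (mod m)}"

lemma target_pos: "m > 0"
  using modulus_pos dvd by (metis dvd_0_left not_gr_zero)

lemma kernel_pos: "card kernel > 0"
proof -
  have "1 mod d \<in> kernel"
    using one_mem dvd by (simp add: cong_def mod_mod_cancel del: One_nat_def)
  then show ?thesis using card_gt_0_iff by fastforce
qed

sublocale reduced: unit_subgroup m reduced
proof
  show "reduced \<noteq> {}" using nonempty by simp
  have "coprime t m" if "t \<in> H" for t
    using coprime[OF that] dvd by (meson coprime_divisors dvd_refl)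
  then show "reduced \<subseteq> units_mod m" by (auto simp: mod_in_units_mod_iff target_pos)
  fix s t assume "s \<in> reduced" "t \<in> reduced"
  then obtain s' t' where st: "s' \<in> H" "t' \<in> H" "s = s' mod m" "t = t' mod m" by blast
  then have "s * t mod m = (s' * t' mod d) mod m"
    using dvd by (simp add: mod_mult_eq mod_mod_cancel)
  then show "s * t mod m \<in> reduced" using mult_closed st by blast
qed

lemma card_fibre:
  assumes "u \<in> reduced"
  shows "card {t \<in> H. t mod m = u} = card kernel"
proof -
  obtain h where h: "h \<in> H" "u = h mod m" using assms by blast
  have "coprime h m" using coprime[OF h(1)] dvd by (meson coprime_divisors dvd_refl)
  then have iff: "t * h mod d mod m = u \<longleftrightarrow> [t = 1] (mod m)" for t
    using cong_mult_rcancel_nat[of h m t 1] h dvd by (simp add: mod_mod_cancel cong_def)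
  have "bij_betw (\<lambda>t. t * h mod d) kernel {t \<in> H. t mod m = u}"
    using mult_bij[OF h(1)] iff by (rule bij_betw_Collect)
  then show ?thesis by (rule bij_betw_same_card[symmetric])
qed

lemma sum_reduce:
  fixes \<phi> :: "nat \<Rightarrow> real"
  shows "(\<Sum>t\<in>H. \<phi> (t mod m)) = real (card kernel) * (\<Sum>u\<in>reduced. \<phi> u)"
proof -
  have "(\<Sum>t\<in>H. \<phi> (t mod m)) = (\<Sum>u\<in>reduced. \<Sum>t\<in>{t \<in> H. t mod m = u}. \<phi> (t mod m))"
    by (rule sum.image_gen) simp
  also have "\<dots> = (\<Sum>u\<in>reduced. real (card kernel) * \<phi> u)"
    by (intro sum.cong refl) (simp add: card_fibre[symmetric] del: One_nat_def)
  finally show ?thesis by (simp add: sum_distrib_left)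
qed

lemma card_reduce: "card H = card kernel * card reduced"
  using sum_reduce[of "\<lambda>_. 1"] by (simp flip: of_nat_mult)

end

locale unit_subgroup_index_le = unit_subgroup +
  fixes n :: nat
  assumes index_le: "totient d \<le> n * card H"

lemma unit_subgroup_index_le_reduce:
  assumes "unit_subgroup_index_le d H n" and m: "m dvd d"
  shows "unit_subgroup_index_le m ((\<lambda>t. t mod m) ` H) n"
proof -
  interpret unit_subgroup_index_le d H n by fact
  interpret H: unit_subgroup_reduction d H m by unfold_locales (rule m)
  interpret V: unit_subgroup_reduction d "units_mod d" m
    using unit_subgroup_units_mod[OF modulus_pos] m
    by (simp add: unit_subgroup_reduction_def unit_subgroup_reduction_axioms_def)
  have "units_mod m \<subseteq> V.reduced"
  proof
    fix t assume "t \<in> units_mod m"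
    then obtain s where s: "[s = t] (mod m)" "coprime s d" "t < m"
      using exists_coprime_in_residue_class[OF _ modulus_pos] by (auto simp: units_mod_def)
    then have "t = (s mod d) mod m" using m by (simp add: mod_mod_cancel cong_def)
    then show "t \<in> V.reduced" using s(2) modulus_pos by (auto simp: mod_in_units_mod_iff)
  qed
  then have "totient m \<le> card V.reduced"
    using H.target_pos card_mono[of V.reduced] by (simp flip: card_units_mod)
  then have "card V.kernel * totient m \<le> totient d"
    using V.card_reduce modulus_pos by (simp add: card_units_mod)
  also have "\<dots> \<le> n * (card H.kernel * card H.reduced)"
    using index_le H.card_reduce by simp
  also have "\<dots> \<le> n * (card V.kernel * card H.reduced)"
    using subset_units by (intro mult_le_mono card_mono) auto
  finally have "card V.kernel * totient m \<le> card V.kernel * (n * card H.reduced)"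
    by (simp add: mult_ac)
  then have "totient m \<le> n * card H.reduced"
    using V.kernel_pos by simp
  then show ?thesis
    using H.reduced.unit_subgroup_axioms
    by (simp add: unit_subgroup_index_le_def unit_subgroup_index_le_axioms_def)
qed

section \<open>Exponential sums over subgroups\<close>

lemma parseval_exp_sum:
  fixes x :: "'a \<Rightarrow> int"
  assumes "finite A" "d > 0" and inj: "inj_on (\<lambda>t. x t mod int d) A"
  shows "(\<Sum>b<d. (norm (\<Sum>t\<in>A. unity_root d (x t * int b)))\<^sup>2) = real d * real (card A)"
proof -
  have "complex_of_real (\<Sum>b<d. (norm (\<Sum>t\<in>A. unity_root d (x t * int b)))\<^sup>2)
      = (\<Sum>b<d. \<Sum>t\<in>A. \<Sum>s\<in>A. unity_root d (int b * (x t - x s)))"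
    by (simp only: of_real_sum complex_norm_square cnj_sum sum_product right_diff_distrib unity_root_diff
        mult.commute[of "int _"])
  also have "\<dots> = (\<Sum>t\<in>A. \<Sum>s\<in>A. \<Sum>b<d. unity_root d (int b * (x t - x s)))"
    by (subst sum.swap, rule sum.cong[OF refl], rule sum.swap)
  also have "\<dots> = (\<Sum>t\<in>A. \<Sum>s\<in>A. if s = t then of_nat d else 0)"
  proof (intro sum.cong refl)
    fix t s assume "t \<in> A" "s \<in> A"
    then have "int d dvd x t - x s \<longleftrightarrow> s = t"
      using inj by (auto simp: inj_on_def mod_eq_dvd_iff[symmetric])
    then show "(\<Sum>b<d. unity_root d (int b * (x t - x s))) = (if s = t then of_nat d else 0)"
      using sum_unity_root[OF assms(2)] by simp
  qed
  also have "\<dots> = of_real (real d * real (card A))"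
    using assms(1) by simp
  finally show ?thesis by (simp only: of_real_eq_iff)
qed

definition orbit_exp_sum :: "nat \<Rightarrow> nat set \<Rightarrow> int \<Rightarrow> complex" where
  "orbit_exp_sum d H a = (\<Sum>t\<in>H. unity_root d (int t * a))"

context unit_subgroup
begin

lemma orbit_exp_sum_cong: "[a = b] (mod int d) \<Longrightarrow> orbit_exp_sum d H a = orbit_exp_sum d H b"
  unfolding orbit_exp_sum_def by (intro sum.cong refl unity_root_cong cong_mult cong_refl)

lemma orbit_exp_sum_dilate: "h \<in> H \<Longrightarrow> orbit_exp_sum d H (int h * a) = orbit_exp_sum d H a"
  unfolding orbit_exp_sum_def by (rule sum_dilate[OF _ unity_root_cong])

lemma cnj_orbit_exp_sum: "cnj (orbit_exp_sum d H a) = orbit_exp_sum d H (- a)"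
  by (simp add: orbit_exp_sum_def cnj_unity_root)

lemma parseval_orbit_exp_sum:
  assumes "coprime a (int d)"
  shows "(\<Sum>b<d. (norm (orbit_exp_sum d H (int b * a)))\<^sup>2) = real d * real (card H)"
proof -
  have "inj_on (\<lambda>t. (int t * a) mod int d) H"
  proof (rule inj_onI)
    fix s t assume st: "s \<in> H" "t \<in> H" "(int s * a) mod int d = (int t * a) mod int d"
    then have "[int s = int t] (mod int d)"
      using assms by (simp flip: cong_def add: cong_mult_rcancel)
    then show "s = t" using less st(1,2) by (simp add: cong_int_iff cong_def)
  qed
  from parseval_exp_sum[OF finite_H modulus_pos this] show ?thesis
    by (simp add: orbit_exp_sum_def mult_ac)
qed

lemma card_le_mult_card_orbit:
  assumes "k > 0"
  shows "card H \<le> k * card ((\<lambda>h. h * k mod d) ` H)"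
proof (rule card_le_mult_card_image)
  fix y
  have "inj_on (\<lambda>h. h * k div d) {h \<in> H. h * k mod d = y}"
  proof (rule inj_onI, clarify)
    fix s t assume "s * k div d = t * k div d" "t * k mod d = s * k mod d"
    then have "s * k = t * k" by (metis div_mult_mod_eq)
    then show "s = t" using assms by simp
  qed
  moreover have "(\<lambda>h. h * k div d) ` {h \<in> H. h * k mod d = y} \<subseteq> {..<k}"
    using less modulus_pos assms by (auto simp: less_mult_imp_div_less mult.commute)
  ultimately show "card {h \<in> H. h * k mod d = y} \<le> k"
    using card_inj_on_le[of _ _ "{..<k}"] by fastforce
qed simp

text \<open>The value at frequency \<open>k\<close> recurs along the \<open>H\<close>-orbit of \<open>k\<close>, which Parseval's identity makes expensive.\<close>

lemma norm_orbit_exp_sum_le: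
  assumes a: "coprime a (int d)" and k: "k > 0"
  shows "norm (orbit_exp_sum d H (int k * a)) \<le> sqrt (real d * real k)"
proof -
  define orbit where "orbit = (\<lambda>h. h * k mod d) ` H"
  have orbit: "finite orbit" "orbit \<subseteq> {..<d}" "card orbit > 0"
    using modulus_pos nonempty by (auto simp: orbit_def card_gt_0_iff)
  have const: "orbit_exp_sum d H (int b * a) = orbit_exp_sum d H (int k * a)" if b: "b \<in> orbit" for b
  proof -
    obtain h where h: "h \<in> H" "b = h * k mod d" using b by (auto simp: orbit_def)
    have "[int b * a = int h * (int k * a)] (mod int d)"
      unfolding h(2) by (rule cong_int_mod_mult)
    then show ?thesis using orbit_exp_sum_cong orbit_exp_sum_dilate[OF h(1)] by simp
  qed
  have "real (card orbit) * (norm (orbit_exp_sum d H (int k * a)))\<^sup>2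
      = (\<Sum>b\<in>orbit. (norm (orbit_exp_sum d H (int b * a)))\<^sup>2)"
    by (simp add: const)
  also have "\<dots> \<le> (\<Sum>b<d. (norm (orbit_exp_sum d H (int b * a)))\<^sup>2)"
    using orbit by (intro sum_mono2) auto
  also have "\<dots> = real d * real (card H)" by (rule parseval_orbit_exp_sum[OF a])
  also have "\<dots> \<le> real d * real (k * card orbit)"
    using card_le_mult_card_orbit[OF k] by (intro mult_left_mono of_nat_mono) (auto simp: orbit_def)
  finally have "real (card orbit) * (norm (orbit_exp_sum d H (int k * a)))\<^sup>2
      \<le> real (card orbit) * (real d * real k)"
    by (simp add: mult_ac)
  then show ?thesis using orbit(3) by (intro real_le_rsqrt) simp
qed

end

section \<open>Equidistribution of orbits\<close>

lemma sum_le_twice_sum_half: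
  fixes F :: "nat \<Rightarrow> real"
  assumes nonneg: "\<And>b. F b \<ge> 0" and sym: "\<And>b. b \<le> d \<Longrightarrow> F (d - b) = F b"
  shows "(\<Sum>b\<in>{1..<d}. F b) \<le> 2 * (\<Sum>b\<in>{1..d div 2}. F b)"
proof -
  have "{1..<d} \<subseteq> {1..d div 2} \<union> (\<lambda>b. d - b) ` {1..d div 2}"
  proof
    fix b assume b: "b \<in> {1..<d}"
    show "b \<in> {1..d div 2} \<union> (\<lambda>b. d - b) ` {1..d div 2}"
    proof (cases "b \<le> d div 2")
      case False
      then have "d - b \<in> {1..d div 2}" "b = d - (d - b)" using b by auto
      then show ?thesis by blast
    qed (use b in auto)
  qed
  then have "(\<Sum>b\<in>{1..<d}. F b) \<le> (\<Sum>b\<in>{1..d div 2} \<union> (\<lambda>b. d - b) ` {1..d div 2}. F b)"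
    using nonneg by (intro sum_mono2) auto
  also have "\<dots> \<le> (\<Sum>b\<in>{1..d div 2}. F b) + (\<Sum>b\<in>(\<lambda>b. d - b) ` {1..d div 2}. F b)"
    using nonneg by (simp add: sum_Un sum_nonneg)
  also have "(\<Sum>b\<in>(\<lambda>b. d - b) ` {1..d div 2}. F b) = (\<Sum>b\<in>{1..d div 2}. F b)"
    using sym by (subst sum.reindex) (auto intro!: inj_onI sum.cong)
  finally show ?thesis by simp
qed

lemma sum_inverse_sqrt_le: "(\<Sum>k=1..K. 1 / sqrt (real k)) \<le> 2 * sqrt (real K)"
proof (induction K)
  case (Suc K)
  have "1 = (sqrt (real K + 1) - sqrt (real K)) * (sqrt (real K + 1) + sqrt (real K))"
    by (simp add: algebra_simps)
  also have "\<dots> \<le> (sqrt (real K + 1) - sqrt (real K)) * (2 * sqrt (real K + 1))"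
    by (intro mult_left_mono) auto
  finally have "1 \<le> (2 * sqrt (real K + 1) - 2 * sqrt (real K)) * sqrt (real K + 1)"
    by (simp only: mult_ac right_diff_distrib left_diff_distrib)
  then have "1 / sqrt (real K + 1) \<le> 2 * sqrt (real K + 1) - 2 * sqrt (real K)"
    by (simp add: pos_divide_le_eq)
  then show ?case using Suc by (simp add: add.commute)
qed simp

lemma sum_inverse_squares_le:
  assumes "K > 0"
  shows "(\<Sum>k\<in>{K<..M}. 1 / (real k)\<^sup>2) \<le> 1 / real K"
proof (cases "K \<le> M")
  case True
  have "(\<Sum>k\<in>{K<..M}. 1 / (real k)\<^sup>2) \<le> 1 / real K - 1 / real M"
    using True
  proof (induction M rule: dec_induct)
    case (step M)
    have "1 / (real (Suc M))\<^sup>2 \<le> 1 / (real M * real (Suc M))"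
      using step assms by (intro divide_left_mono) (auto simp: power2_eq_square)
    also have "\<dots> = 1 / real M - 1 / real (Suc M)"
      using step assms by (simp add: field_simps)
    moreover have "{K<..Suc M} = insert (Suc M) {K<..M}" using step by auto
    ultimately show ?case using step.IH by simp
  qed simp
  then show ?thesis by (rule order_trans) simp
qed simp

context unit_subgroup
begin

lemma sum_mod_frac_fourier_bound:
  "\<bar>(\<Sum>t\<in>H. mod_frac d (int t * a)) - real (card H) * ((real d - 1) / (2 * real d))\<bar>
    \<le> (\<Sum>b\<in>{1..<d}. norm (orbit_exp_sum d H (int b * a)) / norm (unity_root d (int b) - 1)) / real d"
proof -
  have norm_uminus: "norm (unity_root d (- int b) - 1) = norm (unity_root d (int b) - 1)" for b
    using complex_mod_cnj[of "unity_root d (int b) - 1"] by (simp add: cnj_unity_root)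
  have "complex_of_real ((\<Sum>t\<in>H. mod_frac d (int t * a)) - real (card H) * ((real d - 1) / (2 * real d)))
      = (\<Sum>t\<in>H. complex_of_real (mod_frac d (int t * a)) - (of_nat d - 1) / (2 * of_nat d))"
    by (simp add: sum_subtractf)
  also have "\<dots> =
      (\<Sum>t\<in>H. \<Sum>b\<in>{1..<d}. unity_root d (int b * (int t * a)) / (unity_root d (- int b) - 1)) / of_nat d"
    by (simp add: mod_frac_fourier_expansion[OF modulus_pos] sum_divide_distrib)
  also have "\<dots> = (\<Sum>b\<in>{1..<d}. orbit_exp_sum d H (int b * a) / (unity_root d (- int b) - 1)) / of_nat d"
    by (subst sum.swap) (simp add: orbit_exp_sum_def sum_divide_distrib mult.left_commute)
  finally have "\<bar>(\<Sum>t\<in>H. mod_frac d (int t * a)) - real (card H) * ((real d - 1) / (2 * real d))\<bar>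
      = norm (\<Sum>b\<in>{1..<d}. orbit_exp_sum d H (int b * a) / (unity_root d (- int b) - 1)) / real d"
    unfolding norm_of_real[symmetric, where ?'a = complex] by (simp only: norm_divide norm_of_nat)
  also have "\<dots> \<le> (\<Sum>b\<in>{1..<d}. norm (orbit_exp_sum d H (int b * a) / (unity_root d (- int b) - 1))) / real d"
    by (intro divide_right_mono norm_sum) simp
  finally show ?thesis by (simp only: norm_divide norm_uminus)
qed

lemma sum_mod_frac_deviation_le:
  assumes a: "coprime a (int d)"
  shows "\<bar>(\<Sum>t\<in>H. mod_frac d (int t * a)) - real (card H) * ((real d - 1) / (2 * real d))\<bar>
    \<le> (\<Sum>b\<in>{1..d div 2}. norm (orbit_exp_sum d H (int b * a)) / real b) / 2"
proof -
  define F where "F b = norm (orbit_exp_sum d H (int b * a)) / norm (unity_root d (int b) - 1)" for b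
  have "F (d - b) = F b" if "b \<le> d" for b
  proof -
    have minus: "[int (d - b) * k = - (int b * k)] (mod int d)" for k
      using that by (simp add: cong_iff_dvd_diff algebra_simps)
    have "norm (orbit_exp_sum d H (int (d - b) * a)) = norm (orbit_exp_sum d H (int b * a))"
      using orbit_exp_sum_cong[OF minus[of a]] complex_mod_cnj[of "orbit_exp_sum d H (int b * a)"]
      by (simp add: cnj_orbit_exp_sum)
    moreover have "norm (unity_root d (int (d - b)) - 1) = norm (unity_root d (int b) - 1)"
      using unity_root_cong[OF minus[of 1]] complex_mod_cnj[of "unity_root d (int b) - 1"]
      by (simp add: cnj_unity_root)
    ultimately show ?thesis by (simp add: F_def)
  qed
  then have "(\<Sum>b\<in>{1..<d}. F b) / real d \<le> 2 * (\<Sum>b\<in>{1..d div 2}. F b) / real d"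
    by (intro divide_right_mono sum_le_twice_sum_half) (auto simp: F_def)
  also have "\<dots> \<le>
      2 * (\<Sum>b\<in>{1..d div 2}. norm (orbit_exp_sum d H (int b * a)) / (4 * real b / real d)) / real d"
    unfolding F_def using modulus_pos
    by (intro divide_right_mono mult_left_mono sum_mono divide_left_mono norm_unity_root_minus_1_ge
        mult_pos_pos less_le_trans[OF _ norm_unity_root_minus_1_ge]) auto
  also have "\<dots> = (\<Sum>b\<in>{1..d div 2}. norm (orbit_exp_sum d H (int b * a)) / real b) / 2"
    using modulus_pos by (simp add: sum_distrib_left sum_divide_distrib mult.commute)
  finally show ?thesis using sum_mod_frac_fourier_bound[of a] unfolding F_def by linarith
qed

lemma sum_low_orbit_exp_sum_le:
  assumes a: "coprime a (int d)"
  shows "(\<Sum>b\<in>{1..K}. norm (orbit_exp_sum d H (int b * a)) / real b) \<le> 2 * sqrt (real d * real K)"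
proof -
  have "(\<Sum>b\<in>{1..K}. norm (orbit_exp_sum d H (int b * a)) / real b)
      \<le> (\<Sum>b\<in>{1..K}. sqrt (real d) * (1 / sqrt (real b)))"
  proof (intro sum_mono)
    fix b assume "b \<in> {1..K}"
    then have b: "b > 0" by simp
    then have "norm (orbit_exp_sum d H (int b * a)) / real b \<le> sqrt (real d * real b) / real b"
      using norm_orbit_exp_sum_le[OF a, of b] by (simp add: divide_right_mono)
    also have "\<dots> = sqrt (real d) * (1 / sqrt (real b))"
      using b by (simp add: real_sqrt_mult field_simps)
    finally show "norm (orbit_exp_sum d H (int b * a)) / real b \<le> sqrt (real d) * (1 / sqrt (real b))" .
  qed
  also have "\<dots> \<le> sqrt (real d) * (2 * sqrt (real K))"
    unfolding sum_distrib_left[symmetric] by (intro mult_left_mono sum_inverse_sqrt_le) simp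
  finally show ?thesis by (simp add: real_sqrt_mult)
qed

lemma sum_high_orbit_exp_sum_le:
  assumes a: "coprime a (int d)" and K: "K > 0" and M: "M < d"
  shows "(\<Sum>b\<in>{K<..M}. norm (orbit_exp_sum d H (int b * a)) / real b) \<le> real d / sqrt (real K)"
proof -
  define S where "S b = norm (orbit_exp_sum d H (int b * a))" for b
  have "(\<Sum>b\<in>{K<..M}. S b / real b)\<^sup>2 \<le> (\<Sum>b\<in>{K<..M}. (S b)\<^sup>2) * (\<Sum>b\<in>{K<..M}. 1 / (real b)\<^sup>2)"
    using Cauchy_Schwarz_ineq_sum[of S "\<lambda>b. 1 / real b"] by (simp add: power_divide)
  also have "\<dots> \<le> (real d)\<^sup>2 * (1 / real K)"
  proof (intro mult_mono sum_inverse_squares_le K sum_nonneg)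
    have "(\<Sum>b\<in>{K<..M}. (S b)\<^sup>2) \<le> (\<Sum>b<d. (S b)\<^sup>2)"
      using M by (intro sum_mono2) auto
    also have "\<dots> = real d * real (card H)"
      unfolding S_def by (rule parseval_orbit_exp_sum[OF a])
    also have "card H \<le> d" using card_mono[of "{..<d}" H] less by auto
    finally show "(\<Sum>b\<in>{K<..M}. (S b)\<^sup>2) \<le> (real d)\<^sup>2"
      by (simp add: power2_eq_square mult_left_mono)
  qed auto
  finally have "(\<Sum>b\<in>{K<..M}. S b / real b) \<le> sqrt ((real d)\<^sup>2 * (1 / real K))"
    by (rule real_le_rsqrt)
  then show ?thesis by (simp add: S_def real_sqrt_divide)
qed

lemma sum_weighted_orbit_exp_sum_le:
  assumes a: "coprime a (int d)" and K: "K > 0"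
  shows "(\<Sum>b\<in>{1..d div 2}. norm (orbit_exp_sum d H (int b * a)) / real b)
    \<le> 2 * sqrt (real d * real K) + real d / sqrt (real K)"
proof -
  let ?S = "\<lambda>b. norm (orbit_exp_sum d H (int b * a)) / real b"
  have "(\<Sum>b\<in>{1..d div 2}. ?S b) \<le> (\<Sum>b\<in>{1..K} \<union> {K<..d div 2}. ?S b)"
    by (intro sum_mono2) auto
  also have "\<dots> = (\<Sum>b\<in>{1..K}. ?S b) + (\<Sum>b\<in>{K<..d div 2}. ?S b)"
    by (intro sum.union_disjoint) auto
  finally show ?thesis
    using sum_low_orbit_exp_sum_le[OF a, of K] sum_high_orbit_exp_sum_le[OF a K, of "d div 2"] modulus_pos
    by simp
qed

end

lemma one_le_prod_one_minus_inverse: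
  assumes "finite A" "\<And>q. q \<in> A \<Longrightarrow> q \<ge> 2"
  shows "1 \<le> (\<Prod>q\<in>A. 1 - 1 / real q) * (1 + real (card A))"
  using assms
proof (induction A rule: finite_linorder_max_induct)
  case (insert b A)
  have "A \<subseteq> {2..<b}" using insert by force
  then have "card A \<le> b - 2" using card_mono[of "{2..<b}" A] by simp
  then have "1 / real b \<le> 1 / (real (card A) + 2)"
    using insert.prems[of b] by (intro divide_left_mono) auto
  then have "(1 - 1 / (real (card A) + 2)) * (2 + real (card A)) \<le> (1 - 1 / real b) * (2 + real (card A))"
    by (intro mult_right_mono) auto
  moreover have "(1 - 1 / (real (card A) + 2)) * (2 + real (card A)) = 1 + real (card A)"
    by (simp add: field_simps)
  moreover have "0 \<le> (\<Prod>q\<in>A. 1 - 1 / real q)"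
    using insert.prems by (intro prod_nonneg) (force simp: field_simps)
  ultimately have "(\<Prod>q\<in>A. 1 - 1 / real q) * (1 + real (card A))
      \<le> (\<Prod>q\<in>A. 1 - 1 / real q) * ((1 - 1 / real b) * (2 + real (card A)))"
    by (intro mult_left_mono) linarith+
  moreover have "1 \<le> (\<Prod>q\<in>A. 1 - 1 / real q) * (1 + real (card A))" using insert by auto
  moreover have "b \<notin> A" using insert.hyps by auto
  ultimately show ?case using insert.hyps(1) by (simp add: mult_ac add_ac)
qed simp

lemma two_power_card_prime_factors_le:
  fixes n :: nat
  assumes "n > 0"
  shows "2 ^ card (prime_factors n) \<le> n"
proof -
  have "2 ^ card (prime_factors n) = (\<Prod>q\<in>prime_factors n. 2 :: nat)" by simp
  also have "\<dots> \<le> (\<Prod>q\<in>prime_factors n. q ^ multiplicity q n)"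
  proof (intro prod_mono conjI)
    fix q assume "q \<in> prime_factors n"
    then have "q \<ge> 2" "multiplicity q n \<ge> 1"
      by (auto simp: prime_factors_multiplicity prime_ge_2_nat)
    then show "2 \<le> q ^ multiplicity q n" using self_le_power[of q "multiplicity q n"] by simp
  qed simp
  also have "\<dots> = n" using assms by (simp add: prime_factorization_nat[symmetric])
  finally show ?thesis .
qed

lemma totient_ge:
  assumes "n > 0"
  shows "real n \<le> real (totient n) * (1 + log 2 (real n))"
proof -
  let ?A = "prime_factors n"
  have "real n * 1 \<le> real n * ((\<Prod>q\<in>?A. 1 - 1 / real q) * (1 + real (card ?A)))"
    by (intro mult_left_mono one_le_prod_one_minus_inverse) (auto simp: in_prime_factors_iff prime_ge_2_nat)
  also have "\<dots> = real (totient n) * (1 + real (card ?A))"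
    by (simp add: totient_formula2)
  also have "\<dots> \<le> real (totient n) * (1 + log 2 (real n))"
    using le_log2_of_power[OF two_power_card_prime_factors_le[OF assms]] by (intro mult_left_mono) auto
  finally show ?thesis by simp
qed

definition orbit_mean :: "nat \<Rightarrow> nat set \<Rightarrow> int \<Rightarrow> real" where
  "orbit_mean d H a = (\<Sum>t\<in>H. mod_frac d (int t * a)) / real (card H)"

lemma orbit_mean_nonneg: "orbit_mean d H a \<ge> 0"
  by (simp add: orbit_mean_def sum_nonneg mod_frac_nonneg)

definition equidistribution_error :: "nat \<Rightarrow> real \<Rightarrow> real" where
  "equidistribution_error n x =
     real n * (1 + log 2 x) * (sqrt (2 * x * sqrt x) + x / (2 * sqrt (sqrt x)) + 1 / 2) / x"

lemma equidistribution_error_tendsto_0: "(equidistribution_error n \<longlongrightarrow> 0) at_top"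
  unfolding equidistribution_error_def by real_asymp

lemma (in unit_subgroup) sum_mod_frac_near_half:
  assumes a: "coprime a (int d)"
  shows "\<bar>(\<Sum>t\<in>H. mod_frac d (int t * a)) - real (card H) / 2\<bar>
    \<le> sqrt (2 * real d * sqrt (real d)) + real d / (2 * sqrt (sqrt (real d))) + 1 / 2"
proof -
  define K where "K = nat \<lceil>sqrt (real d)\<rceil>"
  have d: "sqrt (real d) \<ge> 1" using modulus_pos by simp
  then have K: "K > 0" "sqrt (real d) \<le> real K" "real K \<le> 2 * sqrt (real d)"
    unfolding K_def by linarith+
  define r where "r = real (card H) / (2 * real d)"
  have r: "0 \<le> r" "r \<le> 1 / 2"
    using modulus_pos card_mono[of "{..<d}" H] less by (auto simp: r_def field_simps)
  have "real (card H) * ((real d - 1) / (2 * real d)) = real (card H) / 2 - r"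
    using modulus_pos by (simp add: r_def field_simps)
  note deviation = sum_mod_frac_deviation_le[OF a, unfolded this]
  have "\<bar>x - y\<bar> \<le> v / 2 + 1 / 2" if "\<bar>x - (y - r)\<bar> \<le> u / 2" "u \<le> v" for x y u v
    using that r by linarith
  from this[OF deviation sum_weighted_orbit_exp_sum_le[OF a K(1)]]
  have "\<bar>(\<Sum>t\<in>H. mod_frac d (int t * a)) - real (card H) / 2\<bar>
      \<le> (2 * sqrt (real d * real K) + real d / sqrt (real K)) / 2 + 1 / 2" .
  also have "\<dots> = sqrt (real d * real K) + real d / (2 * sqrt (real K)) + 1 / 2" by simp
  also have "\<dots> \<le> sqrt (real d * (2 * sqrt (real d))) + real d / (2 * sqrt (sqrt (real d))) + 1 / 2"
    using K modulus_pos
    by (intro add_mono real_sqrt_le_mono mult_left_mono divide_left_mono mult_pos_pos) auto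
  finally show ?thesis by (simp add: mult_ac)
qed

lemma (in unit_subgroup_index_le) orbit_mean_near_half:
  assumes a: "coprime a (int d)"
  shows "\<bar>orbit_mean d H a - 1 / 2\<bar> \<le> equidistribution_error n (real d)"
proof -
  define E where "E = sqrt (2 * real d * sqrt (real d)) + real d / (2 * sqrt (sqrt (real d))) + 1 / 2"
  have E: "E \<ge> 0" by (simp add: E_def)
  have d: "real d \<ge> 1" using modulus_pos by simp
  have "real d \<le> real (totient d) * (1 + log 2 (real d))" using modulus_pos by (rule totient_ge)
  also have "\<dots> \<le> real (n * card H) * (1 + log 2 (real d))"
    using index_le d by (intro mult_right_mono of_nat_mono) auto
  finally have size: "real d * E \<le> real (n * card H) * (1 + log 2 (real d)) * E"
    using E by (rule mult_right_mono)
  have "orbit_mean d H a - 1 / 2 = ((\<Sum>t\<in>H. mod_frac d (int t * a)) - real (card H) / 2) / real (card H)"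
    using nonempty by (simp add: orbit_mean_def diff_divide_distrib)
  then have "\<bar>orbit_mean d H a - 1 / 2\<bar> \<le> E / real (card H)"
    using sum_mod_frac_near_half[OF a] unfolding E_def
    by (simp only: abs_divide abs_of_nat divide_right_mono of_nat_0_le_iff)
  also have "\<dots> \<le> real n * (1 + log 2 (real d)) * E / real d"
    using size d card_pos by (simp add: field_simps)
  also have "\<dots> = equidistribution_error n (real d)"
    by (simp add: E_def equidistribution_error_def)
  finally show ?thesis .
qed

lemma orbit_mean_equidistributed_coprime:
  assumes "\<delta> > 0"
  obtains B where "\<And>d H a. d > B \<Longrightarrow> unit_subgroup_index_le d H n \<Longrightarrow> coprime a (int d) \<Longrightarrow>
    \<bar>orbit_mean d H a - 1 / 2\<bar> < \<delta>"
proof -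
  have "((\<lambda>d. equidistribution_error n (real d)) \<longlongrightarrow> 0) at_top"
    using equidistribution_error_tendsto_0 filterlim_real_sequentially by (rule filterlim_compose)
  from order_tendstoD(2)[OF this assms]
  obtain B where "\<And>d. d \<ge> B \<Longrightarrow> equidistribution_error n (real d) < \<delta>"
    unfolding eventually_at_top_linorder by blast
  then show thesis
    using that[of B] unit_subgroup_index_le.orbit_mean_near_half by (meson le_less_trans less_imp_le)
qed

definition add_order :: "nat \<Rightarrow> int \<Rightarrow> nat" where
  "add_order d a = d div nat (gcd a (int d))"

lemma add_order_decomp:
  assumes "d > 0"
  obtains g b where "g > 0" "d = g * add_order d a" "a = int g * b" "coprime b (int (add_order d a))"
proof -
  define g where "g = nat (gcd a (int d))"
  have g: "g > 0" "int g = gcd a (int d)" using assms by (auto simp: g_def)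
  have "g dvd d" using g(2) by (metis gcd_dvd2 of_nat_dvd_iff)
  then have d: "d = g * add_order d a" by (simp add: add_order_def g_def[symmetric])
  have "int g dvd a" using g(2) by simp
  then obtain b where b: "a = int g * b" by blast
  have "gcd (int g * b) (int g * int (add_order d a)) = int g"
    using g(2) b d by (metis of_nat_mult)
  then have "int g * gcd b (int (add_order d a)) = int g"
    by (simp add: gcd_mult_left)
  then have "coprime b (int (add_order d a))"
    using g(1) by (auto simp: coprime_iff_gcd_eq_1)
  with that g d b show thesis by blast
qed

lemma add_order_pos: "d > 0 \<Longrightarrow> add_order d a > 0"
  using add_order_decomp[of d a] by (metis mult_0_right not_gr_zero)

lemma dvd_mult_iff_add_order_dvd:
  assumes "d > 0"
  shows "int d dvd int k * a \<longleftrightarrow> add_order d a dvd k"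
proof -
  define m where "m = add_order d a"
  obtain g b where gb: "g > 0" "d = g * m" "a = int g * b" "coprime b (int m)"
    using add_order_decomp[OF assms, of a] unfolding m_def by metis
  have "int d dvd int k * a \<longleftrightarrow> int m dvd int k * b"
    using gb(1-3) by (simp add: mult.left_commute)
  also have "\<dots> \<longleftrightarrow> int m dvd int k"
    using gb(4) by (simp add: coprime_dvd_mult_left_iff coprime_commute)
  finally show ?thesis by (simp add: m_def)
qed

lemma (in unit_subgroup_reduction) orbit_mean_reduce:
  assumes "d = g * m" "a = int g * b"
  shows "orbit_mean d H a = orbit_mean m reduced b"
proof -
  have "g > 0" using assms(1) modulus_pos by simp
  have "mod_frac d (int t * a) = mod_frac m (int (t mod m) * b)" for t
  proof -
    have "mod_frac d (int t * a) = mod_frac m (int t * b)"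
      using mod_frac_mult_cancel[OF \<open>g > 0\<close>] by (simp add: assms mult.left_commute)
    also have "\<dots> = mod_frac m (int (t mod m) * b)"
      by (intro mod_frac_cong) (simp add: cong_def zmod_int mod_mult_left_eq)
    finally show ?thesis .
  qed
  then have "orbit_mean d H a = (real (card kernel) * (\<Sum>u\<in>reduced. mod_frac m (int u * b)))
      / (real (card kernel) * real (card reduced))"
    unfolding orbit_mean_def card_reduce of_nat_mult
    by (simp only: sum_reduce[of "\<lambda>u. mod_frac m (int u * b)"])
  also have "\<dots> = orbit_mean m reduced b"
    unfolding orbit_mean_def using kernel_pos by (intro mult_divide_mult_cancel_left) linarith
  finally show ?thesis .
qed

lemma orbit_mean_equidistributed:
  assumes "\<delta> > 0"
  obtains B where "\<And>d H a. unit_subgroup_index_le d H n \<Longrightarrow> add_order d a > B \<Longrightarrow>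
    \<bar>orbit_mean d H a - 1 / 2\<bar> < \<delta>"
proof -
  obtain B where B: "\<And>d H a. d > B \<Longrightarrow> unit_subgroup_index_le d H n \<Longrightarrow> coprime a (int d) \<Longrightarrow>
      \<bar>orbit_mean d H a - 1 / 2\<bar> < \<delta>"
    using orbit_mean_equidistributed_coprime[OF assms] by blast
  show thesis
  proof (rule that[of B])
    fix d H and a :: int
    assume H: "unit_subgroup_index_le d H n" and large: "add_order d a > B"
    interpret unit_subgroup_index_le d H n by (rule H)
    define m where "m = add_order d a"
    obtain g b where gb: "d = g * m" "a = int g * b" "coprime b (int m)"
      using add_order_decomp[OF modulus_pos, of a] unfolding m_def by metis
    interpret unit_subgroup_reduction d H m by unfold_locales (simp add: gb(1))
    show "\<bar>orbit_mean d H a - 1 / 2\<bar> < \<delta>"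
      unfolding orbit_mean_reduce[OF gb(1,2)]
      using large gb(3) unit_subgroup_index_le_reduce[OF H dvd] by (intro B) (auto simp: m_def)
  qed
qed

lemma (in unit_subgroup) orbit_mean_ge:
  assumes a: "\<not> int d dvd a"
  shows "orbit_mean d H a \<ge> 1 / real (add_order d a)"
proof -
  define m where "m = add_order d a"
  obtain g b where gb: "g > 0" "d = g * m" "a = int g * b" "coprime b (int m)"
    using add_order_decomp[OF modulus_pos, of a] unfolding m_def by metis
  have m: "m > 0" using gb(2) modulus_pos by (metis mult_0_right not_gr_zero)
  have "mod_frac d (int t * a) \<ge> 1 / real m" if t: "t \<in> H" for t
  proof -
    have "\<not> int d dvd int t * a"
      using a coprime[OF t] by (simp add: int_dvd_coprime_mult_iff)
    moreover have "int t * a = int g * (int t * b)" by (simp add: gb(3))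
    ultimately have "\<not> int m dvd int t * b" using gb(2) by auto
    then show ?thesis
      using mod_frac_ge[OF m] mod_frac_mult_cancel[OF gb(1), of m "int t * b"] gb(2,3)
      by (simp add: mult.left_commute)
  qed
  then have "real (card H) * (1 / real m) \<le> (\<Sum>t\<in>H. mod_frac d (int t * a))"
    by (intro sum_bounded_below)
  then show ?thesis using card_pos by (simp add: orbit_mean_def m_def field_simps)
qed

section \<open>Sums of orbit means\<close>

definition large_order_indices :: "nat \<Rightarrow> nat \<Rightarrow> nat \<Rightarrow> (nat \<Rightarrow> int) \<Rightarrow> nat set" where
  "large_order_indices B d w a = {i. i \<le> w + 1 \<and> add_order d (a i) > B}"

lemma finite_large_order_indices [simp]: "finite (large_order_indices B d w a)"
  by (simp add: large_order_indices_def)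

lemma dvd_if_add_orders_dvd:
  assumes a: "a \<in> A'_set d w" and "d > 0" and orders: "\<And>i. i \<le> w + 1 \<Longrightarrow> add_order d (a i) dvd M"
  shows "d dvd M"
proof -
  have "int d dvd Gcd ((*) (int M) ` insert (int d) (a ` {..w+1}))"
    using orders \<open>d > 0\<close> by (intro Gcd_greatest) (auto simp: dvd_mult_iff_add_order_dvd)
  also have "\<dots> = normalize (int M * Gcd (insert (int d) (a ` {..w+1})))"
    by (rule Gcd_mult)
  also have "\<dots> = int M" using a by (simp add: A'_set_def)
  finally show ?thesis by simp
qed

lemma add_order_dvd_fact:
  assumes "d > 0" "i \<le> w + 1" "i \<notin> large_order_indices B d w a"
  shows "add_order d (a i) dvd fact B"
  using assms add_order_pos[OF assms(1), of "a i"] by (auto simp: large_order_indices_def intro!: dvd_fact)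

lemma dvd_fact_mult_sum_large_order_indices:
  assumes "a \<in> A'_set d w" "d > 0"
  shows "int d dvd int (fact B) * (\<Sum>i\<in>large_order_indices B d w a. a i)"
proof -
  let ?S = "large_order_indices B d w a"
  have "int (fact B) * (\<Sum>i\<le>w+1. a i) = int (fact B) * (\<Sum>i\<in>?S. a i) + (\<Sum>i\<in>{..w+1} - ?S. int (fact B) * a i)"
    using sum.subset_diff[of ?S "{..w+1}" a]
    by (simp add: large_order_indices_def subset_iff algebra_simps del: sum.atMost_Suc flip: sum_distrib_left)
  moreover have "int d dvd (\<Sum>i\<in>{..w+1} - ?S. int (fact B) * a i)"
    using assms(2) add_order_dvd_fact[of d _ w B a]
    by (intro dvd_sum) (auto simp: dvd_mult_iff_add_order_dvd simp del: of_nat_fact)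
  moreover have "int d dvd int (fact B) * (\<Sum>i\<le>w+1. a i)"
    using assms(1) by (simp add: A'_set_def)
  ultimately show ?thesis by (metis dvd_add_left_iff)
qed

lemma two_le_card_large_order_indices:
  assumes a: "a \<in> A'_set d w" and d: "d > fact B"
  shows "card (large_order_indices B d w a) \<ge> 2"
proof (rule ccontr)
  let ?S = "large_order_indices B d w a"
  have "d > 0" using d by simp
  assume "\<not> card ?S \<ge> 2"
  then have single: "?S = {i}" if "i \<in> ?S" for i
    using that card_le_Suc0_iff_eq[of ?S] by auto
  have "add_order d (a i) dvd fact B" if "i \<le> w + 1" for i
  proof (cases "i \<in> ?S")
    case True
    then show ?thesis
      using dvd_fact_mult_sum_large_order_indices[OF a \<open>d > 0\<close>, of B] \<open>d > 0\<close>
      by (simp add: single[OF True] dvd_mult_iff_add_order_dvd del: of_nat_fact)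
  qed (use add_order_dvd_fact[OF \<open>d > 0\<close> that] in blast)
  then have "d dvd fact B" by (rule dvd_if_add_orders_dvd[OF a \<open>d > 0\<close>])
  then show False using d by (auto dest: dvd_imp_le)
qed

text \<open>Modulo terms of small order, \<open>a\<^sub>j \<equiv> - a\<^sub>i\<close>; so the order of \<open>a\<^sub>i\<close> accounts for nearly all of \<open>d\<close>.\<close>

lemma le_fact_mult_add_order:
  assumes a: "a \<in> A'_set d w" and d: "d > 0"
    and pair: "large_order_indices B d w a = {i, j}" "i \<noteq> j"
  shows "d \<le> fact B * add_order d (a i)"
proof -
  let ?M = "fact B * add_order d (a i)"
  have "int d dvd int (add_order d (a i)) * (int (fact B) * (a i + a j))"
    using dvd_fact_mult_sum_large_order_indices[OF a d, of B] pair by simp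
  then have sum: "int d dvd int ?M * a i + int ?M * a j"
    by (simp add: algebra_simps)
  have "add_order d (a k) dvd ?M" if "k \<le> w + 1" for k
  proof -
    consider "k = i" | "k = j" | "k \<notin> large_order_indices B d w a" using pair by blast
    then show ?thesis
    proof cases
      case 2
      have "int d dvd int ?M * a i" using d by (simp only: dvd_mult_iff_add_order_dvd dvd_triv_right)
      then have "int d dvd int ?M * a j" using sum dvd_add_right_iff by blast
      then show ?thesis using d 2 by (simp only: dvd_mult_iff_add_order_dvd)
    next
      case 3
      then show ?thesis using add_order_dvd_fact[OF d that] dvd_mult2 by blast
    qed simp
  qed
  then have "d dvd ?M" by (rule dvd_if_add_orders_dvd[OF a d])
  then show ?thesis using add_order_pos[OF d] by (auto intro!: dvd_imp_le)
qed

lemma sum_gt_if_three_near_half: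
  fixes m :: "'a \<Rightarrow> real"
  assumes "finite I" "S \<subseteq> I" "card S \<ge> 3"
    and nonneg: "\<And>i. i \<in> I \<Longrightarrow> m i \<ge> 0" and near: "\<And>i. i \<in> S \<Longrightarrow> \<bar>m i - 1 / 2\<bar> < 1 / 12"
  shows "(\<Sum>i\<in>I. m i) \<ge> 5 / 4"
proof -
  have "real (card S) * (5 / 12) \<le> (\<Sum>i\<in>S. m i)"
  proof (intro sum_bounded_below)
    show "5 / 12 \<le> m i" if "i \<in> S" for i using near[OF that] by linarith
  qed
  also have "\<dots> \<le> (\<Sum>i\<in>I. m i)"
    using assms by (intro sum_mono2) auto
  finally show ?thesis using assms(3) by linarith
qed

lemma (in unit_subgroup) sum_orbit_mean_gt_if_two_large_orders:
  assumes a: "a \<in> A'_set d w" and "w \<ge> 1" and "B > 0"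
    and pair: "large_order_indices B d w a = {i, j}" "i \<noteq> j"
    and near: "\<And>l. l \<in> {i, j} \<Longrightarrow> \<bar>orbit_mean d H (a l) - 1 / 2\<bar> < 1 / (4 * real B)"
  shows "(\<Sum>l\<le>w+1. orbit_mean d H (a l)) > 1 + 1 / (2 * real B)"
proof -
  have large: "{i, j} \<subseteq> {..w+1}" using pair(1) by (auto simp: large_order_indices_def)
  have "card {i, j} < card {..w+1}" using pair(2) \<open>w \<ge> 1\<close> by simp
  then obtain k where k: "k \<le> w + 1" "k \<notin> {i, j}" using card_mono[of "{i, j}" "{..w+1}"] by fastforce
  have "add_order d (a k) \<le> B"
    using k unfolding pair(1)[symmetric] by (simp add: large_order_indices_def)
  then have "1 / real B \<le> 1 / real (add_order d (a k))"
    using add_order_pos[OF modulus_pos] \<open>B > 0\<close> by (intro divide_left_mono mult_pos_pos) auto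
  also have "\<dots> \<le> orbit_mean d H (a k)" using a k(1) by (intro orbit_mean_ge) (auto simp: A'_set_def)
  finally have "1 / real B \<le> orbit_mean d H (a k)" .
  moreover have "orbit_mean d H (a i) + orbit_mean d H (a j) + orbit_mean d H (a k)
      \<le> (\<Sum>l\<le>w+1. orbit_mean d H (a l))"
    using sum_mono2[of "{..w+1}" "{i, j, k}" "\<lambda>l. orbit_mean d H (a l)"] pair(2) large k orbit_mean_nonneg
    by (auto simp: add.assoc)
  moreover have "1 / real B = 2 * (1 / (2 * real B))" "1 / (2 * real B) = 2 * (1 / (4 * real B))" by simp_all
  ultimately show ?thesis using near[of i] near[of j] unfolding insert_iff by argo
qed

lemma (in unit_subgroup) sum_orbit_mean_gt_if_equidistributed:
  assumes a: "a \<in> A'_set d w" and w: "w \<ge> 1" and B: "B \<ge> 3" and d: "d > fact B * (M + 1)"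
    and near_B: "\<And>b. add_order d b > B \<Longrightarrow> \<bar>orbit_mean d H b - 1 / 2\<bar> < 1 / 12"
    and near_M: "\<And>b. add_order d b > M \<Longrightarrow> \<bar>orbit_mean d H b - 1 / 2\<bar> < 1 / (4 * real B)"
  shows "(\<Sum>i\<le>w+1. orbit_mean d H (a i)) > 1 + 1 / (2 * real B)"
proof -
  let ?S = "large_order_indices B d w a"
  have "fact B < d" using d by simp
  then have "card ?S \<ge> 2" by (rule two_le_card_large_order_indices[OF a])
  then consider "card ?S \<ge> 3" | "card ?S = 2" by linarith
  then show ?thesis
  proof cases
    case 1
    have "(\<Sum>i\<le>w+1. orbit_mean d H (a i)) \<ge> 5 / 4"
      using near_B by (intro sum_gt_if_three_near_half[OF _ _ 1] orbit_mean_nonneg)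
        (auto simp: large_order_indices_def)
    moreover have "1 / (2 * real B) \<le> 1 / 6" using B by simp
    ultimately show ?thesis by linarith
  next
    case 2
    then obtain i j where pair: "?S = {i, j}" "i \<noteq> j" by (meson card_2_iff)
    have near: "\<bar>orbit_mean d H (a i) - 1 / 2\<bar> < 1 / (4 * real B)" if "?S = {i, j}" "i \<noteq> j" for i j
      using le_fact_mult_add_order[OF a modulus_pos that] d
      by (intro near_M) (metis less_le_trans mult_less_cancel1 Suc_eq_plus1 Suc_lessD)
    show ?thesis
      using near[OF pair] near[of j i] pair B
      by (intro sum_orbit_mean_gt_if_two_large_orders[OF a w _ pair]) (auto simp: insert_commute)
  qed
qed

lemma sum_orbit_mean_gt:
  obtains C \<epsilon> where "\<epsilon> > 0"
    "\<And>d H w a. d > C \<Longrightarrow> unit_subgroup_index_le d H n \<Longrightarrow> w \<ge> 1 \<Longrightarrow> a \<in> A'_set d w \<Longrightarrow>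
      (\<Sum>i\<le>w+1. orbit_mean d H (a i)) > 1 + \<epsilon>"
proof -
  obtain B' where B': "\<And>d H b. unit_subgroup_index_le d H n \<Longrightarrow> add_order d b > B' \<Longrightarrow>
      \<bar>orbit_mean d H b - 1 / 2\<bar> < 1 / 12"
    using orbit_mean_equidistributed[of "1 / 12" n] by auto
  define B where "B = max B' 3"
  have B: "B \<ge> B'" "B \<ge> 3" "1 / (4 * real B) > 0" by (auto simp: B_def)
  obtain M where M: "\<And>d H b. unit_subgroup_index_le d H n \<Longrightarrow> add_order d b > M \<Longrightarrow>
      \<bar>orbit_mean d H b - 1 / 2\<bar> < 1 / (4 * real B)"
    using orbit_mean_equidistributed[OF B(3), of n] by auto
  have bound: "(\<Sum>i\<le>w+1. orbit_mean d H (a i)) > 1 + 1 / (2 * real B)"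
    if "d > fact B * (M + 1)" and H: "unit_subgroup_index_le d H n" and "w \<ge> 1" and "a \<in> A'_set d w"
    for d H w a
  proof -
    interpret unit_subgroup_index_le d H n by (rule H)
    show ?thesis
      using that B'[OF H] M[OF H] B(1,2) by (intro sum_orbit_mean_gt_if_equidistributed) auto
  qed
  show thesis by (rule that[OF _ bound]) (use B(2) in simp)
qed

section \<open>Algebraic integers modulo a prime above p\<close>

lemma alg_int_iff: "alg_int x \<longleftrightarrow> algebraic_int x"
  unfolding alg_int_def algebraic_int_altdef_ipoly by auto

lemma alg_int_of_int [simp]: "alg_int (of_int k)"
  by (simp add: alg_int_iff int_imp_algebraic_int)

lemma alg_int_of_nat [simp]: "alg_int (of_nat k)"
  by (metis alg_int_of_int of_int_of_nat_eq)

lemma alg_int_0 [simp]: "alg_int 0" and alg_int_1 [simp]: "alg_int 1"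
  using alg_int_of_nat[of 0] alg_int_of_nat[of 1] by simp_all

lemma alg_int_root_of_unity:
  assumes "z ^ n = 1" "n > 0"
  shows "alg_int z"
  unfolding alg_int_iff
  by (rule algebraic_int_root[of 1 "Polynomial.monom 1 n"])
    (use assms in \<open>auto simp: poly_monom degree_monom_eq\<close>)

lemma alg_int_unity_root: "n > 0 \<Longrightarrow> alg_int (unity_root n k)"
  by (rule alg_int_root_of_unity[of _ n]) (simp_all add: unity_root_power unity_root_eq_1_iff)

lemma rational_alg_int_dvd:
  assumes "of_int k = of_nat l * y" "alg_int y"
  shows "int l dvd k"
proof (cases "l = 0")
  case False
  then have "y = of_int k / of_nat l" using assms(1) by (simp add: field_simps)
  then have "y \<in> \<rat>" by simp
  then have "y \<in> \<int>" using assms(2) rational_algebraic_int_is_int by (simp add: alg_int_iff)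
  then obtain m where "y = of_int m" by (auto elim: Ints_cases)
  then have "(of_int k :: complex) = of_int (int l * m)" using assms(1) by simp
  then show ?thesis by (simp only: of_int_eq_iff dvd_triv_left)
qed (use assms in auto)

lemma binomial_prime:
  fixes x y :: "'a :: comm_semiring_1"
  assumes "prime l"
  shows "(x + y) ^ l = x ^ l + y ^ l
    + of_nat l * (\<Sum>k\<in>{1..<l}. of_nat ((l choose k) div l) * x ^ k * y ^ (l - k))"
proof -
  have "l \<ge> 2" using assms by (rule prime_ge_2_nat)
  then have indices: "{..l} = insert 0 (insert l {1..<l})" by auto
  have "of_nat (l choose k) = (of_nat l * of_nat ((l choose k) div l) :: 'a)" if "k \<in> {1..<l}" for k
    using that assms dvd_choose_prime[of k l] by (simp flip: of_nat_mult)
  then have "(\<Sum>k\<in>{1..<l}. of_nat (l choose k) * x ^ k * y ^ (l - k))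
      = of_nat l * (\<Sum>k\<in>{1..<l}. of_nat ((l choose k) div l) * x ^ k * y ^ (l - k))"
    unfolding sum_distrib_left by (intro sum.cong refl) (simp add: mult.assoc)
  then show ?thesis
    using \<open>l \<ge> 2\<close> unfolding binomial_ring indices by (simp add: add_ac)
qed

definition alg_dvd :: "complex \<Rightarrow> complex \<Rightarrow> bool" where
  "alg_dvd a b \<longleftrightarrow> (\<exists>w. alg_int w \<and> b = a * w)"

lemma alg_dvdI: "alg_int w \<Longrightarrow> alg_dvd a (a * w)"
  by (auto simp: alg_dvd_def)

lemma alg_dvd_mult_right: "alg_dvd a b \<Longrightarrow> alg_dvd (a * x) (b * x)"
  by (auto simp: alg_dvd_def mult_ac)

locale prime_above =
  fixes P :: "complex set" and p :: nat
  assumes prime_p: "prime p" and over: "prime_over P p"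
begin

lemma p_pos: "p > 0" and p_ge_2: "p \<ge> 2"
  using prime_p by (simp_all add: prime_gt_0_nat prime_ge_2_nat)

lemma p_nonzero [simp]: "p \<noteq> 0"
  using p_pos by simp

text \<open>The closure of the algebraic integers under the ring operations is read off the hypothesis that
  \<open>P\<close> is a prime ideal of \<^const>\<open>AI_ring\<close>, which includes that \<^const>\<open>AI_ring\<close> is a ring.\<close>

lemma primeideal_P: "primeideal P AI_ring"
  using over by (simp add: prime_over_def)

lemma AI_ring_simps [simp]:
  "carrier AI_ring = {x. alg_int x}" "x \<otimes>\<^bsub>AI_ring\<^esub> y = x * y" "x \<oplus>\<^bsub>AI_ring\<^esub> y = x + y"
  "\<one>\<^bsub>AI_ring\<^esub> = 1" "\<zero>\<^bsub>AI_ring\<^esub> = 0"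
  by (simp_all add: AI_ring_def)

lemma cring_AI_ring: "cring AI_ring"
  using primeideal_P by (simp add: primeideal_def)

lemma alg_int_mult [intro]: "alg_int x \<Longrightarrow> alg_int y \<Longrightarrow> alg_int (x * y)"
  and alg_int_add [intro]: "alg_int x \<Longrightarrow> alg_int y \<Longrightarrow> alg_int (x + y)"
  using cring.cring_simprules(1,5)[OF cring_AI_ring, of x y] by simp_all

lemma alg_int_uminus [intro]: "alg_int x \<Longrightarrow> alg_int (- x)"
  using alg_int_mult[of "-1" x] alg_int_of_int[of "-1"] by simp

lemma alg_int_diff [intro]: "alg_int x \<Longrightarrow> alg_int y \<Longrightarrow> alg_int (x - y)"
  using alg_int_add[of x "- y"] by auto

lemma alg_int_sum [intro]: "(\<And>i. i \<in> A \<Longrightarrow> alg_int (g i)) \<Longrightarrow> alg_int (\<Sum>i\<in>A. g i)"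
  by (induction A rule: infinite_finite_induct) auto

lemma alg_int_prod [intro]: "(\<And>i. i \<in> A \<Longrightarrow> alg_int (g i)) \<Longrightarrow> alg_int (\<Prod>i\<in>A. g i)"
  by (induction A rule: infinite_finite_induct) auto

lemma alg_int_power [intro]: "alg_int x \<Longrightarrow> alg_int (x ^ n)"
  by (induction n) auto

lemma alg_int_poly:
  assumes "alg_int x" "\<And>i. poly.coeff Q i \<in> \<int>"
  shows "alg_int (poly Q x)"
proof -
  have "alg_int (poly.coeff Q i)" for i using assms(2)[of i] by (auto elim: Ints_cases)
  then show ?thesis
    unfolding poly_altdef using assms(1) by (intro alg_int_sum alg_int_mult alg_int_power)
qed

lemma alg_dvd_trans [trans]: "alg_dvd a b \<Longrightarrow> alg_dvd b x \<Longrightarrow> alg_dvd a x"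
  by (auto simp: alg_dvd_def mult.assoc)

lemma mem_P_alg_int: "x \<in> P \<Longrightarrow> alg_int x"
  using primeideal_P by (auto simp: primeideal_def ideal_def additive_subgroup_def subgroup_def AI_ring_def)

lemma zero_mem_P [simp]: "0 \<in> P"
  using primeideal_P additive_subgroup.zero_closed[of P AI_ring] by (simp add: primeideal_def ideal_def)

lemma add_mem_P: "x \<in> P \<Longrightarrow> y \<in> P \<Longrightarrow> x + y \<in> P"
  using primeideal_P additive_subgroup.a_closed[of P AI_ring x y]
  by (simp add: primeideal_def ideal_def)

lemma mult_mem_P: "alg_int a \<Longrightarrow> x \<in> P \<Longrightarrow> a * x \<in> P"
  using primeideal_P ideal.I_l_closed[of P AI_ring x a] by (simp add: primeideal_def)

lemma mult_mem_P_right: "x \<in> P \<Longrightarrow> alg_int a \<Longrightarrow> x * a \<in> P"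
  using mult_mem_P by (simp add: mult.commute)

lemma uminus_mem_P: "x \<in> P \<Longrightarrow> - x \<in> P"
  using mult_mem_P[of "-1" x] alg_int_of_int[of "-1"] by simp

lemma mult_mem_P_iff: "alg_int x \<Longrightarrow> alg_int y \<Longrightarrow> x * y \<in> P \<longleftrightarrow> x \<in> P \<or> y \<in> P"
  using primeideal.I_prime[OF primeideal_P, of x y] mult_mem_P[of x y] mult_mem_P_right[of x y] by auto

lemma one_notin_P [simp]: "1 \<notin> P"
proof
  assume "1 \<in> P"
  then have "P = carrier AI_ring" using mult_mem_P_right[of 1] mem_P_alg_int by auto
  then show False using primeideal.I_notcarr[OF primeideal_P] by simp
qed

lemma prod_mem_P_iff:
  assumes "finite A" "\<And>i. i \<in> A \<Longrightarrow> alg_int (g i)"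
  shows "(\<Prod>i\<in>A. g i) \<in> P \<longleftrightarrow> (\<exists>i\<in>A. g i \<in> P)"
  using assms by (induction A rule: finite_induct) (simp_all add: mult_mem_P_iff alg_int_prod)

lemma power_mem_P_imp: "alg_int x \<Longrightarrow> x ^ n \<in> P \<Longrightarrow> x \<in> P"
  by (induction n) (auto simp: mult_mem_P_iff alg_int_power)

lemma p_mem_P: "of_nat p \<in> P"
  using over by (simp add: prime_over_def)

lemma of_int_mem_P_iff: "of_int k \<in> P \<longleftrightarrow> int p dvd k"
proof
  assume "int p dvd k"
  then obtain m where "k = int p * m" by blast
  then show "of_int k \<in> P" using mult_mem_P_right[OF p_mem_P, of "of_int m"] by simp
next
  assume k: "of_int k \<in> P"
  show "int p dvd k"
  proof (rule ccontr)
    assume "\<not> int p dvd k"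
    then have "coprime (int p) k" using prime_p by (simp add: prime_imp_coprime)
    then obtain u v where "u * int p + v * k = 1"
      by (metis bezout_int coprime_imp_gcd_eq_1)
    then have "of_int u * of_nat p + of_int v * of_int k = (1 :: complex)"
      by (metis of_int_1 of_int_add of_int_mult of_int_of_nat_eq)
    moreover have "of_int u * of_nat p + of_int v * of_int k \<in> P"
      using k p_mem_P by (intro add_mem_P mult_mem_P) auto
    ultimately show False by simp
  qed
qed

lemma of_nat_mem_P_iff: "of_nat k \<in> P \<longleftrightarrow> p dvd k"
  using of_int_mem_P_iff[of "int k"] by simp

definition cong_P :: "complex \<Rightarrow> complex \<Rightarrow> bool" (infix "\<equiv>\<^sub>P" 50) where
  "x \<equiv>\<^sub>P y \<longleftrightarrow> x - y \<in> P"

lemma cong_P_refl [simp]: "x \<equiv>\<^sub>P x"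
  by (simp add: cong_P_def)

lemma cong_P_sym: "x \<equiv>\<^sub>P y \<Longrightarrow> y \<equiv>\<^sub>P x"
  using uminus_mem_P[of "x - y"] by (simp add: cong_P_def)

lemma cong_P_trans [trans]: "x \<equiv>\<^sub>P y \<Longrightarrow> y \<equiv>\<^sub>P z \<Longrightarrow> x \<equiv>\<^sub>P z"
  using add_mem_P[of "x - y" "y - z"] by (simp add: cong_P_def)

lemma cong_P_0_iff: "x \<equiv>\<^sub>P 0 \<longleftrightarrow> x \<in> P"
  by (simp add: cong_P_def)

lemma cong_P_mem_iff: "x \<equiv>\<^sub>P y \<Longrightarrow> x \<in> P \<longleftrightarrow> y \<in> P"
  using cong_P_trans[of x y 0] cong_P_trans[of y x 0] cong_P_sym[of x y] by (auto simp: cong_P_0_iff)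

lemma cong_P_add: "x \<equiv>\<^sub>P y \<Longrightarrow> x' \<equiv>\<^sub>P y' \<Longrightarrow> x + x' \<equiv>\<^sub>P y + y'"
  using add_mem_P[of "x - y" "x' - y'"] by (simp add: cong_P_def algebra_simps)

lemma cong_P_sum: "(\<And>i. i \<in> A \<Longrightarrow> g i \<equiv>\<^sub>P h i) \<Longrightarrow> (\<Sum>i\<in>A. g i) \<equiv>\<^sub>P (\<Sum>i\<in>A. h i)"
  by (induction A rule: infinite_finite_induct) (simp_all add: cong_P_add)

lemma cong_P_mult:
  assumes "x \<equiv>\<^sub>P y" "x' \<equiv>\<^sub>P y'" "alg_int x" "alg_int y'"
  shows "x * x' \<equiv>\<^sub>P y * y'"
proof -
  have "x * x' - y * y' = x * (x' - y') + y' * (x - y)" by (simp add: algebra_simps)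
  then show ?thesis using assms by (auto simp: cong_P_def intro!: add_mem_P mult_mem_P)
qed

lemma cong_P_mult_left: "x \<equiv>\<^sub>P y \<Longrightarrow> alg_int a \<Longrightarrow> a * x \<equiv>\<^sub>P a * y"
  using mult_mem_P[of a "x - y"] by (simp add: cong_P_def right_diff_distrib)

lemma cong_P_power: "x \<equiv>\<^sub>P y \<Longrightarrow> alg_int x \<Longrightarrow> alg_int y \<Longrightarrow> x ^ n \<equiv>\<^sub>P y ^ n"
  by (induction n) (simp_all add: cong_P_mult alg_int_power)

lemma cong_P_of_int_iff: "of_int k \<equiv>\<^sub>P of_int l \<longleftrightarrow> [k = l] (mod int p)"
  using of_int_mem_P_iff[of "k - l"] by (simp add: cong_P_def cong_iff_dvd_diff)

lemma cong_P_add_power_prime: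
  assumes "alg_int x" "alg_int y"
  shows "(x + y) ^ p \<equiv>\<^sub>P x ^ p + y ^ p"
  unfolding cong_P_def binomial_prime[OF prime_p, of x y] add_diff_cancel_left'
  using assms by (intro mult_mem_P_right p_mem_P alg_int_sum alg_int_mult alg_int_power) auto

lemma cong_P_add_power_prime_power:
  assumes "alg_int x" "alg_int y"
  shows "(x + y) ^ (p ^ i) \<equiv>\<^sub>P x ^ (p ^ i) + y ^ (p ^ i)"
proof (induction i)
  case (Suc i)
  have "(x + y) ^ (p ^ Suc i) = ((x + y) ^ (p ^ i)) ^ p"
    by (simp add: power_mult[symmetric] mult.commute)
  also have "\<dots> \<equiv>\<^sub>P (x ^ (p ^ i) + y ^ (p ^ i)) ^ p"
    using assms by (intro cong_P_power Suc) auto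
  also have "\<dots> \<equiv>\<^sub>P (x ^ (p ^ i)) ^ p + (y ^ (p ^ i)) ^ p"
    using assms by (intro cong_P_add_power_prime) auto
  also have "\<dots> = x ^ (p ^ Suc i) + y ^ (p ^ Suc i)"
    by (simp add: power_mult[symmetric] mult.commute)
  finally show ?case .
qed simp

lemma cong_P_sum_power_prime:
  assumes "\<And>i. i \<in> A \<Longrightarrow> alg_int (g i)"
  shows "(\<Sum>i\<in>A. g i) ^ p \<equiv>\<^sub>P (\<Sum>i\<in>A. g i ^ p)"
  using assms
proof (induction A rule: infinite_finite_induct)
  case (insert a A)
  have "(g a + (\<Sum>i\<in>A. g i)) ^ p \<equiv>\<^sub>P g a ^ p + (\<Sum>i\<in>A. g i) ^ p"
    using insert by (intro cong_P_add_power_prime) auto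
  also have "\<dots> \<equiv>\<^sub>P g a ^ p + (\<Sum>i\<in>A. g i ^ p)"
    using insert by (intro cong_P_add) auto
  finally show ?case using insert(1,2) by simp
qed (use p_pos in \<open>simp_all add: power_0_left\<close>)

section \<open>Valuations\<close>

definition P_unit :: "complex \<Rightarrow> bool" where
  "P_unit x \<longleftrightarrow> alg_int x \<and> x \<notin> P"

lemma P_unit_alg_int: "P_unit x \<Longrightarrow> alg_int x"
  by (simp add: P_unit_def)

lemma P_unit_1 [simp]: "P_unit 1"
  by (simp add: P_unit_def)

lemma P_unit_uminus_1: "P_unit (- 1)"
  using uminus_mem_P[of "-1"] alg_int_of_int[of "-1"] by (auto simp: P_unit_def)

lemma P_unit_mult: "P_unit x \<Longrightarrow> P_unit y \<Longrightarrow> P_unit (x * y)"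
  by (auto simp: P_unit_def mult_mem_P_iff)

lemma P_unit_mult_cancel_left: "P_unit (x * y) \<Longrightarrow> alg_int x \<Longrightarrow> alg_int y \<Longrightarrow> P_unit x"
  by (auto simp: P_unit_def mult_mem_P_iff)

lemma P_unit_power: "P_unit x \<Longrightarrow> P_unit (x ^ n)"
  by (auto simp: P_unit_def dest: power_mem_P_imp)

lemma P_unit_cong: "x \<equiv>\<^sub>P y \<Longrightarrow> alg_int x \<Longrightarrow> P_unit y \<Longrightarrow> P_unit x"
  by (auto simp: P_unit_def dest: cong_P_mem_iff)

lemma P_unit_p_power_int_mult_imp:
  assumes "P_unit (of_nat p powi e * a)" "alg_int a"
  shows "e \<le> 0"
proof (rule ccontr)
  assume "\<not> e \<le> 0"
  then have e: "e = 1 + int (nat (e - 1))" by simp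
  have "of_nat p powi e * a = of_nat p * (of_nat p ^ nat (e - 1) * a)"
    by (subst e) (simp only: power_int_add of_nat_eq_0_iff p_nonzero power_int_1_right power_int_of_nat
        mult.assoc simp_thms)
  also have "\<dots> \<in> P"
    using assms(2) by (intro mult_mem_P_right p_mem_P alg_int_mult alg_int_power) simp_all
  finally show False using assms(1) by (simp add: P_unit_def)
qed

definition assoc_P :: "complex \<Rightarrow> complex \<Rightarrow> bool" (infix "\<sim>\<^sub>P" 50) where
  "x \<sim>\<^sub>P y \<longleftrightarrow> (\<exists>u v. P_unit u \<and> P_unit v \<and> u * x = v * y)"

lemma assoc_PI: "u * x = v * y \<Longrightarrow> P_unit u \<Longrightarrow> P_unit v \<Longrightarrow> x \<sim>\<^sub>P y"
  by (auto simp: assoc_P_def)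

lemma assoc_P_sym: "x \<sim>\<^sub>P y \<Longrightarrow> y \<sim>\<^sub>P x"
  by (metis assoc_P_def)

lemma assoc_P_trans [trans]:
  assumes "x \<sim>\<^sub>P y" "y \<sim>\<^sub>P z"
  shows "x \<sim>\<^sub>P z"
proof -
  obtain u v where uv: "P_unit u" "P_unit v" "u * x = v * y" using assms(1) by (auto simp: assoc_P_def)
  obtain u' v' where uv': "P_unit u'" "P_unit v'" "u' * y = v' * z" using assms(2) by (auto simp: assoc_P_def)
  have "(u' * u) * x = (v * v') * z"
    by (simp only: mult.assoc uv(3) uv'(3)[symmetric] mult.left_commute)
  then show ?thesis using uv uv' by (auto intro!: assoc_PI P_unit_mult)
qed

lemma assoc_P_mult:
  assumes "x \<sim>\<^sub>P y" "x' \<sim>\<^sub>P y'"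
  shows "x * x' \<sim>\<^sub>P y * y'"
proof -
  obtain u v where uv: "P_unit u" "P_unit v" "u * x = v * y" using assms(1) by (auto simp: assoc_P_def)
  obtain u' v' where uv': "P_unit u'" "P_unit v'" "u' * x' = v' * y'" using assms(2) by (auto simp: assoc_P_def)
  have "(u * u') * (x * x') = (u * x) * (u' * x')" by (simp add: mult_ac)
  also have "\<dots> = (v * v') * (y * y')" unfolding uv(3) uv'(3) by (simp add: mult_ac)
  finally show ?thesis using uv uv' by (auto intro!: assoc_PI P_unit_mult)
qed

lemma assoc_P_refl [simp]: "x \<sim>\<^sub>P x"
  by (rule assoc_PI[of 1 _ 1]) simp_all

lemma assoc_P_power: "x \<sim>\<^sub>P y \<Longrightarrow> x ^ n \<sim>\<^sub>P y ^ n"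
  by (induction n) (simp_all add: assoc_P_mult)

lemma assoc_P_if_mutual_alg_dvd:
  assumes dvd: "alg_dvd a x" "alg_dvd b y" "alg_dvd q (u * (a * b))"
    and u: "P_unit u" and xy: "x * y \<sim>\<^sub>P q" "q \<noteq> 0"
  shows "x \<sim>\<^sub>P a"
proof -
  obtain w w' w'' where w: "alg_int w" "x = a * w" "alg_int w'" "y = b * w'"
      "alg_int w''" "u * (a * b) = q * w''"
    using dvd by (auto simp: alg_dvd_def)
  obtain s t where st: "P_unit s" "P_unit t" "s * (x * y) = t * q"
    using xy(1) by (auto simp: assoc_P_def)
  have "q * (w * (s * w' * w'')) = s * w * w' * (q * w'')" by (simp add: mult_ac)
  also have "\<dots> = s * w * w' * (u * (a * b))" by (simp only: w(6))
  also have "\<dots> = u * (s * (x * y))" by (simp add: w(2,4) mult_ac)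
  also have "\<dots> = q * (u * t)" by (simp add: st(3) mult_ac)
  finally have "w * (s * w' * w'') = u * t" using xy(2) by simp
  moreover have "alg_int (s * w' * w'')" using st(1) w by (auto dest: P_unit_alg_int)
  ultimately have "P_unit w" using P_unit_mult[OF u st(2)] w(1) by (metis P_unit_mult_cancel_left)
  then show ?thesis using w(2) by (intro assoc_PI[of 1 _ w]) (simp_all add: mult.commute)
qed

text \<open>\<^const>\<open>val\<close> is a supremum over all approximations; \<open>has_val\<close> records that it is attained exactly.\<close>

definition has_val :: "complex \<Rightarrow> real \<Rightarrow> bool" where
  "has_val x r \<longleftrightarrow> (\<exists>n m. n > 0 \<and> x ^ n \<sim>\<^sub>P of_nat p powi m \<and> r = real_of_int m / real n)"

lemma has_valI: "x ^ n \<sim>\<^sub>P of_nat p powi m \<Longrightarrow> n > 0 \<Longrightarrow> has_val x (real_of_int m / real n)"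
  by (auto simp: has_val_def)

lemma has_val_upper_bound:
  assumes "has_val x r" and n: "n > 0" and ab: "alg_int a" "P_unit b" "b * x ^ n = of_nat p powi m * a"
  shows "real_of_int m / real n \<le> r"
proof -
  obtain l k u v where r: "l > 0" "r = real_of_int k / real l"
    and uv: "P_unit u" "P_unit v" "u * x ^ l = v * of_nat p powi k"
    using assms(1) by (auto simp: has_val_def assoc_P_def)
  have "of_nat p powi (k * int n) * (v ^ n * b ^ l) = (u * x ^ l) ^ n * b ^ l"
    by (simp add: uv(3) power_mult_distrib power_int_power' mult_ac)
  also have "\<dots> = u ^ n * (b * x ^ n) ^ l"
    by (simp add: power_mult_distrib power_mult[symmetric] mult_ac)
  also have "\<dots> = of_nat p powi (m * int l) * (u ^ n * a ^ l)"
    by (simp add: ab(3) power_mult_distrib power_int_power' mult_ac)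
  also have "\<dots> = of_nat p powi (k * int n) * (of_nat p powi (m * int l - k * int n) * (u ^ n * a ^ l))"
    by (simp add: power_int_diff)
  finally have "of_nat p powi (m * int l - k * int n) * (u ^ n * a ^ l) = v ^ n * b ^ l"
    by simp
  moreover have "P_unit (v ^ n * b ^ l)" using uv ab by (intro P_unit_mult P_unit_power)
  moreover have "alg_int (u ^ n * a ^ l)" using uv(1) ab(1) by (auto dest: P_unit_alg_int)
  ultimately have "m * int l - k * int n \<le> 0" by (metis P_unit_p_power_int_mult_imp)
  then have "real_of_int (m * int l) \<le> real_of_int (k * int n)" unfolding of_int_le_iff by simp
  then show ?thesis unfolding r(2) using n r(1) by (simp add: field_simps)
qed

lemma val_eq_if_has_val:
  assumes "has_val x r"
  shows "val P p x = r"
  unfolding val_def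
proof (rule cSup_eq_maximum)
  obtain n m u v where nm: "n > 0" "r = real_of_int m / real n"
    and uv: "P_unit u" "P_unit v" "u * x ^ n = v * of_nat p powi m"
    using assms unfolding has_val_def assoc_P_def by blast
  have "alg_int v \<and> alg_int u \<and> u \<notin> P \<and> u * x ^ n = of_nat p powi m * v"
    using uv by (simp add: P_unit_def mult.commute)
  with nm show "r \<in> {real_of_int m / real n |m n. 0 < n \<and>
      (\<exists>a b. alg_int a \<and> alg_int b \<and> b \<notin> P \<and> b * x ^ n = of_nat p powi m * a)}"
    by blast
next
  fix y assume "y \<in> {real_of_int m / real n |m n. 0 < n \<and>
      (\<exists>a b. alg_int a \<and> alg_int b \<and> b \<notin> P \<and> b * x ^ n = of_nat p powi m * a)}"
  then show "y \<le> r" using has_val_upper_bound[OF assms] unfolding P_unit_def by blast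
qed

lemma has_val_mult:
  assumes "has_val x r" "has_val y s"
  shows "has_val (x * y) (r + s)"
proof -
  obtain n m where x: "n > 0" "x ^ n \<sim>\<^sub>P of_nat p powi m" "r = real_of_int m / real n"
    using assms(1) by (auto simp: has_val_def)
  obtain n' m' where y: "n' > 0" "y ^ n' \<sim>\<^sub>P of_nat p powi m'" "s = real_of_int m' / real n'"
    using assms(2) by (auto simp: has_val_def)
  have "(x * y) ^ (n * n') = (x ^ n) ^ n' * (y ^ n') ^ n"
    by (simp add: power_mult_distrib power_mult[symmetric] mult_ac)
  also have "\<dots> \<sim>\<^sub>P (of_nat p powi m) ^ n' * (of_nat p powi m') ^ n"
    by (intro assoc_P_mult assoc_P_power x y)
  also have "\<dots> = of_nat p powi (m * int n' + m' * int n)"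
    by (simp add: power_int_power' power_int_add)
  finally have "has_val (x * y) (real_of_int (m * int n' + m' * int n) / real (n * n'))"
    using x(1) y(1) by (intro has_valI) auto
  also have "real_of_int (m * int n' + m' * int n) / real (n * n') = r + s"
    using x(1,3) y(1,3) by (simp add: field_simps)
  finally show ?thesis .
qed

lemma has_val_p_power_int: "has_val (of_nat p powi m) (real_of_int m)"
  using has_valI[of "of_nat p powi m" 1 m] by simp

lemma has_val_prod:
  "finite I \<Longrightarrow> (\<And>i. i \<in> I \<Longrightarrow> has_val (g i) (r i)) \<Longrightarrow> has_val (\<Prod>i\<in>I. g i) (\<Sum>i\<in>I. r i)"
  by (induction I rule: finite_induct) (use has_val_p_power_int[of 0] in \<open>auto intro!: has_val_mult\<close>)

lemma has_val_uminus:
  assumes "has_val x r"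
  shows "has_val (- x) r"
proof -
  have "- 1 \<sim>\<^sub>P 1" by (intro assoc_PI[of 1 _ "- 1"]) (simp_all add: P_unit_uminus_1)
  then have "has_val (- 1) 0" using has_valI[of "-1" 1 0] by simp
  from has_val_mult[OF this assms] show ?thesis by simp
qed

end

section \<open>Teichmueller lifts\<close>

lemma finite_mu [simp]: "n > 0 \<Longrightarrow> finite (mu n)" and card_mu [simp]: "n > 0 \<Longrightarrow> card (mu n) = n"
  using card_roots_unity_eq[of n] finite_roots_unity[of n] by (simp_all add: mu_def)

lemma bij_betw_unity_root_mu:
  assumes "n > 0"
  shows "bij_betw (\<lambda>b. unity_root n (int b)) {..<n} (mu n)"
  using Complex.bij_betw_roots_unity[OF assms] by (simp add: unity_root_def mu_def)

lemma mu_E: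
  assumes "z \<in> mu n" "n > 0"
  obtains k where "z = unity_root n (int k)"
  using assms bij_betw_imp_surj_on[OF bij_betw_unity_root_mu] by blast

lemma power_minus_1_eq_prod_mu:
  assumes "n > 0"
  shows "x ^ n - 1 = (\<Prod>u\<in>mu n. x - u)"
proof -
  define A where "A = Polynomial.monom 1 n - (1 :: complex poly)"
  define B where "B = (\<Prod>u\<in>mu n. [:- u, 1:])"
  have degree_B: "degree B = n" using assms by (simp add: B_def degree_prod_eq_sum_degree)
  have "A = B"
  proof (rule poly_eqI_degree_lead_coeff[where A = "mu n"])
    have "lead_coeff B = 1" unfolding B_def by (simp add: lead_coeff_prod)
    then show "poly.coeff A n = poly.coeff B n" using assms degree_B by (simp add: A_def)
    show "degree A \<le> n" by (simp add: A_def degree_diff_le degree_monom_le)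
    show "poly A u = poly B u" if "u \<in> mu n" for u
      using that assms by (auto simp: A_def B_def poly_prod poly_monom mu_def intro!: prod_zero)
  qed (use assms degree_B in simp_all)
  then have "poly A x = poly B x" by simp
  then show ?thesis by (simp add: A_def B_def poly_monom poly_prod)
qed

lemma sum_mu_power_int:
  assumes "n > 0"
  shows "(\<Sum>z\<in>mu n. z powi k) = (if int n dvd k then of_nat n else 0)"
proof -
  have "(\<Sum>z\<in>mu n. z powi k) = (\<Sum>b<n. unity_root n (int b) powi k)"
    by (rule sum.reindex_bij_betw[OF bij_betw_unity_root_mu[OF assms], symmetric])
  also have "\<dots> = (\<Sum>b<n. unity_root n (int b * k))"
    by (intro sum.cong refl) (simp add: unity_root_def cis_power_int mult_ac)
  finally show ?thesis using sum_unity_root[OF assms] by simp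
qed

locale finite_lift = prime_above +
  fixes f :: nat
  assumes f_pos: "f > 0"
begin

definition N :: nat where "N = p ^ f - 1"

lemma Suc_N: "Suc N = p ^ f" and N_pos [simp]: "N > 0"
  using p_ge_2 f_pos self_le_power[of p f] by (simp_all add: N_def)

lemma N_nonzero [simp]: "N \<noteq> 0"
  using N_pos by linarith

lemma coprime_p_power_N: "coprime (p ^ i) N"
proof -
  have "coprime (Suc N) N" by (rule coprime_Suc_left_nat)
  then have "coprime p N" unfolding Suc_N using f_pos by simp
  then show ?thesis by simp
qed

lemma P_unit_N: "P_unit (of_nat N)"
  using coprime_p_power_N[of 1] prime_p
  by (auto simp: P_unit_def of_nat_mem_P_iff coprime_absorb_left not_prime_unit)

lemma mu_power_q: "z \<in> mu N \<Longrightarrow> z ^ (p ^ f) = z"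
  by (simp add: mu_def flip: Suc_N)

lemma alg_int_mu: "z \<in> mu N \<Longrightarrow> alg_int z"
  using alg_int_root_of_unity N_pos by (auto simp: mu_def)

lemma mu_nonzero: "z \<in> mu N \<Longrightarrow> z \<noteq> 0"
  by (auto simp: mu_def power_0_left)

lemma one_mem_mu [simp]: "1 \<in> mu N"
  and mult_mem_mu: "z \<in> mu N \<Longrightarrow> w \<in> mu N \<Longrightarrow> z * w \<in> mu N"
  and divide_mem_mu: "z \<in> mu N \<Longrightarrow> w \<in> mu N \<Longrightarrow> z / w \<in> mu N"
  and power_mem_mu: "z \<in> mu N \<Longrightarrow> z ^ k \<in> mu N"
  by (auto simp: mu_def power_mult_distrib power_divide) (metis mult.commute power_mult power_one)

lemma inverse_mem_mu: "z \<in> mu N \<Longrightarrow> inverse z \<in> mu N"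
  using divide_mem_mu[OF one_mem_mu] by (simp add: divide_inverse)

lemma power_int_mem_mu: "z \<in> mu N \<Longrightarrow> z powi k \<in> mu N"
  by (simp add: power_int_def power_mem_mu inverse_mem_mu)

lemma mu_power_int_cong:
  assumes "[k = l] (mod int N)" "z \<in> mu N"
  shows "z powi k = z powi l"
proof -
  obtain m where "k = l + int N * m"
    using assms(1) unfolding cong_iff_dvd_diff dvd_def by (metis add.commute diff_add_cancel)
  then show ?thesis
    using assms(2) mu_nonzero[OF assms(2)] by (simp add: power_int_add power_int_mult mu_def)
qed

lemma P_unit_mu: "z \<in> mu N \<Longrightarrow> P_unit z"
  using power_mem_P_imp[of z N] P_unit_mult_cancel_left[of z "inverse z"]
  by (simp add: alg_int_mu inverse_mem_mu mu_nonzero)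

lemma mu_eq_if_cong_P:
  assumes z: "z \<in> mu N" "w \<in> mu N" and "z \<equiv>\<^sub>P w"
  shows "z = w"
proof (rule ccontr)
  define v where "v = inverse w * z"
  have v: "v \<in> mu N" using z by (simp add: v_def mult_mem_mu inverse_mem_mu)
  have "v \<equiv>\<^sub>P inverse w * w"
    unfolding v_def using assms by (intro cong_P_mult_left alg_int_mu inverse_mem_mu)
  then have "v \<equiv>\<^sub>P 1" using mu_nonzero[OF z(2)] by simp
  then have "(\<Sum>j<N. v ^ j) \<equiv>\<^sub>P (\<Sum>j<N. 1 ^ j)"
    using alg_int_mu[OF v] by (intro cong_P_sum cong_P_power) auto
  moreover assume "z \<noteq> w"
  then have "v \<noteq> 1" using mu_nonzero[OF z(2)] by (simp add: v_def field_simps)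
  then have "(\<Sum>j<N. v ^ j) = 0" using v by (simp add: geometric_sum mu_def)
  ultimately have "of_nat N \<in> P" by (simp add: cong_P_sym flip: cong_P_0_iff)
  then show False using P_unit_N by (simp add: P_unit_def)
qed

text \<open>\<open>lifts\<close> are the Teichmueller representatives of \<open>\<bbbF>\<^sub>q\<close>, \<open>frobenius_fixed\<close> is the preimage of \<open>\<bbbF>\<^sub>q\<close> in the
  ring of algebraic integers.\<close>

abbreviation lifts :: "complex set" where "lifts \<equiv> insert 0 (mu N)"

definition frobenius_fixed :: "complex set" where
  "frobenius_fixed = {x. alg_int x \<and> x ^ (p ^ f) \<equiv>\<^sub>P x}"

lemma sum_lifts: "(\<Sum>x\<in>lifts. g x) = g 0 + (\<Sum>z\<in>mu N. g z)"
  using mu_nonzero by (subst sum.insert) auto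

lemma card_lifts: "card lifts = p ^ f"
  using mu_nonzero by (subst card_insert_disjoint) (auto simp: Suc_N)

lemma lifts_eq_if_cong_P:
  assumes "z \<in> lifts" "w \<in> lifts" "z \<equiv>\<^sub>P w"
  shows "z = w"
  using assms mu_eq_if_cong_P[of z w] P_unit_mu[of z] P_unit_mu[of w] cong_P_mem_iff[of z w]
  by (auto simp: P_unit_def)

lemma frobenius_fixed_alg_int: "x \<in> frobenius_fixed \<Longrightarrow> alg_int x"
  by (simp add: frobenius_fixed_def)

lemma lifts_subset_frobenius_fixed: "lifts \<subseteq> frobenius_fixed"
  using alg_int_mu mu_power_q by (auto simp: frobenius_fixed_def power_0_left)

lemma frobenius_fixed_add:
  assumes "x \<in> frobenius_fixed" "y \<in> frobenius_fixed"
  shows "x + y \<in> frobenius_fixed"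
proof -
  have "(x + y) ^ (p ^ f) \<equiv>\<^sub>P x ^ (p ^ f) + y ^ (p ^ f)"
    using assms by (intro cong_P_add_power_prime_power frobenius_fixed_alg_int)
  also have "\<dots> \<equiv>\<^sub>P x + y" using assms by (auto simp: frobenius_fixed_def intro: cong_P_add)
  finally show ?thesis using assms by (auto simp: frobenius_fixed_def)
qed

lemma frobenius_fixed_sum: "(\<And>i. i \<in> A \<Longrightarrow> g i \<in> frobenius_fixed) \<Longrightarrow> (\<Sum>i\<in>A. g i) \<in> frobenius_fixed"
  by (induction A rule: infinite_finite_induct)
    (use lifts_subset_frobenius_fixed in \<open>auto intro: frobenius_fixed_add\<close>)

lemma of_nat_frobenius_fixed: "of_nat k \<in> frobenius_fixed"
  using frobenius_fixed_sum[of "{..<k}" "\<lambda>_. 1"] lifts_subset_frobenius_fixed one_mem_mu by force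

lemma teichmueller_lift_exists:
  assumes x: "x \<in> frobenius_fixed"
  shows "\<exists>u\<in>lifts. x \<equiv>\<^sub>P u"
proof -
  have "x * (\<Prod>u\<in>mu N. x - u) = x ^ Suc N - x"
    by (simp add: algebra_simps flip: power_minus_1_eq_prod_mu)
  also have "\<dots> \<in> P" using x unfolding Suc_N by (simp add: frobenius_fixed_def cong_P_def)
  finally have "x \<in> P \<or> (\<exists>u\<in>mu N. x - u \<in> P)"
    using frobenius_fixed_alg_int[OF x] alg_int_mu
    by (simp add: mult_mem_P_iff prod_mem_P_iff alg_int_prod alg_int_diff)
  then show ?thesis by (auto simp: cong_P_def)
qed

definition teich :: "complex \<Rightarrow> complex" where
  "teich x = (SOME u. u \<in> lifts \<and> x \<equiv>\<^sub>P u)"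

lemma
  assumes "x \<in> frobenius_fixed"
  shows teich_mem: "teich x \<in> lifts" and cong_P_teich: "x \<equiv>\<^sub>P teich x"
  using someI_ex[of "\<lambda>u. u \<in> lifts \<and> x \<equiv>\<^sub>P u"] teichmueller_lift_exists[OF assms]
  unfolding teich_def by blast+

lemma teich_frobenius_fixed: "x \<in> frobenius_fixed \<Longrightarrow> teich x \<in> frobenius_fixed"
  using teich_mem lifts_subset_frobenius_fixed by blast

lemma teich_eq_iff:
  assumes "x \<in> frobenius_fixed" "u \<in> lifts"
  shows "teich x = u \<longleftrightarrow> x \<equiv>\<^sub>P u"
  using cong_P_teich[OF assms(1)] teich_mem[OF assms(1)] assms(2)
  by (metis cong_P_sym cong_P_trans lifts_eq_if_cong_P)

lemma teich_eq_teich_iff: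
  assumes "x \<in> frobenius_fixed" "y \<in> frobenius_fixed"
  shows "teich x = teich y \<longleftrightarrow> x \<equiv>\<^sub>P y"
  using cong_P_teich[OF assms(2)] teich_eq_iff[OF assms(1) teich_mem[OF assms(2)]]
  by (metis cong_P_sym cong_P_trans)

lemma teich_translate_bij:
  assumes w: "w \<in> lifts"
  shows "bij_betw (\<lambda>x. teich (x + w)) lifts lifts"
proof -
  have fixed: "x + w \<in> frobenius_fixed" if "x \<in> lifts" for x
    using that w lifts_subset_frobenius_fixed frobenius_fixed_add by blast
  have "inj_on (\<lambda>x. teich (x + w)) lifts"
  proof (rule inj_onI)
    fix x y assume xy: "x \<in> lifts" "y \<in> lifts" "teich (x + w) = teich (y + w)"
    then have "x + w \<equiv>\<^sub>P y + w" using fixed teich_eq_teich_iff by blast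
    then show "x = y" using xy lifts_eq_if_cong_P by (simp add: cong_P_def)
  qed
  moreover have "(\<lambda>x. teich (x + w)) ` lifts \<subseteq> lifts" using teich_mem fixed by blast
  moreover have "finite lifts" by simp
  ultimately show ?thesis unfolding bij_betw_def using endo_inj_surj by blast
qed

end

lemma (in prime_above) cong_P_of_int_if_frobenius_fixed:
  assumes "alg_int y" "y ^ p \<equiv>\<^sub>P y"
  obtains k where "y \<equiv>\<^sub>P of_int k"
proof -
  interpret F: finite_lift P p "Suc 0" by unfold_locales simp
  have y: "y \<in> F.frobenius_fixed" using assms by (simp add: F.frobenius_fixed_def)
  have "inj_on (\<lambda>k. F.teich (of_nat k)) {..<p}"
  proof (rule inj_onI)
    fix i j assume ij: "i \<in> {..<p}" "j \<in> {..<p}" "F.teich (of_nat i) = F.teich (of_nat j)"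
    then have "of_int (int i) \<equiv>\<^sub>P of_int (int j)"
      using F.teich_eq_teich_iff[OF F.of_nat_frobenius_fixed F.of_nat_frobenius_fixed] by simp
    then show "i = j" using ij(1,2) unfolding cong_P_of_int_iff cong_int_iff by (simp add: cong_def)
  qed
  then have "card ((\<lambda>k. F.teich (of_nat k)) ` {..<p}) = card F.lifts"
    by (simp only: card_image F.card_lifts) simp
  then have "(\<lambda>k. F.teich (of_nat k)) ` {..<p} = F.lifts"
    using F.teich_mem[OF F.of_nat_frobenius_fixed] by (intro card_subset_eq) (simp_all add: image_subset_iff)
  then obtain k :: nat where "F.teich y = F.teich (of_nat k)" using F.teich_mem[OF y] by auto
  then have "y \<equiv>\<^sub>P of_int (int k)"
    using F.teich_eq_teich_iff[OF y F.of_nat_frobenius_fixed, of k] by simp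
  then show thesis by (rule that)
qed

section \<open>Gauss and Jacobi sums\<close>

context finite_lift
begin

abbreviation tr :: "complex \<Rightarrow> complex" where "tr x \<equiv> (\<Sum>i<f. x ^ (p ^ i))"

lemma sum_power_p_shift: "(\<Sum>i<f. (x ^ (p ^ i)) ^ p) = tr x - x + x ^ (p ^ f)"
proof -
  have "(\<Sum>i<f. (x ^ (p ^ i)) ^ p) = (\<Sum>i<f. x ^ (p ^ Suc i))"
    by (intro sum.cong refl) (simp add: power_mult[symmetric] mult.commute)
  then show ?thesis
    using sum.lessThan_Suc_shift[of "\<lambda>i. x ^ (p ^ i)" f] by (simp add: algebra_simps)
qed

lemma tr_cong_P_int:
  assumes x: "x \<in> frobenius_fixed"
  shows "\<exists>k. tr x \<equiv>\<^sub>P of_int k"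
proof -
  have "tr x ^ p \<equiv>\<^sub>P (\<Sum>i<f. (x ^ (p ^ i)) ^ p)"
    using x by (intro cong_P_sum_power_prime alg_int_power frobenius_fixed_alg_int)
  also have "\<dots> \<equiv>\<^sub>P tr x"
    using x unfolding sum_power_p_shift by (simp add: frobenius_fixed_def cong_P_def)
  finally have "tr x ^ p \<equiv>\<^sub>P tr x" .
  moreover have "alg_int (tr x)"
    using x by (intro alg_int_sum alg_int_power frobenius_fixed_alg_int)
  ultimately show ?thesis using cong_P_of_int_if_frobenius_fixed by metis
qed

lemma tr_cong_P_trace_int: "x \<in> frobenius_fixed \<Longrightarrow> tr x \<equiv>\<^sub>P of_int (trace_int P p f x)"
  using someI_ex[OF tr_cong_P_int] by (simp add: trace_int_def cong_P_def)

lemma tr_add: "x \<in> frobenius_fixed \<Longrightarrow> y \<in> frobenius_fixed \<Longrightarrow> tr (x + y) \<equiv>\<^sub>P tr x + tr y"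
  unfolding sum.distrib[symmetric]
  by (intro cong_P_sum cong_P_add_power_prime_power frobenius_fixed_alg_int)

lemma tr_cong: "x \<in> frobenius_fixed \<Longrightarrow> y \<in> frobenius_fixed \<Longrightarrow> x \<equiv>\<^sub>P y \<Longrightarrow> tr x \<equiv>\<^sub>P tr y"
  by (intro cong_P_sum cong_P_power frobenius_fixed_alg_int)

lemma tr_mu_power_p: "z \<in> mu N \<Longrightarrow> tr (z ^ p) = tr z"
  using sum_power_p_shift[of z] by (simp add: mu_power_q power_mult[symmetric] mult.commute)

lemma N_dvd_p_power_minus_1_iff:
  assumes "i < f"
  shows "int N dvd int (p ^ i) - 1 \<longleftrightarrow> i = 0"
proof
  assume dvd: "int N dvd int (p ^ i) - 1"
  have "p ^ i < Suc N"
    using assms p_ge_2 unfolding Suc_N by (intro power_strict_increasing) auto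
  then have "int (p ^ i) - 1 < int N" by linarith
  then have "\<not> 0 < int (p ^ i) - 1" using dvd zdvd_not_zless by blast
  then have "p ^ i \<le> 1" by linarith
  then show "i = 0" using p_ge_2 self_le_power[of p i] by (cases "i = 0") auto
qed simp

lemma sum_mu_inverse_tr: "(\<Sum>z\<in>mu N. inverse z * tr z) = of_nat N"
proof -
  have "(\<Sum>z\<in>mu N. inverse z * tr z) = (\<Sum>z\<in>mu N. \<Sum>i<f. z powi (int (p ^ i) - 1))"
    unfolding sum_distrib_left
    by (intro sum.cong refl) (simp add: power_int_diff mu_nonzero field_simps flip: of_nat_power)
  also have "\<dots> = (\<Sum>i<f. \<Sum>z\<in>mu N. z powi (int (p ^ i) - 1))" by (rule sum.swap)
  also have "\<dots> = (\<Sum>i<f. if i = 0 then of_nat N else 0)"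
    by (intro sum.cong refl) (simp add: sum_mu_power_int N_dvd_p_power_minus_1_iff del: of_nat_power)
  also have "\<dots> = of_nat N" using f_pos by simp
  finally show ?thesis .
qed

end

locale gauss_sums = finite_lift +
  fixes c :: int
  assumes c: "\<not> int p dvd c"
begin

abbreviation \<psi> :: "complex \<Rightarrow> complex" where "\<psi> \<equiv> psi_q P p c f"

lemma psi_eq_unity_root: "\<psi> x = unity_root p (c * trace_int P p f x)"
  by (simp only: psi_q_def exp_eq_unity_root)

lemma psi_eqI:
  assumes "x \<in> frobenius_fixed" "tr x \<equiv>\<^sub>P of_int k"
  shows "\<psi> x = unity_root p (c * k)"
proof -
  have "of_int (trace_int P p f x) \<equiv>\<^sub>P of_int k"
    using cong_P_sym[OF tr_cong_P_trace_int[OF assms(1)]] assms(2) by (rule cong_P_trans)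
  then show ?thesis
    unfolding psi_eq_unity_root cong_P_of_int_iff by (intro unity_root_cong cong_mult cong_refl)
qed

lemma psi_cong:
  assumes "x \<in> frobenius_fixed" "y \<in> frobenius_fixed" "x \<equiv>\<^sub>P y"
  shows "\<psi> x = \<psi> y"
  using psi_eqI[OF assms(1) cong_P_trans[OF tr_cong[OF assms] tr_cong_P_trace_int[OF assms(2)]]]
  by (simp only: psi_eq_unity_root)

lemma psi_teich: "x \<in> frobenius_fixed \<Longrightarrow> \<psi> (teich x) = \<psi> x"
  by (intro psi_cong teich_frobenius_fixed cong_P_sym[OF cong_P_teich])

lemma psi_add:
  assumes "x \<in> frobenius_fixed" "y \<in> frobenius_fixed"
  shows "\<psi> (x + y) = \<psi> x * \<psi> y"
proof -
  have "tr (x + y) \<equiv>\<^sub>P tr x + tr y" using assms by (rule tr_add)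
  also have "\<dots> \<equiv>\<^sub>P of_int (trace_int P p f x) + of_int (trace_int P p f y)"
    using assms by (intro cong_P_add tr_cong_P_trace_int)
  finally have "\<psi> (x + y) = unity_root p (c * (trace_int P p f x + trace_int P p f y))"
    using assms by (intro psi_eqI frobenius_fixed_add) simp_all
  then show ?thesis by (simp only: psi_eq_unity_root unity_root_add distrib_left)
qed

lemma psi_0 [simp]: "\<psi> 0 = 1"
  using psi_eqI[of 0 0] lifts_subset_frobenius_fixed by (simp add: power_0_left)

lemma psi_sum:
  "finite I \<Longrightarrow> (\<And>i. i \<in> I \<Longrightarrow> x i \<in> frobenius_fixed) \<Longrightarrow> \<psi> (\<Sum>i\<in>I. x i) = (\<Prod>i\<in>I. \<psi> (x i))"
  by (induction I rule: finite_induct) (simp_all add: psi_add frobenius_fixed_sum)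

lemma psi_power_p_arg: "z \<in> mu N \<Longrightarrow> \<psi> (z ^ p) = \<psi> z"
  by (simp add: psi_q_def trace_int_def tr_mu_power_p)

lemma alg_int_psi: "alg_int (\<psi> x)"
  unfolding psi_eq_unity_root by (rule alg_int_unity_root[OF p_pos])

lemma psi_nontrivial: "\<exists>z\<in>mu N. \<psi> z \<noteq> 1"
proof (rule ccontr)
  assume trivial: "\<not> (\<exists>z\<in>mu N. \<psi> z \<noteq> 1)"
  have "inverse z * tr z \<equiv>\<^sub>P 0" if z: "z \<in> mu N" for z
  proof -
    have "int p dvd c * trace_int P p f z"
      using trivial z p_pos by (simp add: psi_eq_unity_root unity_root_eq_1_iff)
    then have "int p dvd trace_int P p f z"
      using c prime_p by (simp add: prime_dvd_mult_iff)
    then have "tr z \<in> P"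
      using tr_cong_P_trace_int[of z] z lifts_subset_frobenius_fixed cong_P_mem_iff of_int_mem_P_iff by blast
    then show ?thesis
      using z by (simp add: cong_P_0_iff mult_mem_P alg_int_mu inverse_mem_mu)
  qed
  then have "(\<Sum>z\<in>mu N. inverse z * tr z) \<equiv>\<^sub>P (\<Sum>z\<in>mu N. 0)" by (rule cong_P_sum)
  then show False using P_unit_N by (simp add: sum_mu_inverse_tr cong_P_0_iff P_unit_def)
qed

lemma sum_psi: "(\<Sum>z\<in>mu N. \<psi> z) = - 1"
proof -
  obtain w where w: "w \<in> mu N" "\<psi> w \<noteq> 1" using psi_nontrivial by blast
  have "(\<Sum>x\<in>lifts. \<psi> x) = (\<Sum>x\<in>lifts. \<psi> (teich (x + w)))"
    using w by (intro sum.reindex_bij_betw[OF teich_translate_bij, symmetric]) simp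
  also have "\<dots> = (\<Sum>x\<in>lifts. \<psi> x * \<psi> w)"
  proof (intro sum.cong refl)
    fix x assume "x \<in> lifts"
    then have "x \<in> frobenius_fixed" "w \<in> frobenius_fixed"
      using w(1) lifts_subset_frobenius_fixed by blast+
    then show "\<psi> (teich (x + w)) = \<psi> x * \<psi> w"
      by (simp add: psi_teich psi_add frobenius_fixed_add)
  qed
  also have "\<dots> = (\<Sum>x\<in>lifts. \<psi> x) * \<psi> w" by (rule sum_distrib_right[symmetric])
  finally have "(\<Sum>x\<in>lifts. \<psi> x) = 0" using w(2) by simp
  then show ?thesis unfolding sum_lifts by (simp add: eq_neg_iff_add_eq_0 add.commute)
qed

text \<open>\<open>G k\<close> is the Gauss sum of the character \<open>t\<^sup>-\<^sup>k\<close>, for \<open>t\<close> the Teichmueller character.\<close>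

definition G :: "int \<Rightarrow> complex" where
  "G k = - (\<Sum>z\<in>mu N. z powi (- k) * \<psi> z)"

lemma alg_int_G: "alg_int (G k)"
  unfolding G_def by (intro alg_int_uminus alg_int_sum alg_int_mult alg_int_psi alg_int_mu power_int_mem_mu)

lemma G_cong: "[k = l] (mod int N) \<Longrightarrow> G k = G l"
  unfolding G_def
  by (intro arg_cong[where f = uminus] sum.cong refl arg_cong2[where f = "(*)"] mu_power_int_cong)
    (auto simp: cong_minus_minus_iff)

lemma G_trivial: "int N dvd k \<Longrightarrow> G k = 1"
  using G_cong[of k 0] sum_psi by (simp add: cong_0_iff G_def)

lemma G_mult_p: "G (int p * k) = G k"
proof -
  have bij: "bij_betw (\<lambda>z. z ^ p) (mu N) (mu N)"
  proof (rule bij_betwI[of _ _ _ "\<lambda>z. z ^ (p ^ (f - 1))"])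
    have "p * p ^ (f - 1) = p ^ f" using f_pos by (metis power_eq_if not_gr_zero)
    then show "(z ^ p) ^ (p ^ (f - 1)) = z" "(z ^ (p ^ (f - 1))) ^ p = z" if "z \<in> mu N" for z
      using mu_power_q[OF that] by (simp_all add: power_mult[symmetric] mult.commute)
  qed (auto intro: power_mem_mu)
  have "G k = - (\<Sum>z\<in>mu N. (z ^ p) powi (- k) * \<psi> (z ^ p))"
    unfolding G_def by (subst sum.reindex_bij_betw[OF bij]) simp
  also have "\<dots> = - (\<Sum>z\<in>mu N. z powi (- (int p * k)) * \<psi> z)"
  proof -
    have "(z ^ p) powi (- k) = z powi (- (int p * k))" for z :: complex
      by (metis mult_minus_right power_int_mult power_int_of_nat)
    then show ?thesis by (simp add: psi_power_p_arg)
  qed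
  finally show ?thesis by (simp add: G_def)
qed

definition tuples :: "'i set \<Rightarrow> complex \<Rightarrow> ('i \<Rightarrow> complex) set" where
  "tuples I s = {x \<in> PiE I (\<lambda>_. mu N). (\<Sum>i\<in>I. x i) \<equiv>\<^sub>P s}"

text \<open>\<open>char_sum I k 0\<close> is the Jacobi sum up to the factor \<open>1 / N\<close>.\<close>

definition char_sum :: "'i set \<Rightarrow> ('i \<Rightarrow> int) \<Rightarrow> complex \<Rightarrow> complex" where
  "char_sum I k s = (\<Sum>x\<in>tuples I s. \<Prod>i\<in>I. x i powi (- k i))"

lemma alg_int_char_sum: "alg_int (char_sum I k s)"
  unfolding char_sum_def
  by (intro alg_int_sum alg_int_prod alg_int_mu power_int_mem_mu) (auto simp: tuples_def)

lemma tuples_scale: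
  assumes s: "s \<in> mu N" and x: "x \<in> tuples I r"
  shows "(\<lambda>i\<in>I. s * x i) \<in> tuples I (s * r)"
proof -
  have "(\<Sum>i\<in>I. s * x i) \<equiv>\<^sub>P s * r"
    using x s unfolding sum_distrib_left[symmetric] tuples_def by (auto intro: cong_P_mult_left alg_int_mu)
  then show ?thesis using x s by (auto simp: tuples_def intro!: mult_mem_mu)
qed

lemma bij_betw_tuples_scale:
  assumes s: "s \<in> mu N"
  shows "bij_betw (\<lambda>x. \<lambda>i\<in>I. s * x i) (tuples I r) (tuples I (s * r))"
proof (rule bij_betwI[of _ _ _ "\<lambda>x. \<lambda>i\<in>I. inverse s * x i"])
  have "inverse s * (s * r) = r" using mu_nonzero[OF s] by simp
  then show "(\<lambda>x. \<lambda>i\<in>I. inverse s * x i) \<in> tuples I (s * r) \<rightarrow> tuples I r"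
    using tuples_scale[OF inverse_mem_mu[OF s], of _ I "s * r"] by (intro Pi_I) (simp only:)
  show "(\<lambda>x. \<lambda>i\<in>I. s * x i) \<in> tuples I r \<rightarrow> tuples I (s * r)"
    using tuples_scale[OF s] by blast
qed (use mu_nonzero[OF s] in \<open>auto simp: tuples_def PiE_def extensional_def fun_eq_iff\<close>)

lemma char_sum_scale:
  assumes I: "finite I" and s: "s \<in> mu N"
  shows "char_sum I k (s * r) = s powi (- (\<Sum>i\<in>I. k i)) * char_sum I k r"
proof -
  have "char_sum I k (s * r) = (\<Sum>x\<in>tuples I r. \<Prod>i\<in>I. (\<lambda>i\<in>I. s * x i) i powi (- k i))"
    unfolding char_sum_def by (rule sum.reindex_bij_betw[OF bij_betw_tuples_scale[OF s], symmetric])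
  also have "\<dots> = (\<Sum>x\<in>tuples I r. (\<Prod>i\<in>I. s powi (- k i)) * (\<Prod>i\<in>I. x i powi (- k i)))"
    by (simp add: power_int_mult_distrib prod.distrib)
  also have "(\<Prod>i\<in>I. s powi (- k i)) = s powi (- (\<Sum>i\<in>I. k i))"
    using I mu_nonzero[OF s]
    by (induction I rule: finite_induct) (simp_all add: power_int_diff power_int_minus_divide)
  finally show ?thesis by (simp add: char_sum_def sum_distrib_left)
qed

lemma char_sum_0_eq_0:
  assumes I: "finite I" and nontrivial: "\<not> int N dvd (\<Sum>i\<in>I. k i)"
  shows "char_sum I k 0 = 0"
proof -
  have "of_nat N * char_sum I k 0 = (\<Sum>s\<in>mu N. char_sum I k (s * 0))" by simp
  also have "\<dots> = (\<Sum>s\<in>mu N. s powi (- (\<Sum>i\<in>I. k i))) * char_sum I k 0"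
    unfolding sum_distrib_right by (intro sum.cong refl char_sum_scale[OF I])
  also have "\<dots> = 0" using nontrivial by (simp add: sum_mu_power_int)
  finally show ?thesis by simp
qed

lemma char_sum_eq_char_sum_1:
  assumes I: "finite I" and trivial: "int N dvd (\<Sum>i\<in>I. k i)" and s: "s \<in> mu N"
  shows "char_sum I k s = char_sum I k 1"
proof -
  have "s powi (- (\<Sum>i\<in>I. k i)) = s powi 0"
    using trivial s by (intro mu_power_int_cong) (auto simp: cong_0_iff)
  then show ?thesis using char_sum_scale[OF I s, of k 1] by simp
qed

lemma sum_over_tuples:
  fixes h :: "complex \<Rightarrow> complex"
  assumes I: "finite I"
  shows "(\<Sum>x\<in>PiE I (\<lambda>_. mu N). h (teich (\<Sum>i\<in>I. x i)) * g x) = (\<Sum>s\<in>lifts. h s * (\<Sum>x\<in>tuples I s. g x))"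
proof -
  let ?X = "PiE I (\<lambda>_. mu N)"
  have fixed: "(\<Sum>i\<in>I. x i) \<in> frobenius_fixed" if "x \<in> ?X" for x
    using that lifts_subset_frobenius_fixed by (intro frobenius_fixed_sum) auto
  have "(\<Sum>x\<in>?X. h (teich (\<Sum>i\<in>I. x i)) * g x)
      = (\<Sum>s\<in>lifts. \<Sum>x\<in>{x \<in> ?X. teich (\<Sum>i\<in>I. x i) = s}. h (teich (\<Sum>i\<in>I. x i)) * g x)"
    using teich_mem[OF fixed] I by (intro sum.group[symmetric] finite_PiE) auto
  also have "\<dots> = (\<Sum>s\<in>lifts. \<Sum>x\<in>tuples I s. h s * g x)"
  proof (intro sum.cong[OF refl])
    fix s assume "s \<in> lifts"
    then have "tuples I s = {x \<in> ?X. teich (\<Sum>i\<in>I. x i) = s}"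
      using teich_eq_iff[OF fixed] by (auto simp: tuples_def)
    then show "(\<Sum>x\<in>{x \<in> ?X. teich (\<Sum>i\<in>I. x i) = s}. h (teich (\<Sum>i\<in>I. x i)) * g x)
        = (\<Sum>x\<in>tuples I s. h s * g x)"
      by (auto intro!: sum.cong)
  qed
  finally show ?thesis by (simp only: sum_distrib_left)
qed

lemma prod_G_eq_char_sum:
  assumes I: "finite I"
  shows "(\<Prod>i\<in>I. - G (k i)) = char_sum I k 0 - char_sum I k 1 * G (\<Sum>i\<in>I. k i)"
proof -
  let ?X = "PiE I (\<lambda>_. mu N)"
  have "(\<Prod>i\<in>I. - G (k i)) = (\<Prod>i\<in>I. \<Sum>z\<in>mu N. z powi (- k i) * \<psi> z)" by (simp add: G_def)
  also have "\<dots> = (\<Sum>x\<in>?X. \<Prod>i\<in>I. x i powi (- k i) * \<psi> (x i))"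
    using I by (intro prod_sum_PiE) auto
  also have "\<dots> = (\<Sum>x\<in>?X. \<psi> (teich (\<Sum>i\<in>I. x i)) * (\<Prod>i\<in>I. x i powi (- k i)))"
  proof (intro sum.cong refl)
    fix x assume "x \<in> ?X"
    then have "x i \<in> frobenius_fixed" if "i \<in> I" for i
      using that lifts_subset_frobenius_fixed by auto
    then show "(\<Prod>i\<in>I. x i powi (- k i) * \<psi> (x i)) = \<psi> (teich (\<Sum>i\<in>I. x i)) * (\<Prod>i\<in>I. x i powi (- k i))"
      using I by (simp add: psi_teich psi_sum frobenius_fixed_sum prod.distrib)
  qed
  also have "\<dots> = (\<Sum>s\<in>lifts. \<psi> s * char_sum I k s)"
    unfolding char_sum_def by (rule sum_over_tuples[OF I])
  also have "\<dots> = char_sum I k 0 + (\<Sum>s\<in>mu N. \<psi> s * char_sum I k s)"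
    by (simp add: sum_lifts)
  also have "(\<Sum>s\<in>mu N. \<psi> s * char_sum I k s) = (\<Sum>s\<in>mu N. char_sum I k 1 * (s powi (- (\<Sum>i\<in>I. k i)) * \<psi> s))"
  proof (intro sum.cong refl)
    fix s assume "s \<in> mu N"
    then have "char_sum I k s = s powi (- (\<Sum>i\<in>I. k i)) * char_sum I k 1"
      using char_sum_scale[OF I, of s k 1] by (simp only: mult_1_right)
    then show "\<psi> s * char_sum I k s = char_sum I k 1 * (s powi (- (\<Sum>i\<in>I. k i)) * \<psi> s)"
      by (simp only: mult_ac)
  qed
  also have "\<dots> = - char_sum I k 1 * G (\<Sum>i\<in>I. k i)" by (simp add: G_def sum_distrib_left sum_negf)
  finally show ?thesis by simp
qed

lemma prod_G_eq_char_sum_0: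
  assumes I: "finite I" and trivial: "int N dvd (\<Sum>i\<in>I. k i)" and j: "j \<in> I" "\<not> int N dvd k j"
  shows "of_nat N * (\<Prod>i\<in>I. - G (k i)) = of_nat (p ^ f) * char_sum I k 0"
proof -
  have "0 = (\<Prod>i\<in>I. \<Sum>z\<in>mu N. z powi (- k i))"
    using j by (intro prod_zero[symmetric] I bexI[of _ j]) (auto simp: sum_mu_power_int)
  also have "\<dots> = (\<Sum>x\<in>PiE I (\<lambda>_. mu N). \<Prod>i\<in>I. x i powi (- k i))"
    using I by (intro prod_sum_PiE) auto
  also have "\<dots> = (\<Sum>s\<in>lifts. char_sum I k s)"
    using sum_over_tuples[OF I, of "\<lambda>_. 1" "\<lambda>x. \<Prod>i\<in>I. x i powi (- k i)"]
    unfolding char_sum_def mult_1 .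
  also have "\<dots> = char_sum I k 0 + (\<Sum>s\<in>mu N. char_sum I k s)" by (rule sum_lifts)
  also have "(\<Sum>s\<in>mu N. char_sum I k s) = (\<Sum>s\<in>mu N. char_sum I k 1)"
    by (intro sum.cong refl char_sum_eq_char_sum_1[OF I trivial])
  finally have "of_nat N * char_sum I k 1 = - char_sum I k 0"
    by (simp add: eq_neg_iff_add_eq_0 add.commute)
  moreover have "(\<Prod>i\<in>I. - G (k i)) = char_sum I k 0 - char_sum I k 1"
    using prod_G_eq_char_sum[OF I, of k] G_trivial[OF trivial] by simp
  ultimately have "of_nat N * (\<Prod>i\<in>I. - G (k i)) = of_nat (Suc N) * char_sum I k 0"
    by (simp only: right_diff_distrib of_nat_Suc) (simp add: algebra_simps)
  then show ?thesis by (simp only: Suc_N)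
qed

lemma G_add_alg_dvd:
  assumes "\<not> int N dvd k + l"
  shows "alg_dvd (G (k + l)) (G k * G l)"
proof -
  let ?k = "\<lambda>b. if b then k else l"
  have "(\<Prod>b\<in>UNIV. - G (?k b)) = - char_sum UNIV ?k 1 * G (\<Sum>b\<in>UNIV. ?k b)"
    using prod_G_eq_char_sum[of "UNIV :: bool set" ?k] char_sum_0_eq_0[of "UNIV :: bool set" ?k] assms
    by (simp add: UNIV_bool add.commute)
  then have "G k * G l = G (k + l) * (- char_sum UNIV ?k 1)"
    by (simp add: UNIV_bool mult.commute add.commute)
  then show ?thesis by (simp only:) (intro alg_dvdI alg_int_uminus alg_int_char_sum)
qed

lemma q_alg_dvd_G_mult_G_uminus:
  assumes "\<not> int N dvd k"
  shows "alg_dvd (of_nat (p ^ f)) (of_nat N * (G k * G (- k)))"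
proof -
  let ?k = "\<lambda>b. if b then k else - k"
  have "of_nat N * (\<Prod>b\<in>UNIV. - G (?k b)) = of_nat (p ^ f) * char_sum UNIV ?k 0"
    using assms by (intro prod_G_eq_char_sum_0[of _ _ True]) (auto simp: UNIV_bool)
  then have "of_nat N * (G k * G (- k)) = of_nat (p ^ f) * char_sum UNIV ?k 0"
    by (simp add: UNIV_bool mult.commute)
  then show ?thesis by (simp only:) (intro alg_dvdI alg_int_char_sum)
qed

end

section \<open>Stickelberger's theorem\<close>

definition stickelberger_sum :: "nat \<Rightarrow> nat \<Rightarrow> nat \<Rightarrow> int \<Rightarrow> real" where
  "stickelberger_sum p f n k = (\<Sum>i<f. mod_frac n (int (p ^ i) * k))"

lemma stickelberger_sum_cong: "[k = l] (mod int n) \<Longrightarrow> stickelberger_sum p f n k = stickelberger_sum p f n l"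
  unfolding stickelberger_sum_def by (intro sum.cong refl mod_frac_cong cong_mult) auto

lemma stickelberger_sum_0 [simp]: "stickelberger_sum p f n 0 = 0"
  by (simp add: stickelberger_sum_def)

lemma stickelberger_sum_mult_cancel:
  "m > 0 \<Longrightarrow> stickelberger_sum p f (m * n) (int m * k) = stickelberger_sum p f n k"
  unfolding stickelberger_sum_def mult.left_commute[of _ "int m"] by (simp only: mod_frac_mult_cancel)

lemma stickelberger_sum_mult_p:
  assumes "[p ^ f = 1] (mod n)"
  shows "stickelberger_sum p f n (int p * k) = stickelberger_sum p f n k"
proof -
  let ?g = "\<lambda>i. mod_frac n (int (p ^ i) * k)"
  have "stickelberger_sum p f n (int p * k) = (\<Sum>i<f. ?g (Suc i))"
    unfolding stickelberger_sum_def by (intro sum.cong refl) (simp add: mult_ac)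
  moreover have "?g 0 + (\<Sum>i<f. ?g (Suc i)) = stickelberger_sum p f n k + ?g f"
    using sum.lessThan_Suc_shift[of ?g f] sum.lessThan_Suc[of ?g f]
    unfolding stickelberger_sum_def by linarith
  moreover have "[int (p ^ f) = 1] (mod int n)" using assms cong_int_iff[of "p ^ f" 1 n] by simp
  from mod_frac_cong[OF cong_mult[OF this cong_refl[of k]]] have "?g f = ?g 0" by simp
  ultimately show ?thesis by simp
qed

lemma stickelberger_sum_uminus:
  assumes "coprime p n" "n > 0" "\<not> int n dvd k"
  shows "stickelberger_sum p f n (- k) = real f - stickelberger_sum p f n k"
proof -
  have "\<not> int n dvd int (p ^ i) * k" for i
    using assms(1,3) int_dvd_coprime_mult_iff[of "p ^ i" n k] by simp
  then have "mod_frac n (int (p ^ i) * - k) = 1 - mod_frac n (int (p ^ i) * k)" for i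
    using mod_frac_uminus[OF assms(2)] by (metis mult_minus_right)
  then show ?thesis by (simp only: stickelberger_sum_def sum_subtractf) simp
qed

text \<open>Multiplication by \<open>Q\<close> modulo \<open>Q R - 1\<close> rotates the digits of \<open>k = (k div R) R + k mod R\<close>.\<close>

lemma mult_mod_rotate_digits:
  fixes k n Q R :: int
  assumes "Q * R = n + 1" "0 \<le> k" "k < n" "R > 0"
  shows "(Q * k) mod n = k div R + Q * (k mod R)"
proof -
  define a b where "a = k div R" and "b = k mod R"
  have k: "k = a * R + b" by (simp add: a_def b_def)
  have b: "0 \<le> b" "b \<le> R - 1" using assms(4) by (simp_all add: b_def)
  have Q: "Q > 0" using zero_less_mult_pos2[of Q R] assms by linarith
  have a: "0 \<le> a" "a \<le> Q - 1"
  proof -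
    show "0 \<le> a" using assms by (simp add: a_def pos_imp_zdiv_nonneg_iff)
    have "a * R < Q * R" using assms(1,3) k b by linarith
    then show "a \<le> Q - 1" using assms(4) by simp
  qed
  have "Q * b \<le> Q * (R - 1)" using b(2) Q by (intro mult_left_mono) auto
  then have le: "a + Q * b \<le> n" using a(2) assms(1) by (simp add: algebra_simps)
  have "a + Q * b \<noteq> n"
  proof
    assume "a + Q * b = n"
    then have "Q * b = Q * (R - 1)" "a = Q - 1"
      using a(2) \<open>Q * b \<le> Q * (R - 1)\<close> assms(1) by (simp_all add: right_diff_distrib)
    then have "b = R - 1" "a = Q - 1" using Q by auto
    then have "k = (Q - 1) * R + (R - 1)" using k by simp
    then have "k = n" using assms(1) by (simp add: left_diff_distrib)
    then show False using assms(3) by simp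
  qed
  with le have "a + Q * b < n" by simp
  moreover have "0 \<le> a + Q * b" using a(1) b(1) Q by simp
  moreover have "Q * k = n * a + (a + Q * b)"
  proof -
    have "Q * k = a * (Q * R) + Q * b" by (simp add: k algebra_simps)
    then show ?thesis by (simp add: assms(1) algebra_simps)
  qed
  ultimately have "(Q * k) mod n = a + Q * b" by (intro int_mod_pos_eq[of _ n a])
  then show ?thesis by (simp only: a_def b_def)
qed

context finite_lift
begin

lemma p_power_cong_1: "[p ^ f = 1] (mod N)"
  using mod_add_self2[of "1 :: nat" N] by (simp only: cong_def plus_1_eq_Suc Suc_N)

lemma mod_frac_p_power_step:
  assumes k: "1 \<le> k" "k < int N" and pk: "\<not> int p dvd k" and i: "i < f"
  shows "mod_frac N (int (p ^ i) * k) = mod_frac N (int (p ^ i) * (k - 1)) + real (p ^ i) / real N"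
proof -
  define Q R where "Q = int (p ^ i)" and "R = int (p ^ (f - i))"
  have "p ^ i * p ^ (f - i) = Suc N" using i unfolding Suc_N by (simp flip: power_add)
  then have "int (p ^ i * p ^ (f - i)) = int (Suc N)" by (simp only:)
  then have QR: "Q * R = int N + 1" by (simp add: Q_def R_def)
  have R: "R > 0" by (simp add: R_def p_pos)
  have "int p dvd R" using i by (simp add: R_def)
  then have "\<not> R dvd k" using pk dvd_trans by blast
  then have "k mod R \<noteq> 0" by (simp add: dvd_eq_mod_eq_0)
  then have digit: "0 \<le> k mod R - 1" "k mod R - 1 < R"
    using pos_mod_sign[OF R, of k] pos_mod_bound[OF R, of k] by linarith+
  have "k - 1 = R * (k div R) + (k mod R - 1)" by simp
  note division = this digit
  have pred: "(k - 1) div R = k div R" "(k - 1) mod R = k mod R - 1"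
    by (rule int_div_pos_eq[OF division], rule int_mod_pos_eq[OF division])
  have "(Q * (k - 1)) mod int N = k div R + Q * (k mod R - 1)"
    using mult_mod_rotate_digits[OF QR _ _ R, of "k - 1"] k by (simp only: pred)
  also have "\<dots> = (Q * k) mod int N - Q"
    using mult_mod_rotate_digits[OF QR _ _ R, of k] k by (simp add: right_diff_distrib)
  finally have "mod_frac N (Q * (k - 1)) = mod_frac N (Q * k) - real_of_int Q / real N"
    by (simp only: mod_frac_def diff_divide_distrib of_int_diff)
  then show ?thesis by (simp add: Q_def)
qed

lemma stickelberger_sum_step:
  assumes "1 \<le> k" "k < int N" "\<not> int p dvd k"
  shows "stickelberger_sum p f N k = stickelberger_sum p f N (k - 1) + 1 / (real p - 1)"
proof -
  have "(\<Sum>i<f. real p ^ i) = (real p ^ f - 1) / (real p - 1)"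
    using p_ge_2 by (intro geometric_sum) simp
  also have "real p ^ f - 1 = real N" using arg_cong[OF Suc_N, of real] by simp
  finally have "(\<Sum>i<f. real (p ^ i)) / real N = 1 / (real p - 1)" by simp
  then have geometric: "(\<Sum>i<f. real (p ^ i) / real N) = 1 / (real p - 1)"
    by (simp only: sum_divide_distrib)
  have "stickelberger_sum p f N k = (\<Sum>i<f. mod_frac N (int (p ^ i) * (k - 1)) + real (p ^ i) / real N)"
    unfolding stickelberger_sum_def by (intro sum.cong refl mod_frac_p_power_step[OF assms]) simp
  then show ?thesis by (simp only: sum.distrib geometric stickelberger_sum_def)
qed

end

context gauss_sums
begin

definition \<zeta> :: complex where "\<zeta> = unity_root p c"

lemma zeta_power: "\<zeta> ^ j = unity_root p (c * int j)"
  by (simp add: \<zeta>_def unity_root_power mult.commute)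

lemma alg_int_zeta: "alg_int \<zeta>"
  unfolding \<zeta>_def by (rule alg_int_unity_root[OF p_pos])

lemma zeta_cong_P_1: "\<zeta> \<equiv>\<^sub>P 1"
proof -
  have "((\<zeta> - 1) + 1) ^ p \<equiv>\<^sub>P (\<zeta> - 1) ^ p + 1 ^ p"
    by (intro cong_P_add_power_prime alg_int_diff alg_int_zeta) auto
  moreover have "\<zeta> ^ p = 1" using p_pos by (simp add: zeta_power unity_root_eq_1_iff)
  ultimately have "(\<zeta> - 1) ^ p \<in> P"
    using uminus_mem_P by (fastforce simp: cong_P_def)
  then show ?thesis
    using power_mem_P_imp alg_int_diff[OF alg_int_zeta alg_int_1] by (simp add: cong_P_def)
qed

lemma sum_zeta_powers_cong_P: "(\<Sum>j<m. \<zeta> ^ j) \<equiv>\<^sub>P of_nat m"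
  using cong_P_sum[of "{..<m}" "\<lambda>j. \<zeta> ^ j" "\<lambda>j. 1 ^ j"] cong_P_power[OF zeta_cong_P_1 alg_int_zeta]
  by simp

lemma P_unit_sum_binomial_quotients:
  assumes y: "y \<in> P"
  shows "P_unit (\<Sum>k\<in>{1..<p}. of_nat ((p choose k) div p) * y ^ (k - 1))"
proof -
  have alg_int_y: "alg_int y" using y by (rule mem_P_alg_int)
  have "(\<Sum>k\<in>{1..<p}. of_nat ((p choose k) div p) * y ^ (k - 1)) \<equiv>\<^sub>P (\<Sum>k\<in>{1..<p}. if k = 1 then 1 else 0)"
  proof (intro cong_P_sum)
    fix k assume "k \<in> {1..<p}"
    then consider "k = 1" | l where "k = Suc (Suc l)" by (cases k; cases "k - 1") auto
    then show "of_nat ((p choose k) div p) * y ^ (k - 1) \<equiv>\<^sub>P (if k = 1 then 1 else 0)"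
    proof cases
      case 2
      have "y * y ^ l \<in> P" using y alg_int_y by (intro mult_mem_P_right alg_int_power)
      then show ?thesis by (simp add: 2 cong_P_0_iff mult_mem_P)
    qed (use p_pos in simp)
  qed
  also have "(\<Sum>k\<in>{1..<p}. if k = 1 then 1 else 0) = (1 :: complex)"
    using p_ge_2 by simp
  finally show ?thesis
    by (rule P_unit_cong) (intro alg_int_sum alg_int_mult alg_int_power alg_int_y alg_int_of_nat P_unit_1)+
qed

text \<open>Expand \<open>1 = (1 - \<pi>)\<^sup>p\<close> for \<open>\<pi> = 1 - \<zeta>\<close>: the extreme terms balance, and the others are divisible by \<open>p \<pi>\<^sup>2\<close>.\<close>

lemma one_minus_zeta_power_assoc_P_p: "(1 - \<zeta>) ^ (p - 1) \<sim>\<^sub>P of_nat p"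
proof -
  define y where "y = \<zeta> - 1"
  define w where "w = (\<Sum>k\<in>{1..<p}. of_nat ((p choose k) div p) * y ^ (k - 1))"
  have y: "y \<in> P" "y \<noteq> 0"
    using zeta_cong_P_1 c p_pos by (simp_all add: y_def \<zeta>_def cong_P_def unity_root_eq_1_iff)
  have w: "P_unit w" unfolding w_def by (rule P_unit_sum_binomial_quotients[OF y(1)])
  have "1 = (y + 1) ^ p"
    using p_pos by (simp add: y_def zeta_power unity_root_eq_1_iff)
  also have "\<dots> = y ^ p + 1 + of_nat p * (\<Sum>k\<in>{1..<p}. of_nat ((p choose k) div p) * y ^ k)"
    by (simp add: binomial_prime[OF prime_p])
  also have "(\<Sum>k\<in>{1..<p}. of_nat ((p choose k) div p) * y ^ k) = y * w"
    unfolding w_def sum_distrib_left by (intro sum.cong refl) (simp add: power_eq_if mult_ac)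
  also have "y ^ p = y * y ^ (p - 1)" by (simp add: power_eq_if)
  finally have "y * (y ^ (p - 1) + of_nat p * w) = 0" by (simp add: algebra_simps)
  then have "y ^ (p - 1) = - w * of_nat p" using y(2) by (simp add: eq_neg_iff_add_eq_0 mult.commute)
  then have eq: "(1 - \<zeta>) ^ (p - 1) = ((- 1) ^ (p - 1) * (- 1 * w)) * of_nat p"
    using power_mult_distrib[of "-1" y "p - 1"] by (simp add: y_def)
  have "P_unit ((- 1) ^ (p - 1) * (- 1 * w))"
    by (intro P_unit_mult P_unit_power P_unit_uminus_1 w)
  then show ?thesis
    by (intro assoc_PI[of 1 _ "(- 1) ^ (p - 1) * (- 1 * w)"]) (simp_all only: eq mult_1_left P_unit_1)
qed

text \<open>\<open>\<psi> z\<close> is a power \<open>\<zeta>\<^sup>m\<close> with \<open>m \<equiv> tr z\<close>, and \<open>1 - \<zeta>\<^sup>m\<close> is \<open>(1 - \<zeta>) m\<close> to first order.\<close>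

lemma one_minus_psi_eq:
  assumes z: "z \<in> mu N"
  obtains w where "1 - \<psi> z = (1 - \<zeta>) * w" "alg_int w" "w \<equiv>\<^sub>P tr z"
proof -
  define m where "m = nat (trace_int P p f z mod int p)"
  have m: "int m = trace_int P p f z mod int p" using p_pos by (simp add: m_def)
  have "[trace_int P p f z = int m] (mod int p)" by (simp add: m cong_def)
  then have "of_int (trace_int P p f z) \<equiv>\<^sub>P of_int (int m)" by (simp only: cong_P_of_int_iff)
  with tr_cong_P_trace_int have tr: "tr z \<equiv>\<^sub>P of_int (int m)"
    using z lifts_subset_frobenius_fixed by (blast intro: cong_P_trans)
  show thesis
  proof (rule that)
    have "\<psi> z = \<zeta> ^ m"
      unfolding zeta_power using tr z lifts_subset_frobenius_fixed by (intro psi_eqI) auto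
    then show "1 - \<psi> z = (1 - \<zeta>) * (\<Sum>j<m. \<zeta> ^ j)" by (simp add: one_diff_power_eq)
    show "alg_int (\<Sum>j<m. \<zeta> ^ j)" by (intro alg_int_sum alg_int_power alg_int_zeta)
    show "(\<Sum>j<m. \<zeta> ^ j) \<equiv>\<^sub>P tr z"
      using cong_P_trans[OF sum_zeta_powers_cong_P cong_P_sym[OF tr[unfolded of_int_of_nat_eq]]] .
  qed
qed

lemma G_1_assoc_P_one_minus_zeta:
  assumes "N \<ge> 2"
  shows "G 1 \<sim>\<^sub>P 1 - \<zeta>"
proof -
  have "\<forall>z\<in>mu N. \<exists>w. 1 - \<psi> z = (1 - \<zeta>) * w \<and> alg_int w \<and> w \<equiv>\<^sub>P tr z"
    using one_minus_psi_eq by blast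
  from bchoice[OF this]
  obtain w where w: "\<forall>z\<in>mu N. 1 - \<psi> z = (1 - \<zeta>) * w z \<and> alg_int (w z) \<and> w z \<equiv>\<^sub>P tr z" ..
  define U where "U = (\<Sum>z\<in>mu N. inverse z * w z)"
  have "U \<equiv>\<^sub>P (\<Sum>z\<in>mu N. inverse z * tr z)"
    unfolding U_def using w by (intro cong_P_sum cong_P_mult_left alg_int_mu inverse_mem_mu) auto
  then have "U \<equiv>\<^sub>P of_nat N" by (simp only: sum_mu_inverse_tr)
  moreover have "alg_int U"
    unfolding U_def using w alg_int_mu[OF inverse_mem_mu] by (intro alg_int_sum[of "mu N"] alg_int_mult) auto
  ultimately have U: "P_unit U" using P_unit_N by (blast intro: P_unit_cong)
  have "(\<Sum>z\<in>mu N. inverse z) = 0"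
    using sum_mu_power_int[OF N_pos, of "-1"] assms by (simp add: power_int_minus)
  then have "G 1 = (\<Sum>z\<in>mu N. inverse z * (1 - \<psi> z))"
    by (simp add: G_def power_int_minus right_diff_distrib sum_subtractf)
  also have "\<dots> = (\<Sum>z\<in>mu N. (1 - \<zeta>) * (inverse z * w z))"
    using w by (intro sum.cong refl) (simp add: mult.left_commute)
  also have "\<dots> = U * (1 - \<zeta>)" by (simp add: U_def sum_distrib_left mult.commute)
  finally show ?thesis using U by (intro assoc_PI[of 1 _ U]) simp_all
qed

lemma G_1_power_assoc_P_p:
  assumes "N \<ge> 2"
  shows "G 1 ^ (p - 1) \<sim>\<^sub>P of_nat p"
  using assoc_P_power[OF G_1_assoc_P_one_minus_zeta[OF assms]] one_minus_zeta_power_assoc_P_p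
  by (rule assoc_P_trans)

text \<open>The exponent \<open>s\<close> is the digit sum of \<open>k mod N\<close> in base \<open>p\<close>.\<close>

definition dvd_G_1_power :: "int \<Rightarrow> bool" where
  "dvd_G_1_power k \<longleftrightarrow> (\<exists>s. real s = (real p - 1) * stickelberger_sum p f N k \<and> alg_dvd (G k) (G 1 ^ s))"

lemma dvd_G_1_power_0: "dvd_G_1_power 0"
  unfolding dvd_G_1_power_def using alg_dvdI[of 1 "G 0"] G_trivial[of 0] by (intro exI[of _ 0]) simp

lemma dvd_G_1_power_mult_p: "dvd_G_1_power (int p * k) \<longleftrightarrow> dvd_G_1_power k"
  by (simp add: dvd_G_1_power_def stickelberger_sum_mult_p[OF p_power_cong_1] G_mult_p)

lemma dvd_G_1_power_cong: "[k = l] (mod int N) \<Longrightarrow> dvd_G_1_power k \<longleftrightarrow> dvd_G_1_power l"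
  unfolding dvd_G_1_power_def using stickelberger_sum_cong[of k l N p f] G_cong[of k l] by simp

lemma dvd_G_1_power_step:
  assumes k: "1 \<le> k" "k < int N" "\<not> int p dvd k" and pred: "dvd_G_1_power (k - 1)"
  shows "dvd_G_1_power k"
proof -
  obtain s where s: "real s = (real p - 1) * stickelberger_sum p f N (k - 1)" "alg_dvd (G (k - 1)) (G 1 ^ s)"
    using pred by (auto simp: dvd_G_1_power_def)
  have "\<not> int N dvd k" using k zdvd_not_zless[of k "int N"] by simp
  then have "alg_dvd (G k) (G (k - 1) * G 1)" using G_add_alg_dvd[of "k - 1" 1] by simp
  also have "alg_dvd (G (k - 1) * G 1) (G 1 ^ s * G 1)" by (rule alg_dvd_mult_right[OF s(2)])
  finally have "alg_dvd (G k) (G 1 ^ Suc s)" by (simp only: power_Suc2)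
  moreover have "real (Suc s) = (real p - 1) * stickelberger_sum p f N k"
    using s(1) stickelberger_sum_step[OF k] p_ge_2 by (simp add: field_simps)
  ultimately show ?thesis unfolding dvd_G_1_power_def by blast
qed

lemma dvd_G_1_power_if_less:
  assumes "k < N"
  shows "dvd_G_1_power (int k)"
  using assms
proof (induction k rule: less_induct)
  case (less k)
  consider "k = 0" | l where "k = p * l" "l > 0" | "k > 0" "\<not> p dvd k" by fastforce
  then show ?case
  proof cases
    case 1
    then show ?thesis using dvd_G_1_power_0 by simp
  next
    case 2
    then have "l < k" using p_ge_2 by simp
    then have "dvd_G_1_power (int l)" using less by simp
    then show ?thesis by (simp add: 2(1) dvd_G_1_power_mult_p)
  next
    case 3
    then have "int (k - 1) = int k - 1" "k - 1 < k" by simp_all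
    then have pred: "dvd_G_1_power (int k - 1)" using less.IH[of "k - 1"] less.prems by (simp only:)
    show ?thesis by (rule dvd_G_1_power_step[OF _ _ _ pred]) (use 3 less.prems in simp_all)
  qed
qed

lemma dvd_G_1_power: "dvd_G_1_power k"
proof -
  define l where "l = nat (k mod int N)"
  have l: "int l = k mod int N" by (simp add: l_def)
  then have "l < N" using N_pos by (metis of_nat_0_less_iff of_nat_less_iff pos_mod_bound)
  then have "dvd_G_1_power (int l)" by (rule dvd_G_1_power_if_less)
  moreover have "[int l = k] (mod int N)" using l by (simp add: cong_def)
  ultimately show ?thesis using dvd_G_1_power_cong by blast
qed

theorem stickelberger:
  assumes k: "\<not> int N dvd k"
  shows "has_val (G k) (stickelberger_sum p f N k)"
proof -
  have "N \<noteq> 1" using k by auto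
  then have "N \<ge> 2" using N_pos by linarith
  note G_1 = G_1_power_assoc_P_p[OF this]
  obtain s where s: "real s = (real p - 1) * stickelberger_sum p f N k" "alg_dvd (G k) (G 1 ^ s)"
    using dvd_G_1_power unfolding dvd_G_1_power_def by blast
  obtain s' where s': "real s' = (real p - 1) * stickelberger_sum p f N (- k)" "alg_dvd (G (- k)) (G 1 ^ s')"
    using dvd_G_1_power unfolding dvd_G_1_power_def by blast
  have "real (s + s') = (real p - 1) * (stickelberger_sum p f N k + stickelberger_sum p f N (- k))"
    by (simp add: s(1) s'(1) distrib_left)
  also have "\<dots> = real ((p - 1) * f)"
    using stickelberger_sum_uminus[of p N k f] coprime_p_power_N[of 1] k p_ge_2 by simp
  finally have "real (s + s') = real ((p - 1) * f)" .
  then have "s + s' = (p - 1) * f" by (simp only: of_nat_eq_iff)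
  then have "G 1 ^ s * G 1 ^ s' = (G 1 ^ (p - 1)) ^ f" by (simp only: power_mult flip: power_add)
  then have "G 1 ^ s * G 1 ^ s' \<sim>\<^sub>P of_nat (p ^ f)" using assoc_P_power[OF G_1, of f] by simp
  with s(2) s'(2) q_alg_dvd_G_mult_G_uminus[OF k] P_unit_N
  have "G 1 ^ s \<sim>\<^sub>P G k" by (rule assoc_P_if_mutual_alg_dvd) simp
  then have "G k ^ (p - 1) \<sim>\<^sub>P (G 1 ^ s) ^ (p - 1)" by (rule assoc_P_power[OF assoc_P_sym])
  also have "(G 1 ^ s) ^ (p - 1) = (G 1 ^ (p - 1)) ^ s" by (simp only: mult.commute flip: power_mult)
  also have "\<dots> \<sim>\<^sub>P of_nat p powi int s" using assoc_P_power[OF G_1, of s] by simp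
  finally have "has_val (G k) (real_of_int (int s) / real (p - 1))"
    using p_ge_2 by (intro has_valI) auto
  also have "real_of_int (int s) / real (p - 1) = stickelberger_sum p f N k"
    using s(1) p_ge_2 by simp
  finally show ?thesis .
qed

end

section \<open>Conjugates of roots of unity\<close>

definition rat_eval :: "rat poly \<Rightarrow> complex \<Rightarrow> complex" where
  "rat_eval Q z = poly (map_poly of_rat Q) z"

lemma rat_eval_0 [simp]: "rat_eval 0 z = 0"
  and rat_eval_pCons [simp]: "rat_eval (pCons a Q) z = of_rat a + z * rat_eval Q z"
  by (simp_all add: rat_eval_def map_poly_pCons)

lemma rat_eval_add: "rat_eval (A + B) z = rat_eval A z + rat_eval B z"
proof -
  have "map_poly of_rat (A + B) = map_poly of_rat A + (map_poly of_rat B :: complex poly)"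
    by (rule poly_eqI) (simp add: coeff_map_poly of_rat_add)
  then show ?thesis by (simp add: rat_eval_def)
qed

lemma rat_eval_smult: "rat_eval (Polynomial.smult a B) z = of_rat a * rat_eval B z"
  by (induction B) (simp_all add: of_rat_mult algebra_simps)

lemma rat_eval_mult: "rat_eval (A * B) z = rat_eval A z * rat_eval B z"
  by (induction A) (simp_all add: rat_eval_add rat_eval_smult algebra_simps)

lemma rat_eval_monom: "rat_eval (Polynomial.monom 1 n) z = z ^ n"
  by (simp add: rat_eval_def map_poly_monom poly_monom)

definition rat_poly_fun :: "(complex \<Rightarrow> complex) \<Rightarrow> bool" where
  "rat_poly_fun g \<longleftrightarrow> (\<exists>Q. g = rat_eval Q)"

lemma rat_poly_fun_const: "rat_poly_fun (\<lambda>z. of_rat a)"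
  unfolding rat_poly_fun_def by (intro exI[of _ "[:a:]"]) auto

lemma rat_poly_fun_monom: "rat_poly_fun (\<lambda>z. z ^ n)"
  unfolding rat_poly_fun_def by (intro exI[of _ "Polynomial.monom 1 n"]) (auto simp: rat_eval_monom)

lemma rat_poly_fun_add: "rat_poly_fun g \<Longrightarrow> rat_poly_fun h \<Longrightarrow> rat_poly_fun (\<lambda>z. g z + h z)"
  unfolding rat_poly_fun_def by (auto simp: rat_eval_add[symmetric])

lemma rat_poly_fun_mult: "rat_poly_fun g \<Longrightarrow> rat_poly_fun h \<Longrightarrow> rat_poly_fun (\<lambda>z. g z * h z)"
  unfolding rat_poly_fun_def by (auto simp: rat_eval_mult[symmetric])

lemma rat_poly_fun_uminus: "rat_poly_fun g \<Longrightarrow> rat_poly_fun (\<lambda>z. - g z)"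
  using rat_poly_fun_mult[OF rat_poly_fun_const[of "-1"], of g] by simp

lemma rat_poly_fun_diff: "rat_poly_fun g \<Longrightarrow> rat_poly_fun h \<Longrightarrow> rat_poly_fun (\<lambda>z. g z - h z)"
  using rat_poly_fun_add[OF _ rat_poly_fun_uminus, of g h] by simp

lemma rat_poly_fun_sum: "(\<And>i. i \<in> A \<Longrightarrow> rat_poly_fun (g i)) \<Longrightarrow> rat_poly_fun (\<lambda>z. \<Sum>i\<in>A. g i z)"
  by (induction A rule: infinite_finite_induct)
    (use rat_poly_fun_const[of 0] in \<open>simp_all add: rat_poly_fun_add\<close>)

lemma rat_poly_fun_prod: "(\<And>i. i \<in> A \<Longrightarrow> rat_poly_fun (g i)) \<Longrightarrow> rat_poly_fun (\<lambda>z. \<Prod>i\<in>A. g i z)"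
  by (induction A rule: infinite_finite_induct)
    (use rat_poly_fun_const[of 1] in \<open>simp_all add: rat_poly_fun_mult\<close>)

lemma rat_poly_fun_power: "rat_poly_fun g \<Longrightarrow> rat_poly_fun (\<lambda>z. g z ^ n)"
  by (induction n) (use rat_poly_fun_const[of 1] in \<open>simp_all add: rat_poly_fun_mult\<close>)

lemma rat_poly_fun_comp_monom:
  assumes "rat_poly_fun g"
  shows "rat_poly_fun (\<lambda>z. g (z ^ s))"
proof -
  obtain Q where Q: "g = rat_eval Q" using assms by (auto simp: rat_poly_fun_def)
  have "rat_poly_fun (\<lambda>z. rat_eval Q (z ^ s))"
  proof (induction Q)
    case 0
    then show ?case using rat_poly_fun_const[of 0] by simp
  next
    case (pCons a Q)
    then show ?case
      by (simp add: rat_poly_fun_add rat_poly_fun_mult rat_poly_fun_const rat_poly_fun_monom)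
  qed
  then show ?thesis using Q by simp
qed

lemma rat_poly_clear_denominators:
  obtains c :: int and A :: "int poly"
  where "c \<noteq> 0" "\<And>z. poly (map_poly of_int A) z = of_int c * rat_eval Q z"
proof -
  have "\<exists>(c::int) A :: int poly. c \<noteq> 0 \<and> (\<forall>z. poly (map_poly of_int A) z = of_int c * rat_eval Q z)"
  proof (induction Q)
    case 0
    then show ?case by (intro exI[of _ 1] exI[of _ 0]) simp
  next
    case (pCons a Q)
    then obtain c A where cA: "c \<noteq> 0" "\<And>z. poly (map_poly of_int A) z = of_int c * rat_eval Q z" by blast
    obtain u v where uv: "quotient_of a = (u, v)" by fastforce
    have v: "v > 0" using quotient_of_denom_pos[OF uv] .
    have "a = of_int u / of_int v" using quotient_of_div[OF uv] .
    then have a: "of_int v * of_rat a = (of_int u :: complex)" using v by (simp add: of_rat_divide)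
    have smult: "poly (map_poly of_int (Polynomial.smult v A)) z
        = (of_int v * poly (map_poly of_int A) z :: complex)" for z
      by (induction A) (simp_all add: map_poly_pCons algebra_simps)
    have "poly (map_poly of_int (pCons (c * u) (Polynomial.smult v A))) z
        = of_int (c * v) * rat_eval (pCons a Q) z" for z
      by (simp add: map_poly_pCons smult cA(2) distrib_left mult.left_commute mult.assoc flip: a)
    then show ?case
      using cA(1) v by (intro exI[of _ "c * v"] exI[of _ "pCons (c * u) (Polynomial.smult v A)"]) auto
  qed
  with that show thesis by blast
qed

lemma minimal_rat_poly:
  assumes "Q \<noteq> 0" "rat_eval Q x = 0"
  obtains D where "D \<noteq> 0" "rat_eval D x = 0" "\<And>B. rat_eval B x = 0 \<Longrightarrow> D dvd B"
proof -
  obtain D where D: "D \<noteq> 0" "rat_eval D x = 0"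
    and least: "\<And>B. B \<noteq> 0 \<Longrightarrow> rat_eval B x = 0 \<Longrightarrow> degree D \<le> degree B"
    using ex_has_least_nat[of "\<lambda>D. D \<noteq> 0 \<and> rat_eval D x = 0" Q degree] assms by blast
  have "D dvd B" if B: "rat_eval B x = 0" for B
  proof -
    have "rat_eval (B div D * D + B mod D) x = 0" using B by (simp only: div_mult_mod_eq)
    then have "rat_eval (B mod D) x = 0"
      unfolding rat_eval_add rat_eval_mult using D(2) by simp
    then have "B mod D = 0" using least[of "B mod D"] degree_mod_less[OF D(1), of B] by fastforce
    then show ?thesis by auto
  qed
  then show thesis using that D by blast
qed

lemma cong_power_prime_int:
  fixes a :: int
  assumes "prime l"
  shows "[a ^ l = a] (mod int l)"
proof (cases "int l dvd a")
  case True
  then have "int l dvd a ^ l" using prime_gt_0_nat[OF assms] by (meson dvd_power dvd_trans)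
  then show ?thesis using True by (simp add: cong_def mod_eq_0_iff_dvd)
next
  case False
  define b where "b = nat (a mod int l)"
  have b: "int b = a mod int l" using prime_gt_0_nat[OF assms] by (simp add: b_def)
  have "\<not> l dvd b" using False b by (metis dvd_mod_iff dvd_refl int_dvd_int_iff)
  then have "[b ^ (l - 1) * b = 1 * b] (mod l)"
    using fermat_theorem[OF assms] by (intro cong_mult) auto
  moreover have "b ^ (l - 1) * b = b ^ l" using prime_gt_0_nat[OF assms] by (metis power_minus_mult)
  ultimately have "[b ^ l = b] (mod l)" by simp
  then have "[int b ^ l = int b] (mod int l)" by (metis cong_int_iff of_nat_power)
  moreover have "[a = int b] (mod int l)" by (simp add: b cong_def)
  ultimately show ?thesis by (metis cong_pow cong_sym cong_trans)
qed

lemma root_of_unity_power_cong: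
  fixes x :: "'a :: monoid_mult"
  assumes "x ^ m = 1" "[s = t] (mod m)"
  shows "x ^ s = x ^ t"
proof -
  have "x ^ s = x ^ (s mod m)" for s
    by (metis assms(1) div_mult_mod_eq mult.commute mult_1 power_add power_mult power_one)
  then show ?thesis using assms(2) unfolding cong_def by metis
qed

context prime_above
begin

lemma alg_dvd_add: "alg_dvd a b \<Longrightarrow> alg_dvd a b' \<Longrightarrow> alg_dvd a (b + b')"
  unfolding alg_dvd_def by (metis alg_int_add distrib_left)

lemma alg_dvd_mult_left: "alg_int x \<Longrightarrow> alg_dvd a b \<Longrightarrow> alg_dvd a (x * b)"
  unfolding alg_dvd_def by (metis alg_int_mult mult.left_commute)

lemma alg_dvd_frobenius_int_poly:
  assumes l: "prime l" and x: "alg_int x"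
  shows "alg_dvd (of_nat l) (poly (map_poly of_int A) (x ^ l) - poly (map_poly of_int A) x ^ l)"
proof (induction A)
  case 0
  then show ?case using prime_gt_0_nat[OF l] alg_dvdI[of 0] by (simp add: power_0_left)
next
  case (pCons a A)
  let ?A = "poly (map_poly of_int A) :: complex \<Rightarrow> complex"
  let ?w = "\<Sum>k\<in>{1..<l}. of_nat ((l choose k) div l) * of_int a ^ k * (x * ?A x) ^ (l - k)"
  obtain m where "a - a ^ l = int l * m"
    using cong_sym[OF cong_power_prime_int[OF l]] unfolding cong_iff_dvd_diff dvd_def by blast
  then have m: "of_int a - of_int a ^ l = of_nat l * (of_int m :: complex)"
    by (metis of_int_diff of_int_mult of_int_of_nat_eq of_int_power)
  have "alg_int (?A x)" using x by (intro alg_int_poly) (simp_all add: coeff_map_poly)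
  then have w: "alg_int ?w"
    using x by (intro alg_int_sum alg_int_mult alg_int_power alg_int_of_nat alg_int_of_int)
  have "poly (map_poly of_int (pCons a A)) (x ^ l) - poly (map_poly of_int (pCons a A)) x ^ l
      = (of_int a - of_int a ^ l) + x ^ l * (?A (x ^ l) - ?A x ^ l) + of_nat l * - ?w"
    by (simp add: map_poly_pCons binomial_prime[OF l, of "of_int a"] power_mult_distrib right_diff_distrib)
  also have "alg_dvd (of_nat l) \<dots>"
    unfolding m using pCons.IH x w
    by (intro alg_dvd_add alg_dvdI alg_dvd_mult_left alg_int_power alg_int_uminus alg_int_of_int)
  finally show ?case .
qed

text \<open>Dedekind's argument. If a factor \<open>A\<close> of \<open>c (X^m - 1)\<close> vanishes at \<open>x\<close> but not at \<open>x^l\<close>, then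
  \<open>A(x^l)\<close> divides \<open>c m\<close> (differentiate), while \<open>l\<close> divides \<open>A(x^l)\<close> (Frobenius).\<close>

lemma int_poly_root_power_prime:
  fixes x :: complex
  assumes factors: "\<And>z. poly (map_poly of_int A) z * poly (map_poly of_int B) z
      = of_int c * (z ^ m - 1 :: complex)"
    and m: "m > 0" and x: "x ^ m = 1" "poly (map_poly of_int A) x = 0"
    and l: "prime l" "\<not> int l dvd c * int m"
  shows "poly (map_poly of_int A) (x ^ l) = 0"
proof (rule ccontr)
  let ?A = "map_poly of_int A :: complex poly" and ?B = "map_poly of_int B :: complex poly"
  let ?C = "Polynomial.smult (of_int c) (Polynomial.monom 1 m - 1) :: complex poly"
  assume nonzero: "poly ?A (x ^ l) \<noteq> 0"
  define y where "y = x ^ l"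
  have ym: "y ^ m = 1" unfolding y_def using x(1) by (metis mult.commute power_mult power_one)
  have alg: "alg_int x" "alg_int y" using alg_int_root_of_unity x(1) ym m by blast+
  have By: "poly ?B y = 0" using factors[of y] ym nonzero by (simp add: y_def)
  have "poly (?A * ?B) z = poly ?C z" for z
    using factors[of z] by (simp add: poly_monom)
  then have "poly (?A * ?B) = poly ?C" by blast
  then have "?A * ?B = ?C" by (simp only: poly_eq_poly_eq_iff)
  then have "poly (pderiv (?A * ?B)) y = poly (pderiv ?C) y" by (simp only:)
  then have "poly ?A y * poly (pderiv ?B) y = of_int c * (of_nat m * y ^ (m - 1))"
    using By by (simp add: pderiv_mult pderiv_smult pderiv_diff pderiv_monom poly_monom)
  moreover have "alg_dvd (of_nat l) (poly ?A y)"
    using alg_dvd_frobenius_int_poly[OF l(1) alg(1), of A] x(2) prime_gt_0_nat[OF l(1)]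
    by (simp add: y_def power_0_left)
  then obtain w where w: "alg_int w" "poly ?A y = of_nat l * w" by (auto simp: alg_dvd_def)
  ultimately have "of_nat l * (w * poly (pderiv ?B) y * y) = of_int c * (of_nat m * (y ^ (m - 1) * y))"
    by (simp add: mult_ac)
  also have "y ^ (m - 1) * y = 1" using m ym by (metis power_minus_mult)
  finally have "of_int (c * int m) = of_nat l * (w * poly (pderiv ?B) y * y)" by simp
  moreover have "alg_int (w * poly (pderiv ?B) y * y)"
    using w(1) alg by (intro alg_int_mult alg_int_poly) (auto simp: coeff_pderiv coeff_map_poly)
  ultimately have "int l dvd c * int m" by (rule rational_alg_int_dvd)
  then show False using l(2) by simp
qed

lemma int_poly_root_power_coprime:
  fixes x :: complex
  assumes factors: "\<And>z. poly (map_poly of_int A) z * poly (map_poly of_int B) z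
      = of_int c * (z ^ m - 1 :: complex)"
    and m: "m > 0" and x: "x ^ m = 1" "poly (map_poly of_int A) x = 0"
    and t: "coprime (int t) (c * int m)"
  shows "poly (map_poly of_int A) (x ^ t) = 0"
  using t
proof (induction t rule: less_induct)
  case (less t)
  consider "t = 0" | "t = 1" | "t > 1" by linarith
  then show ?case
  proof cases
    case 1
    then have "m = 1" using less.prems by (auto simp: zmult_eq_1_iff)
    then show ?thesis using x 1 by simp
  next
    case 2
    then show ?thesis using x(2) by simp
  next
    case 3
    then obtain l where l: "prime l" "l dvd t" using prime_factor_nat[of t] by auto
    then obtain u where u: "t = l * u" by blast
    have "u > 0" using 3 u by (cases u) auto
    then have "u < t" using u prime_gt_1_nat[OF l(1)] by simp
    moreover have "coprime (int u) (c * int m)" using less.prems u by simp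
    ultimately have "poly (map_poly of_int A) (x ^ u) = (0 :: complex)" by (rule less.IH)
    moreover have "(x ^ u) ^ m = 1" using x(1) by (metis mult.commute power_mult power_one)
    moreover have "\<not> int l dvd c * int m"
      using less.prems l coprime_common_divisor[of "int t" "c * int m" "int l"] by auto
    ultimately have "poly (map_poly of_int A) ((x ^ u) ^ l) = (0 :: complex)"
      using int_poly_root_power_prime[OF factors m] l(1) by blast
    then show ?thesis by (simp add: u power_mult[symmetric] mult.commute)
  qed
qed

lemma cyclotomic_conjugate:
  assumes g: "rat_poly_fun g" "g x = 0" and m: "m > 0" and x: "x ^ m = 1" and s: "coprime s m"
  shows "g (x ^ s) = 0"
proof -
  obtain Q where Q: "g = rat_eval Q" using g(1) by (auto simp: rat_poly_fun_def)
  define R :: "rat poly" where "R = Polynomial.monom 1 m + [:-1:]"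
  have R: "rat_eval R z = z ^ m - 1" for z by (simp add: R_def rat_eval_add rat_eval_monom)
  have "degree R = m" unfolding R_def using m by (subst degree_add_eq_left) (simp_all add: degree_monom_eq)
  then have "R \<noteq> 0" using m by auto
  moreover have "rat_eval R x = 0" using x by (simp add: R)
  ultimately obtain D where D: "rat_eval D x = 0" "\<And>B. rat_eval B x = 0 \<Longrightarrow> D dvd B"
    using minimal_rat_poly by blast
  obtain E B where EB: "Q = D * E" "R = D * B" using D(2) g(2) Q \<open>rat_eval R x = 0\<close> by (metis dvdE)
  obtain c A' where A': "c \<noteq> 0" "\<And>z. poly (map_poly of_int A') z = of_int c * rat_eval D z"
    using rat_poly_clear_denominators[of D] by blast
  obtain c' B' where B': "c' \<noteq> 0" "\<And>z. poly (map_poly of_int B') z = of_int c' * rat_eval B z"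
    using rat_poly_clear_denominators[of B] by blast
  have factors: "poly (map_poly of_int A') z * poly (map_poly of_int B') z
      = of_int (c * c') * (z ^ m - 1 :: complex)" for z
    unfolding A'(2) B'(2) R[symmetric] EB(2) rat_eval_mult by (simp add: mult_ac)
  have "m * nat \<bar>c * c'\<bar> > 0" using m A'(1) B'(1) by simp
  then obtain t where t: "[t = s] (mod m)" "coprime t (m * nat \<bar>c * c'\<bar>)"
    using exists_coprime_in_residue_class[OF s] by blast
  have "coprime (int t) (int (m * nat \<bar>c * c'\<bar>))" using t(2) by (simp only: coprime_int_iff)
  then have "coprime (int t) (c * c' * int m)" by simp
  then have "poly (map_poly of_int A') (x ^ t) = (0 :: complex)"
    using D(1) A'(2) by (intro int_poly_root_power_coprime[OF factors m x]) simp_all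
  then have "rat_eval D (x ^ t) = 0" using A' by simp
  moreover have "x ^ s = x ^ t" using root_of_unity_power_cong[OF x] t(1) by (metis cong_sym)
  ultimately show ?thesis by (simp add: Q EB(1) rat_eval_mult)
qed

end

section \<open>Stabilisers and degrees\<close>

lemma mem_cyc_field_iff:
  "x \<in> cyc_field e \<longleftrightarrow> (\<exists>r :: nat \<Rightarrow> rat. x = (\<Sum>j<e. of_rat (r j) * unity_root e (int j)))"
  by (simp add: cyc_field_def flip: exp_eq_unity_root)

lemma Rats_subset_cyc_field:
  assumes "e > 0"
  shows "\<rat> \<subseteq> cyc_field e"
proof
  fix x :: complex assume "x \<in> \<rat>"
  then obtain q where q: "x = of_rat q" by (auto elim: Rats_cases)
  have "(\<Sum>j<e. of_rat (if j = 0 then q else 0) * unity_root e (int j)) = (\<Sum>j<e. if j = 0 then x else 0)"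
    by (intro sum.cong) (auto simp: q)
  then show "x \<in> cyc_field e"
    using assms unfolding mem_cyc_field_iff by (intro exI[of _ "\<lambda>j. if j = 0 then q else 0"]) simp
qed

lemma cyc_field_1: "cyc_field 1 = \<rat>"
proof
  show "cyc_field 1 \<subseteq> \<rat>" by (auto simp: mem_cyc_field_iff)
qed (rule Rats_subset_cyc_field, simp)

lemma alg_degree_attained:
  assumes "Q \<noteq> 0" "\<And>i. poly.coeff Q i \<in> K" "poly Q x = 0"
  obtains R where "R \<noteq> 0" "degree R = alg_degree K x" "\<And>i. poly.coeff R i \<in> K" "poly R x = 0"
proof -
  have "\<exists>n. \<exists>R :: complex poly. R \<noteq> 0 \<and> degree R = n \<and> (\<forall>i. poly.coeff R i \<in> K) \<and> poly R x = 0"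
    using assms by blast
  then have "\<exists>R :: complex poly. R \<noteq> 0 \<and> degree R = alg_degree K x
      \<and> (\<forall>i. poly.coeff R i \<in> K) \<and> poly R x = 0"
    unfolding alg_degree_def by (rule LeastI_ex)
  then show thesis using that by blast
qed

lemma rat_poly_of_alg_int_multiple:
  assumes "alg_int (of_nat k * x)" "k > 0"
  obtains Q :: "complex poly" where "Q \<noteq> 0" "\<And>i. poly.coeff Q i \<in> \<rat>" "poly Q x = 0"
proof -
  obtain A :: "int poly" where A: "lead_coeff A = 1" "poly (map_poly of_int A) (of_nat k * x) = 0"
    using assms(1) unfolding alg_int_def by blast
  let ?A = "map_poly of_int A :: complex poly"
  have "poly.coeff ?A (degree A) = 1" using A(1) by (simp add: coeff_map_poly)
  then have "?A \<noteq> 0" by auto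
  show thesis
  proof (rule that)
    show "pcompose ?A [:0, of_nat k:] \<noteq> 0"
      using \<open>?A \<noteq> 0\<close> assms(2) by (subst pcompose_eq_0_iff) auto
    show "poly (pcompose ?A [:0, of_nat k:]) x = 0"
      using A(2) by (simp add: poly_pcompose mult.commute)
    show "poly.coeff (pcompose ?A [:0, of_nat k:]) i \<in> \<rat>" for i
      by (simp add: coeff_pcompose_linear coeff_map_poly)
  qed
qed

text \<open>The conjugates \<open>X t\<close> of \<open>X 1\<close> under the Galois group \<open>(\<int>/d)\<^sup>*\<close> of \<open>\<rat>(\<mu>\<^bsub>ed\<^esub>)\<close> over \<open>\<rat>(\<mu>\<^bsub>e\<^esub>)\<close>.\<close>

locale conjugate_family = prime_above +
  fixes e d :: nat and X :: "int \<Rightarrow> complex" and g :: "complex \<Rightarrow> complex"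
  assumes coprime_e_d: "coprime e d" and e_pos: "e > 0" and d_pos: "d > 0"
    and rat_poly_fun_g: "rat_poly_fun g"
    and g_eq: "[s = 1] (mod e) \<Longrightarrow> g (unity_root (e * d) (int s)) = X (int s)"
    and X_cong: "[k = l] (mod int d) \<Longrightarrow> X k = X l"
begin

definition lift :: "nat \<Rightarrow> nat" where
  "lift t = (SOME s. [s = 1] (mod e) \<and> [s = t] (mod d))"

lemma lift_cong_e: "[lift t = 1] (mod e)" and lift_cong_d: "[lift t = t] (mod d)"
  using someI_ex[OF binary_chinese_remainder_nat[OF coprime_e_d, of 1 t]] by (simp_all add: lift_def)

lemma coprime_lift:
  assumes "coprime t d"
  shows "coprime (lift t) (e * d)"
proof -
  have "coprime (lift t) e" using lift_cong_e by (metis cong_imp_coprime coprime_1_left cong_sym)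
  moreover have "coprime (lift t) d" using lift_cong_d assms by (metis cong_imp_coprime cong_sym)
  ultimately show ?thesis by simp
qed

lemma g_unity_root:
  assumes "[s = 1] (mod e)" "[s = t] (mod d)"
  shows "g (unity_root (e * d) (int s)) = X (int t)"
  using g_eq[OF assms(1)] X_cong[of "int s" "int t"] assms(2) by (simp add: cong_int_iff)

lemma conjugate_eq_0:
  assumes "rat_poly_fun h" "h (unity_root (e * d) 1) = 0" "coprime s (e * d)"
  shows "h (unity_root (e * d) (int s)) = 0"
proof -
  have "unity_root (e * d) 1 ^ (e * d) = 1"
    using e_pos d_pos by (simp add: unity_root_power unity_root_eq_1_iff)
  from cyclotomic_conjugate[OF assms(1,2) _ this assms(3)] show ?thesis
    using e_pos d_pos by (simp add: unity_root_power)
qed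

lemma X_mult_eq:
  assumes X: "X (int t) = X (int t')" and cop: "coprime u d"
  shows "X (int (t * u)) = X (int (t' * u))"
proof -
  let ?h = "\<lambda>z. g (z ^ lift t) - g (z ^ lift t')"
  have "rat_poly_fun ?h"
    by (intro rat_poly_fun_diff rat_poly_fun_comp_monom rat_poly_fun_g)
  moreover have "?h (unity_root (e * d) 1) = 0"
    using X g_unity_root[OF lift_cong_e lift_cong_d] by (simp add: unity_root_power)
  ultimately have "?h (unity_root (e * d) (int (lift u))) = 0"
    using coprime_lift[OF cop] by (rule conjugate_eq_0)
  then have "g (unity_root (e * d) (int (lift t * lift u))) = g (unity_root (e * d) (int (lift t' * lift u)))"
    by (simp add: unity_root_power)
  moreover have "g (unity_root (e * d) (int (lift t * lift u))) = X (int (t * u))" for t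
    using cong_mult[OF lift_cong_e lift_cong_e] cong_mult[OF lift_cong_d lift_cong_d]
    by (intro g_unity_root) simp_all
  ultimately show ?thesis by simp
qed

lemma X_mod: "X (int (t mod d)) = X (int t)"
  by (intro X_cong) (simp add: cong_def zmod_int)

definition stabiliser :: "nat set" where
  "stabiliser = {t \<in> units_mod d. X (int t) = X 1}"

lemma mod_mem_stabiliser_iff: "t mod d \<in> stabiliser \<longleftrightarrow> coprime t d \<and> X (int t) = X 1"
  using d_pos by (simp add: stabiliser_def mod_in_units_mod_iff X_mod)

sublocale stabiliser: unit_subgroup d stabiliser
proof
  have "1 mod d \<in> stabiliser" unfolding mod_mem_stabiliser_iff by simp
  then show "stabiliser \<noteq> {}" by blast
  show "stabiliser \<subseteq> units_mod d" by (auto simp: stabiliser_def)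
  fix s t assume st: "s \<in> stabiliser" "t \<in> stabiliser"
  then have "X (int (s * t)) = X (int (1 * t))"
    by (intro X_mult_eq) (auto simp: stabiliser_def units_mod_def)
  then show "s * t mod d \<in> stabiliser"
    using st by (simp add: mod_mem_stabiliser_iff) (simp add: stabiliser_def units_mod_def)
qed

text \<open>Multiplication by an inverse of \<open>t\<close> embeds the fibre through \<open>t\<close> into the stabiliser.\<close>

lemma card_fibre_le:
  assumes "y \<in> (\<lambda>t. X (int t)) ` units_mod d"
  shows "card {t \<in> units_mod d. X (int t) = y} \<le> card stabiliser"
proof -
  obtain t0 where t0: "t0 \<in> units_mod d" "y = X (int t0)" using assms by blast
  then obtain u where u: "[t0 * u = 1] (mod d)"
    using cong_solve_coprime_nat[of t0 d] by (auto simp: units_mod_def)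
  then have "coprime (t0 * u) d" by (metis cong_imp_coprime coprime_1_left cong_sym)
  then have cop: "coprime u d" by simp
  interpret units: unit_subgroup d "units_mod d" by (rule unit_subgroup_units_mod[OF d_pos])
  have "inj_on (\<lambda>t. t * u mod d) {t \<in> units_mod d. X (int t) = y}"
    using units.mult_inj[OF cop] by (rule inj_on_subset) auto
  moreover have "(\<lambda>t. t * u mod d) ` {t \<in> units_mod d. X (int t) = y} \<subseteq> stabiliser"
  proof clarify
    fix t assume t: "t \<in> units_mod d" "y = X (int t)"
    then have "X (int (t * u)) = X (int (t0 * u))" using t0(2) cop by (intro X_mult_eq) simp_all
    also have "\<dots> = X (int 1)" using u by (intro X_cong) (simp only: cong_int_iff)
    finally show "t * u mod d \<in> stabiliser"
      using t(1) cop by (simp add: mod_mem_stabiliser_iff) (simp add: units_mod_def)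
  qed
  ultimately show ?thesis using stabiliser.finite_H by (rule card_inj_on_le)
qed

lemma totient_le_card_conjugates:
  "totient d \<le> card ((\<lambda>t. X (int t)) ` units_mod d) * card stabiliser"
  using card_le_mult_card_image[OF finite_units_mod card_fibre_le]
  by (simp add: card_units_mod[OF d_pos] mult.commute)

lemma poly_cyc_field_conjugate_root:
  assumes coeffs: "\<And>i. poly.coeff R i \<in> cyc_field e" and root: "poly R (X 1) = 0" and cop: "coprime t d"
  shows "poly R (X (int t)) = 0"
proof -
  have "\<forall>i. \<exists>r :: nat \<Rightarrow> rat. poly.coeff R i = (\<Sum>j<e. of_rat (r j) * unity_root e (int j))"
    using coeffs unfolding mem_cyc_field_iff by blast
  from choice[OF this] obtain r :: "nat \<Rightarrow> nat \<Rightarrow> rat"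
    where r: "\<And>i. poly.coeff R i = (\<Sum>j<e. of_rat (r i j) * unity_root e (int j))" by blast
  define h where "h z = (\<Sum>i\<le>degree R. (\<Sum>j<e. of_rat (r i j) * z ^ (d * j)) * g z ^ i)" for z
  have h_eq: "h (unity_root (e * d) (int s)) = poly R (X (int t))"
    if s: "[s = 1] (mod e)" "[s = t] (mod d)" for s t
  proof -
    have "unity_root (e * d) (int s) ^ (d * j) = unity_root e (int j)" for j
      using unity_root_mult_power_cong_1[OF d_pos s(1)] unfolding mult.commute[of d e] .
    then show ?thesis by (simp add: h_def poly_altdef r g_unity_root[OF s])
  qed
  have "rat_poly_fun h"
    unfolding h_def
    by (intro rat_poly_fun_sum rat_poly_fun_mult rat_poly_fun_const rat_poly_fun_monom rat_poly_fun_power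
        rat_poly_fun_g)
  moreover have "h (unity_root (e * d) 1) = 0" using h_eq[of 1 1] root by simp
  ultimately have "h (unity_root (e * d) (int (lift t))) = 0"
    using coprime_lift[OF cop] by (rule conjugate_eq_0)
  then show ?thesis using h_eq[OF lift_cong_e lift_cong_d] by simp
qed

lemma card_conjugates_le_alg_degree:
  assumes "alg_int (of_nat k * X 1)" "k > 0"
  shows "card ((\<lambda>t. X (int t)) ` units_mod d) \<le> alg_degree (cyc_field e) (X 1)"
proof -
  obtain Q :: "complex poly" where Q: "Q \<noteq> 0" "\<And>i. poly.coeff Q i \<in> \<rat>" "poly Q (X 1) = 0"
    using rat_poly_of_alg_int_multiple[OF assms] by blast
  have "poly.coeff Q i \<in> cyc_field e" for i using Q(2) Rats_subset_cyc_field[OF e_pos] by blast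
  then obtain R where R: "R \<noteq> 0" "degree R = alg_degree (cyc_field e) (X 1)"
    "\<And>i. poly.coeff R i \<in> cyc_field e" "poly R (X 1) = 0"
    using alg_degree_attained[OF Q(1) _ Q(3)] by metis
  have "card ((\<lambda>t. X (int t)) ` units_mod d) \<le> card {x. poly R x = 0}"
    using poly_cyc_field_conjugate_root[OF R(3,4)]
    by (intro card_mono poly_roots_finite R(1)) (auto simp: units_mod_def)
  also have "\<dots> \<le> degree R" by (rule card_poly_roots_bound[OF R(1)])
  finally show ?thesis by (simp only: R(2))
qed

lemma stabiliser_index_le:
  assumes "alg_int (of_nat k * X 1)" "k > 0" "alg_degree (cyc_field e) (X 1) \<le> n"
  shows "unit_subgroup_index_le d stabiliser n"
proof
  have "totient d \<le> card ((\<lambda>t. X (int t)) ` units_mod d) * card stabiliser"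
    by (rule totient_le_card_conjugates)
  also have "\<dots> \<le> n * card stabiliser"
    using card_conjugates_le_alg_degree[OF assms(1,2)] assms(3) by (intro mult_right_mono) auto
  finally show "totient d \<le> n * card stabiliser" .
qed

end

section \<open>Valuations as orbit means\<close>

locale gauss_sums_level = gauss_sums +
  fixes d :: nat
  assumes d_dvd_N: "d dvd N"
begin

lemma d_pos: "d > 0"
  using d_dvd_N N_pos by (metis dvd_0_left not_gr_zero)

lemma N_eq: "N = N div d * d" and N_div_d_pos: "N div d > 0"
  using d_dvd_N N_pos by (simp_all add: div_greater_zero_iff dvd_imp_le d_pos)

lemma coprime_p_d: "coprime p d"
  using coprime_p_power_N[of 1] d_dvd_N by (simp add: coprime_divisors[of p p d N])

lemma N_dvd_iff: "int N dvd a * int (N div d) \<longleftrightarrow> int d dvd a"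
proof -
  have "int N = int (N div d) * int d" using N_eq by (metis of_nat_mult)
  then show ?thesis using N_div_d_pos by (simp add: mult.commute)
qed

lemma scale_cong: "[a = b] (mod int d) \<Longrightarrow> [a * int (N div d) = b * int (N div d)] (mod int N)"
  using N_dvd_iff[of "a - b"] by (simp add: cong_iff_dvd_diff left_diff_distrib)

lemma stickelberger_sum_scale:
  "stickelberger_sum p f N (a * int (N div d)) = stickelberger_sum p f d a"
  using stickelberger_sum_mult_cancel[OF N_div_d_pos, of p f d a] N_eq by (simp only: mult.commute)

lemma gauss_eq_G: "gauss P p c f d a = G (a * int (N div d))"
  unfolding gauss_def G_def chr_def N_def ..

lemma has_val_gauss: "\<not> int d dvd a \<Longrightarrow> has_val (gauss P p c f d a) (stickelberger_sum p f d a)"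
  using stickelberger[of "a * int (N div d)"] by (simp add: gauss_eq_G N_dvd_iff stickelberger_sum_scale)

lemma gauss_mult_p: "gauss P p c f d (int p * a) = gauss P p c f d a"
  unfolding gauss_eq_G mult.assoc by (rule G_mult_p)

lemma gauss_cong: "[a = b] (mod int d) \<Longrightarrow> gauss P p c f d a = gauss P p c f d b"
  unfolding gauss_eq_G by (intro G_cong scale_cong)

lemma chr_cong: "[a = b] (mod int d) \<Longrightarrow> z \<in> mu N \<Longrightarrow> chr (p ^ f) d a z = chr (p ^ f) d b z"
  unfolding chr_def N_def[symmetric]
  by (intro mu_power_int_cong) (simp_all add: scale_cong cong_minus_minus_iff)

lemma jacobi_cong:
  assumes "\<And>i. i \<le> w + 1 \<Longrightarrow> [a i = b i] (mod int d)"
  shows "jacobi P (p ^ f) d w a = jacobi P (p ^ f) d w b"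
  unfolding jacobi_def N_def[symmetric] using assms
  by (intro arg_cong2[where f = "(*)"] refl sum.cong prod.cong chr_cong) auto

lemma jacobi_eq_char_sum:
  "of_nat N * jacobi P (p ^ f) d w a = char_sum {..w+1} (\<lambda>i. a i * int (N div d)) 0"
  using N_pos unfolding jacobi_def char_sum_def tuples_def cong_P_0_iff chr_def N_def[symmetric] by simp

lemma jacobi_eq_prod_gauss:
  assumes "int d dvd (\<Sum>i\<le>w+1. a i)" "\<not> int d dvd a 0"
  shows "jacobi P (p ^ f) d w a = (\<Prod>i\<le>w+1. - gauss P p c f d (a i)) * of_nat p powi (- int f)"
proof -
  have "of_nat N * (\<Prod>i\<le>w+1. - gauss P p c f d (a i))
      = of_nat (p ^ f) * char_sum {..w+1} (\<lambda>i. a i * int (N div d)) 0"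
    unfolding gauss_eq_G
  proof (rule prod_G_eq_char_sum_0[of _ _ 0])
    show "int N dvd (\<Sum>i\<le>w+1. a i * int (N div d))"
      using assms(1) by (simp only: sum_distrib_right[symmetric] N_dvd_iff)
  qed (use assms(2) in \<open>simp_all add: N_dvd_iff\<close>)
  also have "\<dots> = of_nat N * (of_nat p ^ f * jacobi P (p ^ f) d w a)"
    unfolding jacobi_eq_char_sum[symmetric] by (simp add: mult_ac)
  finally have "(\<Prod>i\<le>w+1. - gauss P p c f d (a i)) = of_nat p ^ f * jacobi P (p ^ f) d w a"
    by (simp only: mult_cancel_left of_nat_eq_0_iff N_nonzero simp_thms)
  then show ?thesis by (simp add: power_int_minus)
qed

lemma has_val_jacobi:
  assumes "int d dvd (\<Sum>i\<le>w+1. a i)" "\<And>i. i \<le> w + 1 \<Longrightarrow> \<not> int d dvd a i"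
  shows "has_val (jacobi P (p ^ f) d w a) ((\<Sum>i\<le>w+1. stickelberger_sum p f d (a i)) - real f)"
proof -
  have "has_val ((\<Prod>i\<le>w+1. - gauss P p c f d (a i)) * of_nat p powi (- int f))
    ((\<Sum>i\<le>w+1. stickelberger_sum p f d (a i)) + real_of_int (- int f))"
    using assms by (intro has_val_mult has_val_prod has_val_p_power_int has_val_uminus has_val_gauss) auto
  then show ?thesis using assms jacobi_eq_prod_gauss[of a w] by simp
qed

lemma jacobi_mult_p:
  assumes "int d dvd (\<Sum>i\<le>w+1. a i)" "\<not> int d dvd a 0"
  shows "jacobi P (p ^ f) d w (\<lambda>i. int p * a i) = jacobi P (p ^ f) d w a"
proof -
  have "int d dvd (\<Sum>i\<le>w+1. int p * a i)"
    using assms(1) by (simp only: sum_distrib_left[symmetric] dvd_mult)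
  moreover have "\<not> int d dvd int p * a 0"
    using assms(2) coprime_p_d by (simp add: int_dvd_coprime_mult_iff)
  ultimately show ?thesis
    using jacobi_eq_prod_gauss[of "\<lambda>i. int p * a i" w]
    unfolding jacobi_eq_prod_gauss[OF assms] gauss_mult_p by simp
qed

lemma chr_eq_unity_root_exists:
  assumes "z \<in> mu N"
  shows "\<exists>l :: nat. \<forall>t. chr (p ^ f) d (t * a) z = unity_root d (t * int l)"
proof -
  obtain k :: nat where z: "z = unity_root N (int k)" using assms N_pos by (rule mu_E)
  define l where "l = nat ((- a * int k) mod int d)"
  have l: "[- a * int k = int l] (mod int d)" using d_pos by (simp add: l_def cong_def)
  show ?thesis
  proof (intro exI allI)
    fix t
    have "chr (p ^ f) d (t * a) z = unity_root N (- (t * a * int (N div d)) * int k)"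
      unfolding chr_def z N_def[symmetric] by (simp add: unity_root_def cis_power_int mult_ac)
    also have "- (t * a * int (N div d)) * int k = int (N div d) * (t * (- a * int k))"
      by (simp add: mult_ac)
    also have "unity_root N \<dots> = unity_root d (t * (- a * int k))"
      using unity_root_mult_cancel[OF N_div_d_pos, of d "t * (- a * int k)"] unfolding N_eq[symmetric] .
    also have "\<dots> = unity_root d (t * int l)" by (intro unity_root_cong cong_mult cong_refl l)
    finally show "chr (p ^ f) d (t * a) z = unity_root d (t * int l)" .
  qed
qed

definition chr_exponent :: "int \<Rightarrow> complex \<Rightarrow> nat" where
  "chr_exponent a z = (SOME l. \<forall>t. chr (p ^ f) d (t * a) z = unity_root d (t * int l))"

lemma chr_eq_unity_root:
  "z \<in> mu N \<Longrightarrow> chr (p ^ f) d (t * a) z = unity_root d (t * int (chr_exponent a z))"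
  using someI_ex[OF chr_eq_unity_root_exists] unfolding chr_exponent_def by blast

definition psi_exponent :: "complex \<Rightarrow> nat" where
  "psi_exponent z = nat ((c * trace_int P p f z) mod int p)"

lemma psi_eq_unity_root_exponent: "\<psi> z = unity_root p (int (psi_exponent z))"
  unfolding psi_eq_unity_root using p_pos by (intro unity_root_cong) (simp add: psi_exponent_def cong_def)

definition gauss_fun :: "int \<Rightarrow> complex \<Rightarrow> complex" where
  "gauss_fun a y = - (\<Sum>z\<in>mu N. y ^ (p * chr_exponent a z) * y ^ (d * psi_exponent z))"

lemma gauss_conjugate_family: "conjugate_family P p p d (\<lambda>t. gauss P p c f d (t * a)) (gauss_fun a)"
proof
  show "rat_poly_fun (gauss_fun a)"
    unfolding gauss_fun_def
    by (intro rat_poly_fun_uminus rat_poly_fun_sum rat_poly_fun_mult rat_poly_fun_monom)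
  show "gauss P p c f d (k * a) = gauss P p c f d (l * a)" if "[k = l] (mod int d)" for k l
    by (intro gauss_cong cong_mult that cong_refl)
  fix s assume s: "[s = 1] (mod p)"
  let ?y = "unity_root (p * d) (int s)"
  have "?y ^ (p * chr_exponent a z) * ?y ^ (d * psi_exponent z) = chr (p ^ f) d (int s * a) z * \<psi> z"
    if "z \<in> mu N" for z
  proof -
    have "?y ^ (d * psi_exponent z) = \<psi> z"
      using unity_root_mult_power_cong_1[OF d_pos s]
      unfolding mult.commute[of d p] psi_eq_unity_root_exponent .
    then show ?thesis
      using chr_eq_unity_root[OF that] p_pos by (simp add: unity_root_mult_power)
  qed
  then show "gauss_fun a ?y = gauss P p c f d (int s * a)"
    unfolding gauss_fun_def gauss_def N_def[symmetric] by simp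
qed (use coprime_p_d p_pos d_pos in auto)

definition jacobi_fun :: "nat \<Rightarrow> (nat \<Rightarrow> int) \<Rightarrow> complex \<Rightarrow> complex" where
  "jacobi_fun w a y = of_rat (1 / of_nat N) *
     (\<Sum>x\<in>{x \<in> PiE {..w+1} (\<lambda>_. mu N). (\<Sum>i\<le>w+1. x i) \<in> P}. \<Prod>i\<le>w+1. y ^ chr_exponent (a i) (x i))"

lemma jacobi_conjugate_family:
  "conjugate_family P p 1 d (\<lambda>t. jacobi P (p ^ f) d w (\<lambda>i. t * a i)) (jacobi_fun w a)"
proof
  show "rat_poly_fun (jacobi_fun w a)"
    unfolding jacobi_fun_def
    by (rule rat_poly_fun_mult[OF rat_poly_fun_const], rule rat_poly_fun_sum, rule rat_poly_fun_prod,
        rule rat_poly_fun_monom)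
  show "jacobi P (p ^ f) d w (\<lambda>i. k * a i) = jacobi P (p ^ f) d w (\<lambda>i. l * a i)"
    if "[k = l] (mod int d)" for k l
    by (intro jacobi_cong cong_mult that cong_refl)
  fix s
  let ?X = "{x \<in> PiE {..w+1} (\<lambda>_. mu N). (\<Sum>i\<le>w+1. x i) \<in> P}"
  have "(\<Sum>x\<in>?X. \<Prod>i\<le>w+1. unity_root d (int s) ^ chr_exponent (a i) (x i))
      = (\<Sum>x\<in>?X. \<Prod>i\<le>w+1. chr (p ^ f) d (int s * a i) (x i))"
  proof (intro sum.cong prod.cong refl)
    fix x i assume "x \<in> ?X" "i \<in> {..w+1}"
    then have "x i \<in> mu N" by (auto simp only: mem_Collect_eq intro: PiE_mem)
    from chr_eq_unity_root[OF this]
    show "unity_root d (int s) ^ chr_exponent (a i) (x i) = chr (p ^ f) d (int s * a i) (x i)"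
      by (simp add: unity_root_power mult.commute)
  qed
  then show "jacobi_fun w a (unity_root (1 * d) (int s)) = jacobi P (p ^ f) d w (\<lambda>i. int s * a i)"
    unfolding jacobi_fun_def jacobi_def N_def[symmetric]
    by (simp only: mult_1 of_rat_divide of_rat_of_nat_eq of_rat_1)
qed (use d_pos in auto)

lemma sum_stickelberger_sum:
  assumes "unit_subgroup d H" and p: "p mod d \<in> H"
  shows "(\<Sum>t\<in>H. stickelberger_sum p f d (int t * a)) = real (card H) * (real f * orbit_mean d H a)"
proof -
  interpret unit_subgroup d H by fact
  have "(\<Sum>t\<in>H. mod_frac d (int (p ^ i) * (int t * a))) = (\<Sum>t\<in>H. mod_frac d (int t * a))" for i
  proof -
    have "(\<Sum>t\<in>H. mod_frac d (int (p ^ i) * (int t * a)))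
        = (\<Sum>t\<in>H. mod_frac d (int t * (int (p ^ i mod d) * a)))"
      unfolding mult.left_commute[of "int (p ^ i)"]
      by (intro sum.cong refl mod_frac_cong cong_mult cong_refl) (simp add: cong_def zmod_int)
    also have "\<dots> = (\<Sum>t\<in>H. mod_frac d (int t * a))"
      by (rule sum_dilate[OF power_mod_mem[OF p] mod_frac_cong])
    finally show ?thesis .
  qed
  then have "(\<Sum>t\<in>H. stickelberger_sum p f d (int t * a)) = real f * (\<Sum>t\<in>H. mod_frac d (int t * a))"
    unfolding stickelberger_sum_def by (subst sum.swap) simp
  then show ?thesis using nonempty by (simp add: orbit_mean_def)
qed

lemma val_gauss_eq_orbit_mean:
  assumes degree: "alg_degree (cyc_field p) (gauss P p c f d a) \<le> n" and a: "\<not> int d dvd a"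
  obtains H where "unit_subgroup_index_le d H n" "val P p (gauss P p c f d a) = real f * orbit_mean d H a"
proof -
  interpret X: conjugate_family P p p d "\<lambda>t. gauss P p c f d (t * a)" "gauss_fun a"
    by (rule gauss_conjugate_family)
  let ?v = "val P p (gauss P p c f d a)" and ?H = X.stabiliser
  have "?v = stickelberger_sum p f d (int t * a)" if t: "t \<in> ?H" for t
    using val_eq_if_has_val[OF has_val_gauss, of "int t * a"] a t X.stabiliser.coprime[OF t]
    by (simp add: int_dvd_coprime_mult_iff X.stabiliser_def)
  then have "(\<Sum>t\<in>?H. ?v) = (\<Sum>t\<in>?H. stickelberger_sum p f d (int t * a))"
    by (intro sum.cong refl)
  then have "real (card ?H) * ?v = (\<Sum>t\<in>?H. stickelberger_sum p f d (int t * a))" by simp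
  also have "\<dots> = real (card ?H) * (real f * orbit_mean d ?H a)"
    using coprime_p_d by (intro sum_stickelberger_sum X.stabiliser.unit_subgroup_axioms)
      (simp add: X.mod_mem_stabiliser_iff gauss_mult_p)
  finally have "?v = real f * orbit_mean d ?H a" using X.stabiliser.nonempty by simp
  moreover have "unit_subgroup_index_le d ?H n"
    using degree by (intro X.stabiliser_index_le[of 1]) (simp_all add: gauss_eq_G alg_int_G)
  ultimately show thesis using that by blast
qed

lemma val_jacobi_eq_orbit_mean:
  assumes degree: "alg_degree \<rat> (jacobi P (p ^ f) d w a) \<le> n"
    and sum: "int d dvd (\<Sum>i\<le>w+1. a i)" and a: "\<And>i. i \<le> w + 1 \<Longrightarrow> \<not> int d dvd a i"
  obtains H where "unit_subgroup_index_le d H n"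
    "val P p (jacobi P (p ^ f) d w a) = real f * ((\<Sum>i\<le>w+1. orbit_mean d H (a i)) - 1)"
proof -
  interpret X: conjugate_family P p 1 d "\<lambda>t. jacobi P (p ^ f) d w (\<lambda>i. t * a i)" "jacobi_fun w a"
    by (rule jacobi_conjugate_family)
  let ?v = "val P p (jacobi P (p ^ f) d w a)" and ?H = X.stabiliser
  have v: "?v = (\<Sum>i\<le>w+1. stickelberger_sum p f d (int t * a i)) - real f" if t: "t \<in> ?H" for t
  proof -
    have "has_val (jacobi P (p ^ f) d w (\<lambda>i. int t * a i))
        ((\<Sum>i\<le>w+1. stickelberger_sum p f d (int t * a i)) - real f)"
      using sum a int_dvd_coprime_mult_iff[OF X.stabiliser.coprime[OF t]]
      by (intro has_val_jacobi) (simp_all only: sum_distrib_left[symmetric] not_False_eq_True)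
    from val_eq_if_has_val[OF this] t show ?thesis by (simp add: X.stabiliser_def)
  qed
  have "p mod d \<in> ?H"
    using coprime_p_d jacobi_mult_p[OF sum a] by (simp add: X.mod_mem_stabiliser_iff)
  note sum_orbit = sum_stickelberger_sum[OF X.stabiliser.unit_subgroup_axioms this]
  have "real (card ?H) * ?v = (\<Sum>t\<in>?H. ?v)" by simp
  also have "\<dots> = (\<Sum>t\<in>?H. (\<Sum>i\<le>w+1. stickelberger_sum p f d (int t * a i)) - real f)"
    by (intro sum.cong refl v)
  also have "\<dots> = (\<Sum>i\<le>w+1. \<Sum>t\<in>?H. stickelberger_sum p f d (int t * a i)) - real (card ?H) * real f"
    unfolding sum_subtractf by (subst sum.swap) simp
  also have "\<dots> = real (card ?H) * (real f * ((\<Sum>i\<le>w+1. orbit_mean d ?H (a i)) - 1))"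
    by (simp add: sum_orbit sum_distrib_left algebra_simps)
  finally have "?v = real f * ((\<Sum>i\<le>w+1. orbit_mean d ?H (a i)) - 1)" using X.stabiliser.nonempty by simp
  moreover have "unit_subgroup_index_le d ?H n"
    using degree cyc_field_1 jacobi_eq_char_sum[of w a] alg_int_char_sum
    by (intro X.stabiliser_index_le[of N]) simp_all
  ultimately show thesis using that by blast
qed

end

lemma gauss_sums_levelI:
  assumes "prime p" "prime_over P p" "\<not> int p dvd c" "f > 0" "p ^ f mod d = 1 mod d"
  shows "gauss_sums_level P p f c d"
proof -
  interpret gauss_sums P p f c by unfold_locales (use assms in auto)
  have "[p ^ f = 1] (mod d)" using assms(5) by (simp add: cong_def)
  then have "d dvd N" by (simp add: cong_altdef_nat flip: Suc_N)
  then show ?thesis by unfold_locales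
qed

lemma val_gauss_near_half:
  assumes "\<epsilon> > 0"
  obtains C where "\<And>p P c d f a. prime p \<Longrightarrow> prime_over P p \<Longrightarrow> \<not> int p dvd c \<Longrightarrow> d > C \<Longrightarrow> f > 0 \<Longrightarrow>
    p ^ f mod d = 1 mod d \<Longrightarrow> coprime a (int d) \<Longrightarrow>
    alg_degree (cyc_field p) (gauss P p c f d a) \<le> n \<Longrightarrow>
    \<bar>val P p (gauss P p c f d a) / real f - 1 / 2\<bar> < \<epsilon>"
proof -
  obtain B where B: "\<And>d H a. d > B \<Longrightarrow> unit_subgroup_index_le d H n \<Longrightarrow> coprime a (int d) \<Longrightarrow>
      \<bar>orbit_mean d H a - 1 / 2\<bar> < \<epsilon>"
    using orbit_mean_equidistributed_coprime[OF assms] by blast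
  show thesis
  proof (rule that[of "max B 1"])
    fix p P c d f and a :: int
    assume f: "f > 0" and d: "d > max B 1" and a: "coprime a (int d)"
      and degree: "alg_degree (cyc_field p) (gauss P p c f d a) \<le> n"
      and level: "prime p" "prime_over P p" "\<not> int p dvd c" "p ^ f mod d = 1 mod d"
    interpret gauss_sums_level P p f c d by (intro gauss_sums_levelI f level)
    have "\<not> int d dvd a"
      using a d coprime_common_divisor[of a "int d" "int d"] by auto
    then obtain H where "unit_subgroup_index_le d H n" "val P p (gauss P p c f d a) = real f * orbit_mean d H a"
      using val_gauss_eq_orbit_mean[OF degree] by blast
    then show "\<bar>val P p (gauss P p c f d a) / real f - 1 / 2\<bar> < \<epsilon>"
      using B[of d H a] d a f by simp
  qed
qed

lemma val_jacobi_bounded_below: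
  obtains C \<epsilon> where "\<epsilon> > 0"
    "\<And>p P d f w a. prime p \<Longrightarrow> prime_over P p \<Longrightarrow> d > C \<Longrightarrow> f > 0 \<Longrightarrow> p ^ f mod d = 1 mod d \<Longrightarrow>
      w \<ge> 1 \<Longrightarrow> a \<in> A'_set d w \<Longrightarrow> alg_degree \<rat> (jacobi P (p ^ f) d w a) \<le> n \<Longrightarrow>
      val P p (jacobi P (p ^ f) d w a) / real f > \<epsilon>"
proof -
  obtain C \<epsilon> where C: "\<epsilon> > 0" "\<And>d H w a. d > C \<Longrightarrow> unit_subgroup_index_le d H n \<Longrightarrow> w \<ge> 1 \<Longrightarrow>
      a \<in> A'_set d w \<Longrightarrow> (\<Sum>i\<le>w+1. orbit_mean d H (a i)) > 1 + \<epsilon>"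
    by (rule sum_orbit_mean_gt[of n]) (rule that; blast)
  show thesis
  proof (rule that[OF C(1), of C])
    fix p P d f w and a :: "nat \<Rightarrow> int"
    assume level: "prime p" "prime_over P p" "p ^ f mod d = 1 mod d" and f: "f > 0" and d: "d > C"
      and w: "w \<ge> 1" and a: "a \<in> A'_set d w" and degree: "alg_degree \<rat> (jacobi P (p ^ f) d w a) \<le> n"
    have "\<not> int p dvd 1" using prime_gt_1_nat[OF level(1)] by simp
    then interpret gauss_sums_level P p f 1 d by (intro gauss_sums_levelI f level)
    obtain H where H: "unit_subgroup_index_le d H n"
      "val P p (jacobi P (p ^ f) d w a) = real f * ((\<Sum>i\<le>w+1. orbit_mean d H (a i)) - 1)"
      using val_jacobi_eq_orbit_mean[OF degree] a by (auto simp: A'_set_def)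
    then show "val P p (jacobi P (p ^ f) d w a) / real f > \<epsilon>"
      using C(2)[OF d H(1) w a] f by simp
  qed
qed

theorem theorem2p4:
  shows "(\<forall>(\<epsilon>::real) > 0. \<forall>n::nat > 0. \<exists>C::real. \<forall>p P c d f a.
            prime p \<longrightarrow> prime_over P p \<longrightarrow> \<not> int p dvd c \<longrightarrow>
            real d > C \<longrightarrow> f > 0 \<longrightarrow> p ^ f mod d = 1 mod d \<longrightarrow> coprime a (int d) \<longrightarrow>
            alg_degree (cyc_field p) (gauss P p c f d a) \<le> n \<longrightarrow>
            \<bar>val P p (gauss P p c f d a) / real f - 1 / 2\<bar> < \<epsilon>)
       \<and> (\<forall>n::nat > 0. \<exists>C::real. \<exists>\<epsilon>::real > 0. \<forall>p P d f w a.
            prime p \<longrightarrow> prime_over P p \<longrightarrow>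
            real d > C \<longrightarrow> f > 0 \<longrightarrow> p ^ f mod d = 1 mod d \<longrightarrow> w \<ge> 1 \<longrightarrow> a \<in> A'_set d w \<longrightarrow>
            alg_degree \<rat> (jacobi P (p ^ f) d w a) \<le> n \<longrightarrow>
            val P p (jacobi P (p ^ f) d w a) / real f > \<epsilon>)"
    (is "(\<forall>\<epsilon>>0. \<forall>n>0. ?gauss \<epsilon> n) \<and> (\<forall>n>0. ?jacobi n)")
proof (intro conjI allI impI)
  fix \<epsilon> :: real and n :: nat
  assume "\<epsilon> > 0"
  then show "?gauss \<epsilon> n"
    by (rule val_gauss_near_half[of _ n])
      (rule exI[of _ "real C" for C], simp only: of_nat_less_iff, blast)
next
  fix n :: nat
  show "?jacobi n"
    by (rule val_jacobi_bounded_below[of n])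
      (rule exI[of _ "real C" for C], simp only: of_nat_less_iff, blast)
qed

end
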